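(* Let $k$ be an algebraically closed field of characteristic $p$ with $2<p\leq 23$, and let $\mathrm{Hilb}^5(\mathbb{A}^2_k)$ be equipped with the Frobenius splitting induced from the standard splitting of $\mathbb{A}^2_k$. Then the one-dimensional subvariety $$Y = \{\langle y^3, xy^2, x^2y, x^3, ay^2+cx^2\rangle : [a,c]\in\mathbb{P}^1_k\}\subseteq \mathrm{Hilb}^5(\mathbb{A}^2_k)$$ is not compatibly split.
   Context: Points of $\mathrm{Hilb}^n(\mathbb{A}^2_k)$ are written as colength-$n$ ideals of $k[x,y]$. Subvarieties are closed, reduced and irreducible. A Frobenius splitting of a $k$-scheme $X$ is an $\mathcal{O}_X$-linear map $\phi:F_*\mathcal{O}_X\to\mathcal{O}_X$ with $\phi\circ F^\sharp=\mathrm{id}$; a closed subscheme $Y$ is compatibly split if $\phi(F_*\mathcal{I}_Y)\subseteq\mathcal{I}_Y$. The standard splitting of $\mathbb{A}^N_k=\mathrm{Spec}\,k[z_1,\dots,z_N]$ is $\mathrm{Tr}((z_1\cdots z_N)^{p-1}\cdot)$, where $\mathrm{Tr}$ is additive, satisfies $\mathrm{Tr}(c^pg)=c\,\mathrm{Tr}(g)$ for $c\in k$, and sends a monomial $m$ to $(z_1\cdots z_N m)^{1/p}/(z_1\cdots z_N)$ if $z_1\cdots z_Nm$ is a $p$-th power and to $0$ otherwise. The standard splitting of $(\mathbb{A}^2_k)^n$ preserves $S_n$-invariants, hence induces a splitting of $(\mathbb{A}^2_k)^n/S_n$; the induced splitting of $\mathrm{Hilb}^n(\mathbb{A}^2_k)$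 (which exists for all $p>2$, by Kumar–Thomsen) is the unique splitting agreeing with it on the open locus of $n$ distinct points. *)

theory Defs
  imports
    "HOL-Analysis.Analysis"
    "HOL-Computational_Algebra.Polynomial"
    "HOL-Library.Poly_Mapping"
    "HOL-Library.Multiset"
begin

section \<open>Varieties as spaces with functions\<close>

text \<open>
  Over an algebraically closed field a variety (reduced scheme of finite type) is treated
  classically: its closed points, the Zariski topology on them, and the sheaf of regular
  functions. A section over an open set \<open>U\<close> is a function that is \<open>undefined\<close> outside
  \<open>U\<close>, so restriction of sections is the library's \<^const>\<open>restrict\<close>.
\<close>

record ('a, 'k) space =
  zariski :: "'a topology"
  regular :: "'a set \<Rightarrow> ('a \<Rightarrow> 'k) set"

type_synonym ('v, 'k) mpoly = "('v \<Rightarrow>\<^sub>0 nat) \<Rightarrow>\<^sub>0 'k"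

definition peval :: "('v, 'k::comm_semiring_1) mpoly \<Rightarrow> ('v \<Rightarrow> 'k) \<Rightarrow> 'k" where
  "peval P z = (\<Sum>m\<in>Poly_Mapping.keys P.
     Poly_Mapping.lookup P m * (\<Prod>v\<in>Poly_Mapping.keys m. z v ^ Poly_Mapping.lookup m v))"

text \<open>
  A chart \<open>(D, c)\<close> consists of an affine open set \<open>D\<close> of points and a family \<open>c\<close> of functions
  generating its coordinate ring. Regular functions are locally quotients of polynomials in the
  coordinates of some chart.
\<close>

definition charts_topology :: "('a set \<times> ('a \<Rightarrow> 'v \<Rightarrow> 'k::field)) set \<Rightarrow> 'a topology" where
  "charts_topology \<C> = topology_generated_by
     {{x \<in> D. peval P (c x) \<noteq> 0} | D c P. (D, c) \<in> \<C>}"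

definition charts_regular ::
    "('a set \<times> ('a \<Rightarrow> 'v \<Rightarrow> 'k::field)) set \<Rightarrow> 'a set \<Rightarrow> ('a \<Rightarrow> 'k) set" where
  "charts_regular \<C> U = {f \<in> extensional U. \<forall>x\<in>U. \<exists>(D, c)\<in>\<C>. \<exists>W P Q.
     openin (charts_topology \<C>) W \<and> x \<in> W \<and> W \<subseteq> U \<inter> D \<and>
     (\<forall>y\<in>W. peval Q (c y) \<noteq> 0 \<and> f y = peval P (c y) / peval Q (c y))}"

definition variety_of_charts ::
    "('a set \<times> ('a \<Rightarrow> 'v \<Rightarrow> 'k::field)) set \<Rightarrow> ('a, 'k) space" where
  "variety_of_charts \<C> = \<lparr>zariski = charts_topology \<C>, regular = charts_regular \<C>\<rparr>"

text \<open>The affine space with coordinates indexed by \<open>V\<close>.\<close>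

definition affine_space :: "'v set \<Rightarrow> ('v \<Rightarrow> 'k::field, 'k) space" where
  "affine_space V = variety_of_charts {(V \<rightarrow>\<^sub>E UNIV, \<lambda>z. z)}"

definition map_preimage :: "('a, 'k) space \<Rightarrow> ('a \<Rightarrow> 'b) \<Rightarrow> 'b set \<Rightarrow> 'a set" where
  "map_preimage X h U = {x \<in> topspace (zariski X). h x \<in> U}"

definition pullback ::
    "('a, 'k) space \<Rightarrow> ('a \<Rightarrow> 'b) \<Rightarrow> 'b set \<Rightarrow> ('b \<Rightarrow> 'k) \<Rightarrow> 'a \<Rightarrow> 'k" where
  "pullback X h U f = (\<lambda>x\<in>map_preimage X h U. f (h x))"

text \<open>
  The quotient of \<open>X\<close> by the equivalence relation with classes the fibres of \<open>q\<close>: the quotient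
  topology, and as sections the sections upstairs that are constant on the fibres. For the orbit
  map of a finite group acting on an affine variety this is the geometric quotient.
\<close>

definition quotient_space :: "('a, 'k) space \<Rightarrow> ('a \<Rightarrow> 'b) \<Rightarrow> ('b, 'k) space" where
  "quotient_space X q =
    \<lparr>zariski = topology (\<lambda>U. U \<subseteq> q ` topspace (zariski X) \<and>
                               openin (zariski X) (map_preimage X q U)),
     regular = (\<lambda>U. {f \<in> extensional U. pullback X q U f \<in> regular X (map_preimage X q U)})\<rparr>"

lemma istopology_quotient:
  "istopology (\<lambda>U. U \<subseteq> q ` topspace (zariski X) \<and> openin (zariski X) (map_preimage X q U))"
proof -
  have "openin (zariski X) (map_preimage X q (S \<inter> T))"
    if "openin (zariski X) (map_preimage X q S)" "openin (zariski X) (map_preimage X q T)" for S T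
  proof -
    have "map_preimage X q (S \<inter> T) = map_preimage X q S \<inter> map_preimage X q T"
      by (auto simp: map_preimage_def)
    then show ?thesis using that by auto
  qed
  moreover have "openin (zariski X) (map_preimage X q (\<Union>\<K>))"
    if "\<And>K. K \<in> \<K> \<Longrightarrow> openin (zariski X) (map_preimage X q K)" for \<K>
  proof -
    have "map_preimage X q (\<Union>\<K>) = (\<Union>K\<in>\<K>. map_preimage X q K)"
      by (auto simp: map_preimage_def)
    then show ?thesis using that by auto
  qed
  ultimately show ?thesis
    unfolding istopology_def by blast
qed

section \<open>Frobenius splittings\<close>

type_synonym ('a, 'k) sheaf_map = "'a set \<Rightarrow> ('a \<Rightarrow> 'k) \<Rightarrow> 'a \<Rightarrow> 'k"

text \<open>
  The Frobenius morphism is the identity on points and the \<open>p\<close>-th power map on functions, so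
  \<open>f\<close> acts on \<open>F\<^sub>*\<O>\<close> as multiplication by \<open>f ^ p\<close>.
\<close>

definition frobenius_splitting :: "('a, 'k::field) space \<Rightarrow> ('a, 'k) sheaf_map \<Rightarrow> bool" where
  "frobenius_splitting X \<phi> \<longleftrightarrow> (\<forall>U. openin (zariski X) U \<longrightarrow>
     (\<forall>f\<in>regular X U. \<phi> U f \<in> regular X U) \<and>
     (\<forall>W. \<forall>f\<in>regular X U. openin (zariski X) W \<and> W \<subseteq> U \<longrightarrow>
        \<phi> W (restrict f W) = restrict (\<phi> U f) W) \<and>
     (\<forall>f\<in>regular X U. \<forall>g\<in>regular X U.
        \<phi> U (\<lambda>x\<in>U. f x + g x) = (\<lambda>x\<in>U. \<phi> U f x + \<phi> U g x)) \<and>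
     (\<forall>f\<in>regular X U. \<forall>g\<in>regular X U.
        \<phi> U (\<lambda>x\<in>U. f x ^ CHAR('k) * g x) = (\<lambda>x\<in>U. f x * \<phi> U g x)) \<and>
     (\<forall>f\<in>regular X U. \<phi> U (\<lambda>x\<in>U. f x ^ CHAR('k)) = f))"

text \<open>The ideal sheaf of a closed set \<open>Y\<close> with its reduced structure.\<close>

definition ideal_sheaf :: "('a, 'k::field) space \<Rightarrow> 'a set \<Rightarrow> 'a set \<Rightarrow> ('a \<Rightarrow> 'k) set" where
  "ideal_sheaf X Y U = {f \<in> regular X U. \<forall>x\<in>U \<inter> Y. f x = 0}"

definition compatibly_split ::
    "('a, 'k::field) space \<Rightarrow> ('a, 'k) sheaf_map \<Rightarrow> 'a set \<Rightarrow> bool" where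
  "compatibly_split X \<phi> Y \<longleftrightarrow>
     (\<forall>U. openin (zariski X) U \<longrightarrow> \<phi> U ` ideal_sheaf X Y U \<subseteq> ideal_sheaf X Y U)"

text \<open>
  The splitting \<open>\<psi>\<close> of \<open>Z\<close> agrees over the open set \<open>D\<close> with the splitting \<open>\<phi>\<close> of \<open>X\<close>, when functions
  on \<open>D\<close> are regarded as functions on \<open>X\<close> via the map \<open>h\<close>.
\<close>

definition agrees_along ::
    "('a, 'k::field) space \<Rightarrow> ('a, 'k) sheaf_map \<Rightarrow> ('a \<Rightarrow> 'b) \<Rightarrow>
     ('b, 'k) space \<Rightarrow> ('b, 'k) sheaf_map \<Rightarrow> 'b set \<Rightarrow> bool" where
  "agrees_along X \<phi> h Z \<psi> D \<longleftrightarrow>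
     (\<forall>U. openin (zariski Z) U \<and> U \<subseteq> D \<longrightarrow> (\<forall>f\<in>regular Z U.
        pullback X h U (\<psi> U f) = \<phi> (map_preimage X h U) (pullback X h U f)))"

section \<open>The standard splitting of affine space\<close>

definition frobenius_root :: "'k::alg_closed_field \<Rightarrow> 'k" where
  "frobenius_root a = (THE c. c ^ CHAR('k) = a)"

definition all_ones :: "'v set \<Rightarrow> ('v \<Rightarrow>\<^sub>0 nat)" where
  "all_ones V = (\<Sum>v\<in>V. Poly_Mapping.single v 1)"

text \<open>
  In exponents, a monomial \<open>m\<close> goes to \<open>(all_ones V + m) / p - all_ones V\<close> if \<open>p\<close> divides every
  entry of \<open>all_ones V + m\<close>, and to \<open>0\<close> otherwise.
\<close>

definition frobenius_trace ::
    "'v set \<Rightarrow> ('v, 'k::alg_closed_field) mpoly \<Rightarrow> ('v, 'k) mpoly" where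
  "frobenius_trace V g = (\<Sum>m\<in>Poly_Mapping.keys g.
     if \<forall>v. CHAR('k) dvd Poly_Mapping.lookup (all_ones V + m) v
     then Poly_Mapping.single
            (Poly_Mapping.map (\<lambda>e. e div CHAR('k)) (all_ones V + m) - all_ones V)
            (frobenius_root (Poly_Mapping.lookup g m))
     else 0)"

definition standard_splitting_poly ::
    "'v set \<Rightarrow> ('v, 'k::alg_closed_field) mpoly \<Rightarrow> ('v, 'k) mpoly" where
  "standard_splitting_poly V g =
     frobenius_trace V (Poly_Mapping.single (all_ones V) 1 ^ (CHAR('k) - 1) * g)"

definition standard_splitting ::
    "'v set \<Rightarrow> ('v \<Rightarrow> 'k::alg_closed_field, 'k) sheaf_map \<Rightarrow> bool" where
  "standard_splitting V \<tau> \<longleftrightarrow> frobenius_splitting (affine_space V) \<tau> \<and>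
     (\<forall>g. (\<forall>m\<in>Poly_Mapping.keys g. Poly_Mapping.keys m \<subseteq> V) \<longrightarrow>
        \<tau> (V \<rightarrow>\<^sub>E UNIV) (\<lambda>z\<in>V \<rightarrow>\<^sub>E UNIV. peval g z) =
          (\<lambda>z\<in>V \<rightarrow>\<^sub>E UNIV. peval (standard_splitting_poly V g) z))"

section \<open>The symmetric product of the affine plane\<close>

text \<open>
  Points of the \<open>n\<close>-fold product of the plane have coordinates \<open>Inl i\<close> (the \<open>x\<close>-coordinate of the
  \<open>i\<close>-th point) and \<open>Inr i\<close> (its \<open>y\<close>-coordinate) for \<open>i < n\<close>. Orbits of the symmetric group are
  multisets of size \<open>n\<close>.
\<close>

definition plane_power_vars :: "nat \<Rightarrow> (nat + nat) set" where
  "plane_power_vars n = {..<n} <+> {..<n}"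

definition orbit :: "nat \<Rightarrow> (nat + nat \<Rightarrow> 'k) \<Rightarrow> ('k \<times> 'k) multiset" where
  "orbit n z = image_mset (\<lambda>i. (z (Inl i), z (Inr i))) (mset_set {..<n})"

definition symmetric_product :: "nat \<Rightarrow> (('k::field \<times> 'k) multiset, 'k) space" where
  "symmetric_product n = quotient_space (affine_space (plane_power_vars n)) (orbit n)"

section \<open>The Hilbert scheme of points of the affine plane\<close>

text \<open>
  The ring \<open>k[x,y]\<close> is the type \<open>'k poly poly\<close>, with \<open>x\<close> the inner and \<open>y\<close> the outer variable.
\<close>

abbreviation is_ideal :: "'a::comm_ring_1 set \<Rightarrow> bool" where
  "is_ideal \<equiv> module.subspace (*)"

abbreviation ideal_generated :: "'a::comm_ring_1 set \<Rightarrow> 'a set" where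
  "ideal_generated \<equiv> module.span (*)"

definition var_x :: "'k::field poly poly" where "var_x = [:[:0, 1:]:]"
definition var_y :: "'k::field poly poly" where "var_y = [:0, 1:]"

definition xy_monom :: "nat \<times> nat \<Rightarrow> 'k::field poly poly" where
  "xy_monom m = var_x ^ fst m * var_y ^ snd m"

text \<open>\<open>represents I B e f a\<close>: \<open>f\<close> is congruent modulo \<open>I\<close> to the combination of the
  \<open>e b\<close> with coefficients \<open>a b\<close>.\<close>

definition represents ::
    "'k::field poly poly set \<Rightarrow> 'i set \<Rightarrow> ('i \<Rightarrow> 'k poly poly) \<Rightarrow> 'k poly poly \<Rightarrow> ('i \<Rightarrow> 'k) \<Rightarrow> bool"
  where "represents I B e f a \<longleftrightarrow>
    a \<in> B \<rightarrow>\<^sub>E UNIV \<and> f - (\<Sum>b\<in>B. smult [:a b:] (e b)) \<in> I"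

definition basis_mod ::
    "'k::field poly poly set \<Rightarrow> 'i set \<Rightarrow> ('i \<Rightarrow> 'k poly poly) \<Rightarrow> bool" where
  "basis_mod I B e \<longleftrightarrow> (\<forall>f. \<exists>!a. represents I B e f a)"

definition hilb_points :: "nat \<Rightarrow> 'k::field poly poly set set" where
  "hilb_points n = {I. is_ideal I \<and> (\<exists>e :: nat \<Rightarrow> 'k poly poly. basis_mod I {..<n} e)}"

text \<open>
  The standard affine charts: for a set \<open>B\<close> of \<open>n\<close> monomials closed under divisors
  (equivalently, a partition of \<open>n\<close>), the ideals modulo which \<open>B\<close> is a basis. The coordinate ring
  is generated by the coefficients of the expansions of all monomials \<open>m\<close> in terms of \<open>B\<close>. Since the
  Hilbert scheme of points of the plane is smooth, the variety glued from these charts carries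
  the whole scheme structure.
\<close>

definition hilb_chart_domain :: "nat \<Rightarrow> (nat \<times> nat) set \<Rightarrow> 'k::field poly poly set set" where
  "hilb_chart_domain n B = {I \<in> hilb_points n. basis_mod I B xy_monom}"

definition hilb_coord ::
    "(nat \<times> nat) set \<Rightarrow> 'k::field poly poly set \<Rightarrow> (nat \<times> nat) \<times> (nat \<times> nat) \<Rightarrow> 'k" where
  "hilb_coord B I = (\<lambda>(m, b).
     if b \<in> B then (THE a. represents I B xy_monom (xy_monom m) a) b else 0)"

definition order_ideal :: "(nat \<times> nat) set \<Rightarrow> bool" where
  "order_ideal B \<longleftrightarrow> (\<forall>(i, j)\<in>B. \<forall>i'\<le>i. \<forall>j'\<le>j. (i', j') \<in> B)"

definition hilb :: "nat \<Rightarrow> ('k::field poly poly set, 'k) space" where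
  "hilb n = variety_of_charts
     {(hilb_chart_domain n B, hilb_coord B) | B. finite B \<and> card B = n \<and> order_ideal B}"

definition vanishing_ideal :: "('k::field \<times> 'k) set \<Rightarrow> 'k poly poly set" where
  "vanishing_ideal S = {f. \<forall>(a, b)\<in>S. poly (poly f [:b:]) a = 0}"

definition distinct_locus :: "nat \<Rightarrow> 'k::field poly poly set set" where
  "distinct_locus n = {vanishing_ideal S | S. finite S \<and> card S = n}"

text \<open>
  The splitting of the Hilbert scheme induced from the standard splitting of the plane. On the
  locus of \<open>n\<close> distinct points the Hilbert scheme is identified with an open subset of the symmetric
  product by sending a set of points to its ideal. The ideal of the support of a multiset with
  repetitions has colength less than \<open>n\<close>, so such multisets lie in no preimage of an open set of
  the Hilbert scheme.
\<close>

definition induced_splitting ::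
    "nat \<Rightarrow> ('k::alg_closed_field poly poly set, 'k) sheaf_map \<Rightarrow> bool" where
  "induced_splitting n \<phi> \<longleftrightarrow> frobenius_splitting (hilb n) \<phi> \<and>
     (\<exists>\<tau> \<sigma>. standard_splitting (plane_power_vars n) \<tau> \<and>
        frobenius_splitting (symmetric_product n) \<sigma> \<and>
        agrees_along (affine_space (plane_power_vars n)) \<tau> (orbit n)
          (symmetric_product n) \<sigma> (topspace (zariski (symmetric_product n))) \<and>
        agrees_along (symmetric_product n) \<sigma> (\<lambda>s. vanishing_ideal (set_mset s))
          (hilb n) \<phi> (distinct_locus n))"

text \<open>The pair \<open>(a, c)\<close> ranges over homogeneous coordinates of points of the projective line.\<close>

definition curve_Y :: "'k::field poly poly set set" where
  "curve_Y = {ideal_generated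
      {var_y ^ 3, var_x * var_y ^ 2, var_x ^ 2 * var_y, var_x ^ 3,
       smult [:a:] (var_y ^ 2) + smult [:c:] (var_x ^ 2)} | a c. (a, c) \<noteq> (0, 0)}"

end

theory Submission
  imports Defs
begin

text \<open>
  In the chart with basis \<open>1, x, x\<^sup>2, y, xy\<close> write \<open>y\<^sup>2 = s xy + t x\<^sup>2 + \<dots>\<close>. The function \<open>s\<^sup>2 t\<^bsup>p-1\<^esup>\<close>
  vanishes on the curve, but its image under the splitting does not vanish at the ideal with \<open>s = 0\<close>,
  \<open>t = 1\<close>. (In the plane of ideals containing all cubics, which is the symmetric square of the
  projective line of linear forms, the splitting sends \<open>s\<^sup>2 t\<^bsup>p-1\<^esup>\<close> to \<open>2 t\<close>, where \<open>2\<close> is a middle binomial coefficient.)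

  By Cramer's rule \<open>s\<close> and \<open>t\<close> are quotients of \<open>4 \<times> 4\<close> determinants \<open>D\<^sub>s\<close>, \<open>D\<^sub>t\<close> by a determinant \<open>\<Delta>\<close> in the
  coordinates of the five points, so on distinct points the image is \<open>Q / \<Delta>\<^sup>2\<close>, where \<open>Q\<close> is the image of
  \<open>D\<^sub>s\<^sup>2 (D\<^sub>t \<Delta>)\<^bsup>p-1\<^esup>\<close> under the standard splitting. For suitable weights of the coordinates the leading
  forms of the determinants factor as \<open>a (v\<^sup>2 - u\<^sup>2)\<close>, \<open>a b (u - v)\<close>, \<open>a c (v - u)\<close> with \<open>b c = u v\<close>, so the
  polynomial has leading form \<open>(a\<^sup>2 (u - v)\<^sup>2)\<^bsup>p\<^esup> (u + v)\<^sup>2 (u v)\<^bsup>p-1\<^esup>\<close>, and \<open>Q\<close> has leading form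
  \<open>2 a\<^sup>2 (u - v)\<^sup>2 u v\<close>. Evaluating along an explicit one-parameter family of five points with
  these weights, whose ideals converge to the given point of the curve, gives a nonzero limit.
\<close>

section \<open>Multivariate polynomials\<close>

text \<open>Why the leading forms look as they do: points 0 and 1 dominate the others, so to leading
  order the conic y^2 - s xy - t x^2 contains their directions. With slopes m_0 = y_0/x_0 and m_1 =
  y_1/x_1 this gives s = m_0 + m_1 and t = - m_0 m_1, while points 2, 3, 4 enter only through the
  common factor a. As p is odd, the test function becomes (m_0 + m_1)^2 (m_0 m_1)^(p-1), in which
  only (m_0 m_1)^p is a p-th power.

  The obstacle is that the splitting is known explicitly only where the five points are distinct,
  whereas the curve lies entirely outside that locus. Two things are therefore needed. An open set
  of distinct configurations must be cut out by polynomials in chart coordinates; the discriminant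
  in the chart 1, x, ..., x^4 does this. And the value at the limit must be reached through
  regularity alone: near the limit the image is a quotient of polynomials in the coordinates of some
  chart, not necessarily the chosen one. So normal forms along the family have to be polynomial in
  the parameter, up to and including the limit, in every chart that contains the limit; there are
  just two.\<close>

abbreviation monom_value :: "('v \<Rightarrow>\<^sub>0 nat) \<Rightarrow> ('v \<Rightarrow> 'k::comm_semiring_1) \<Rightarrow> 'k" where
  "monom_value m z \<equiv> \<Prod>v\<in>Poly_Mapping.keys m. z v ^ Poly_Mapping.lookup m v"

lemma monom_value_superset:
  assumes "finite A" "Poly_Mapping.keys m \<subseteq> A"
  shows "monom_value m z = (\<Prod>v\<in>A. z v ^ Poly_Mapping.lookup m v)"
  using assms by (intro prod.mono_neutral_left) (auto simp: in_keys_iff)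

lemma monom_value_add: "monom_value (m + n) z = monom_value m z * monom_value n z"
proof -
  let ?A = "Poly_Mapping.keys m \<union> Poly_Mapping.keys n"
  have "monom_value (m + n) z = (\<Prod>v\<in>?A. z v ^ Poly_Mapping.lookup (m + n) v)"
    by (intro monom_value_superset keys_add) auto
  moreover have "monom_value m z = (\<Prod>v\<in>?A. z v ^ Poly_Mapping.lookup m v)"
    by (intro monom_value_superset) auto
  moreover have "monom_value n z = (\<Prod>v\<in>?A. z v ^ Poly_Mapping.lookup n v)"
    by (intro monom_value_superset) auto
  ultimately show ?thesis
    by (simp add: lookup_add power_add prod.distrib)
qed

lemma peval_superset:
  assumes "finite A" "Poly_Mapping.keys P \<subseteq> A"
  shows "peval P z = (\<Sum>m\<in>A. Poly_Mapping.lookup P m * monom_value m z)"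
  unfolding peval_def using assms
  by (intro sum.mono_neutral_left) (auto simp: in_keys_iff)

lemma peval_0 [simp]: "peval 0 z = 0"
  by (simp add: peval_def)

lemma peval_add [simp]: "peval (P + Q) z = peval P z + peval Q z"
proof -
  let ?A = "Poly_Mapping.keys P \<union> Poly_Mapping.keys Q"
  show ?thesis
    using peval_superset[of ?A "P + Q" z] peval_superset[of ?A P z] peval_superset[of ?A Q z]
      keys_add[of P Q]
    by (simp add: lookup_add sum.distrib algebra_simps)
qed

lemma peval_sum [simp]: "peval (sum f A) z = (\<Sum>a\<in>A. peval (f a) z)"
  by (induction A rule: infinite_finite_induct) auto

lemma peval_single [simp]: "peval (Poly_Mapping.single m c) z = c * monom_value m z"
  by (simp add: peval_def)

lemma peval_1 [simp]: "peval 1 z = 1"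
  using peval_single[of 0 1 z] by simp

lemma mpoly_eq_sum_single: "P = (\<Sum>m\<in>Poly_Mapping.keys P. Poly_Mapping.single m (Poly_Mapping.lookup P m))"
proof (rule poly_mapping_eqI)
  fix k
  have "(\<Sum>m\<in>Poly_Mapping.keys P. Poly_Mapping.lookup (Poly_Mapping.single m (Poly_Mapping.lookup P m)) k)
     = (\<Sum>m\<in>Poly_Mapping.keys P. if m = k then Poly_Mapping.lookup P k else 0)"
    by (intro sum.cong) (auto simp: lookup_single)
  then show "Poly_Mapping.lookup P k = Poly_Mapping.lookup
      (\<Sum>m\<in>Poly_Mapping.keys P. Poly_Mapping.single m (Poly_Mapping.lookup P m)) k"
    by (simp add: lookup_sum in_keys_iff)
qed

lemma peval_mult [simp]: "peval (P * Q) z = peval P z * peval Q z"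
proof -
  have "P * Q = (\<Sum>m\<in>Poly_Mapping.keys P. \<Sum>n\<in>Poly_Mapping.keys Q.
      Poly_Mapping.single (m + n) (Poly_Mapping.lookup P m * Poly_Mapping.lookup Q n))"
    by (subst mpoly_eq_sum_single[of P], subst mpoly_eq_sum_single[of Q])
      (simp add: sum_product mult_single)
  then have "peval (P * Q) z = (\<Sum>m\<in>Poly_Mapping.keys P. \<Sum>n\<in>Poly_Mapping.keys Q.
      (Poly_Mapping.lookup P m * monom_value m z) * (Poly_Mapping.lookup Q n * monom_value n z))"
    by (simp add: monom_value_add mult_ac)
  then show ?thesis
    by (simp add: peval_def sum_product)
qed

lemma peval_power [simp]: "peval (P ^ n) z = peval P z ^ n"
  by (induction n) auto

lemma peval_prod [simp]: "peval (prod f A) z = (\<Prod>a\<in>A. peval (f a) z)"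
  by (induction A rule: infinite_finite_induct) auto

lemma peval_uminus [simp]: "peval (- P) z = - peval P z" for P :: "('v, 'k::comm_ring_1) mpoly"
proof -
  have "peval (P + - P) z = 0" by simp
  then show ?thesis unfolding peval_add by (simp add: eq_neg_iff_add_eq_0 add.commute)
qed

lemma peval_diff [simp]: "peval (P - Q) z = peval P z - peval Q z"
  for P :: "('v, 'k::comm_ring_1) mpoly"
  using peval_add[of P "- Q" z] by simp

lemma peval_of_nat [simp]: "peval (of_nat n) z = of_nat n"
  by (induction n) auto

lemma peval_of_int [simp]: "peval (of_int n) z = (of_int n :: 'k::comm_ring_1)"
  by (cases n rule: int_cases2) auto

definition pvar :: "'v \<Rightarrow> ('v, 'k::comm_semiring_1) mpoly" where
  "pvar v = Poly_Mapping.single (Poly_Mapping.single v 1) 1"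

lemma peval_pvar [simp]: "peval (pvar v) z = z v"
  by (simp add: pvar_def)

section \<open>Weighted orders of polynomials\<close>

definition weight :: "'v set \<Rightarrow> ('v \<Rightarrow> nat) \<Rightarrow> ('v \<Rightarrow>\<^sub>0 nat) \<Rightarrow> nat" where
  "weight V w m = (\<Sum>v\<in>V. w v * Poly_Mapping.lookup m v)"

text \<open>Confining the variables to \<open>V\<close> is part of the notion because
  \<open>standard_splitting\<close> prescribes values only for polynomials in these variables; every
  order bound thus delivers that side condition too.\<close>

definition order_ge :: "'v set \<Rightarrow> ('v \<Rightarrow> nat) \<Rightarrow> nat \<Rightarrow> ('v, 'k::zero) mpoly \<Rightarrow> bool" where
  "order_ge V w n P \<longleftrightarrow>
     (\<forall>m\<in>Poly_Mapping.keys P. Poly_Mapping.keys m \<subseteq> V \<and> n \<le> weight V w m)"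

lemma weight_add: "weight V w (m + n) = weight V w m + weight V w n"
  by (simp add: weight_def lookup_add distrib_left sum.distrib)

lemma order_ge_mono: "order_ge V w n P \<Longrightarrow> m \<le> n \<Longrightarrow> order_ge V w m P"
  by (auto simp: order_ge_def intro: order_trans)

lemma order_ge_0: "order_ge V w n 0"
  by (simp add: order_ge_def)

lemma order_ge_add: "order_ge V w n P \<Longrightarrow> order_ge V w n Q \<Longrightarrow> order_ge V w n (P + Q)"
  unfolding order_ge_def using keys_add[of P Q] by blast

lemma order_ge_uminus: "order_ge V w n P \<Longrightarrow> order_ge V w n (- P)"
  for P :: "('v, 'k::ab_group_add) mpoly"
  by (simp add: order_ge_def in_keys_iff)

lemma order_ge_diff: "order_ge V w n P \<Longrightarrow> order_ge V w n Q \<Longrightarrow> order_ge V w n (P - Q)"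
  for P :: "('v, 'k::ab_group_add) mpoly"
  using order_ge_add[of V w n P "- Q"] order_ge_uminus[of V w n Q] by simp

lemma order_ge_mult: "order_ge V w n P \<Longrightarrow> order_ge V w m Q \<Longrightarrow> order_ge V w (n + m) (P * Q)"
  unfolding order_ge_def
proof
  fix k
  assume P: "\<forall>m\<in>Poly_Mapping.keys P. Poly_Mapping.keys m \<subseteq> V \<and> n \<le> weight V w m"
    and Q: "\<forall>n\<in>Poly_Mapping.keys Q. Poly_Mapping.keys n \<subseteq> V \<and> m \<le> weight V w n"
    and k: "k \<in> Poly_Mapping.keys (P * Q)"
  obtain a b where "a \<in> Poly_Mapping.keys P" "b \<in> Poly_Mapping.keys Q" "k = a + b"
    using keys_mult[of P Q] k by blast
  then show "Poly_Mapping.keys k \<subseteq> V \<and> n + m \<le> weight V w k"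
    using P Q keys_add[of a b] add_mono[of n "weight V w a" m "weight V w b"]
    by (simp add: weight_add) blast
qed

lemma order_ge_1: "order_ge V w 0 1"
  by (simp add: order_ge_def)

lemma order_ge_power: "order_ge V w n P \<Longrightarrow> order_ge V w (n * k) (P ^ k)"
  by (induction k) (auto intro: order_ge_1 order_ge_mult)

lemma order_ge_pvar:
  assumes "finite V" "v \<in> V"
  shows "order_ge V w (w v) (pvar v :: ('v, 'k::comm_semiring_1) mpoly)"
proof -
  have "weight V w (Poly_Mapping.single v 1) = (\<Sum>u\<in>V. if u = v then w v else 0)"
    unfolding weight_def by (intro sum.cong) (auto simp: lookup_single)
  then show ?thesis
    using assms by (simp add: order_ge_def pvar_def)
qed

lemma order_ge_mult_cong:
  fixes P :: "('v, 'k::comm_ring_1) mpoly"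
  assumes "order_ge V w n P" "order_ge V w (Suc n) (P' - P)"
    and "order_ge V w m Q" "order_ge V w (Suc m) (Q' - Q)"
  shows "order_ge V w (n + m) (P * Q)" "order_ge V w (Suc (n + m)) (P' * Q' - P * Q)"
proof -
  show "order_ge V w (n + m) (P * Q)"
    by (intro order_ge_mult assms)
  have eq: "P' * Q' - P * Q = (P' - P) * (Q' - Q) + (P' - P) * Q + P * (Q' - Q)"
    by (simp add: algebra_simps)
  show "order_ge V w (Suc (n + m)) (P' * Q' - P * Q)"
    unfolding eq
    using order_ge_mult[OF assms(2,4)] order_ge_mult[OF assms(2,3)] order_ge_mult[OF assms(1,4)]
    by (intro order_ge_add) (auto elim: order_ge_mono)
qed

lemma order_ge_power_cong:
  fixes P :: "('v, 'k::comm_ring_1) mpoly"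
  assumes "order_ge V w n P" "order_ge V w (Suc n) (P' - P)"
  shows "order_ge V w (n * k) (P ^ k) \<and> order_ge V w (Suc (n * k)) (P' ^ k - P ^ k)"
proof (induction k)
  case 0
  then show ?case by (simp add: order_ge_1 order_ge_0)
next
  case (Suc k)
  then show ?case
    using order_ge_mult_cong[OF assms, of "n * k" "P ^ k" "P' ^ k"] by (simp add: algebra_simps)
qed

text \<open>Powers of \<open>e\<close> with the weights as exponents turn a monomial of weight
  \<open>k\<close> into a multiple of \<open>e ^ k\<close>. One polynomial \<open>r\<close> serves
  all \<open>e\<close>, so the quotient by \<open>e ^ n\<close> has a value at \<open>e = 0\<close>
  as well, which is where the limit is taken.\<close>

lemma peval_along_curve:
  fixes P :: "('v, 'k::comm_ring_1) mpoly"
  assumes V: "finite V" and P: "order_ge V w n P"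
  shows "\<exists>r. \<forall>e. \<forall>z. (\<forall>v\<in>V. z v = e ^ w v * poly (\<zeta> v) e) \<longrightarrow> peval P z = e ^ n * poly r e"
proof -
  define r where "r = (\<Sum>m\<in>Poly_Mapping.keys P. [:Poly_Mapping.lookup P m:] *
     monom 1 (weight V w m - n) * (\<Prod>v\<in>V. \<zeta> v ^ Poly_Mapping.lookup m v))"
  have "peval P z = e ^ n * poly r e" if z: "\<forall>v\<in>V. z v = e ^ w v * poly (\<zeta> v) e" for e z
  proof -
    have "Poly_Mapping.lookup P m * monom_value m z = e ^ n * (Poly_Mapping.lookup P m *
        e ^ (weight V w m - n) * (\<Prod>v\<in>V. poly (\<zeta> v) e ^ Poly_Mapping.lookup m v))"
      if m: "m \<in> Poly_Mapping.keys P" for m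
    proof -
      have "Poly_Mapping.keys m \<subseteq> V" and n: "n \<le> weight V w m"
        using P m by (auto simp: order_ge_def)
      then have "monom_value m z = (\<Prod>v\<in>V. z v ^ Poly_Mapping.lookup m v)"
        by (intro monom_value_superset V)
      also have "\<dots> = (\<Prod>v\<in>V. e ^ (w v * Poly_Mapping.lookup m v) * poly (\<zeta> v) e ^ Poly_Mapping.lookup m v)"
        using z by (intro prod.cong) (auto simp: power_mult_distrib power_mult)
      also have "\<dots> = e ^ weight V w m * (\<Prod>v\<in>V. poly (\<zeta> v) e ^ Poly_Mapping.lookup m v)"
        by (simp add: prod.distrib weight_def power_sum)
      also have "e ^ weight V w m = e ^ n * e ^ (weight V w m - n)"
        using n by (simp flip: power_add)
      finally show ?thesis by (simp add: mult_ac)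
    qed
    then show ?thesis
      by (simp add: peval_def r_def poly_sum poly_prod poly_monom sum_distrib_left mult.assoc)
  qed
  then show ?thesis by blast
qed

section \<open>The standard splitting on polynomials\<close>

lemma lookup_all_ones: "finite V \<Longrightarrow> Poly_Mapping.lookup (all_ones V) v = (if v \<in> V then 1 else 0)"
  by (simp add: all_ones_def lookup_sum lookup_single when_def)

lemma single_power:
  "Poly_Mapping.single a (1::'k::comm_semiring_1) ^ n = Poly_Mapping.single (\<Sum>i<n. a) 1"
  by (induction n) (auto simp: mult_single add.commute)

text \<open>The power of the product of the variables adds \<open>p - 1\<close> to each exponent and
  the trace adds one more; after division by \<open>p\<close> this shift cancels against the final
  subtraction. So the splitting just takes \<open>p\<close>-th roots of monomials. Comparing
  supports avoids the root coefficients.\<close>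

lemma keys_standard_splitting_poly:
  fixes g :: "('v, 'k::alg_closed_field) mpoly"
  assumes V: "finite V" and p: "CHAR('k) > 0"
    and m: "m \<in> Poly_Mapping.keys (standard_splitting_poly V g)"
  shows "\<exists>m'\<in>Poly_Mapping.keys g. \<forall>v. Poly_Mapping.lookup m' v = CHAR('k) * Poly_Mapping.lookup m v"
proof -
  define G where "G = Poly_Mapping.single (all_ones V) (1::'k) ^ (CHAR('k) - 1) * g"
  define root where "root l = Poly_Mapping.map (\<lambda>e. e div CHAR('k)) (all_ones V + l) - all_ones V" for l :: "'v \<Rightarrow>\<^sub>0 nat"
  have "standard_splitting_poly V g = (\<Sum>l\<in>Poly_Mapping.keys G.
     if \<forall>v. CHAR('k) dvd Poly_Mapping.lookup (all_ones V + l) v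
     then Poly_Mapping.single (root l) (frobenius_root (Poly_Mapping.lookup G l)) else 0)"
    unfolding standard_splitting_poly_def frobenius_trace_def G_def[symmetric] root_def ..
  with m have "m \<in> (\<Union>l\<in>Poly_Mapping.keys G. Poly_Mapping.keys
      (if \<forall>v. CHAR('k) dvd Poly_Mapping.lookup (all_ones V + l) v
       then Poly_Mapping.single (root l) (frobenius_root (Poly_Mapping.lookup G l)) else 0))"
    by (simp only: subsetD[OF keys_sum])
  then obtain l where l: "l \<in> Poly_Mapping.keys G" "m \<in> Poly_Mapping.keys
      (if \<forall>v. CHAR('k) dvd Poly_Mapping.lookup (all_ones V + l) v
       then Poly_Mapping.single (root l) (frobenius_root (Poly_Mapping.lookup G l)) else 0)"
    by blast
  then have dvd: "\<forall>v. CHAR('k) dvd Poly_Mapping.lookup (all_ones V + l) v" and mr: "m = root l"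
    by (auto split: if_splits)
  obtain m' where m': "m' \<in> Poly_Mapping.keys g" "l = (\<Sum>i<CHAR('k) - 1. all_ones V) + m'"
    using l(1) keys_mult[of "Poly_Mapping.single (all_ones V) (1::'k) ^ (CHAR('k) - 1)" g]
    by (auto simp: G_def single_power)
  have "Poly_Mapping.lookup m' v = CHAR('k) * Poly_Mapping.lookup m v" for v
  proof -
    let ?o = "if v \<in> V then 1 else (0::nat)"
    have "Poly_Mapping.lookup (all_ones V + l) v
        = ?o + (CHAR('k) - 1) * ?o + Poly_Mapping.lookup m' v"
      by (simp add: m'(2) lookup_add lookup_sum lookup_all_ones[OF V])
    also have "?o + (CHAR('k) - 1) * ?o = CHAR('k) * ?o"
      using p by auto
    finally have lk: "Poly_Mapping.lookup (all_ones V + l) v = CHAR('k) * ?o + Poly_Mapping.lookup m' v" .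
    with dvd have "CHAR('k) dvd CHAR('k) * ?o + Poly_Mapping.lookup m' v"
      by metis
    then have "CHAR('k) dvd Poly_Mapping.lookup m' v"
      by (simp add: dvd_add_right_iff split: if_splits)
    then obtain c where c: "Poly_Mapping.lookup m' v = CHAR('k) * c" ..
    \<comment> \<open>The division yields \<open>?o + c\<close>, so the subtraction of natural
      numbers does not truncate.\<close>
    have "Poly_Mapping.lookup m v = Poly_Mapping.lookup (all_ones V + l) v div CHAR('k) - ?o"
      by (simp add: mr root_def lookup_minus map.rep_eq when_def lookup_all_ones[OF V])
    also have "\<dots> = c"
      unfolding lk c using p by (simp flip: distrib_left)
    finally show ?thesis by (simp add: c)
  qed
  with m'(1) show ?thesis by blast
qed

text \<open>Taking \<open>p\<close>-th roots divides weights by \<open>p\<close>, and strictness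
  survives: \<open>p * n < p * k\<close> forces \<open>n < k\<close>. This discards everything above
  the leading form.\<close>

lemma order_ge_standard_splitting_poly:
  fixes g :: "('v, 'k::alg_closed_field) mpoly"
  assumes "finite V" "CHAR('k) > 0" "order_ge V w (Suc (CHAR('k) * n)) g"
  shows "order_ge V w (Suc n) (standard_splitting_poly V g)"
  unfolding order_ge_def
proof
  fix m assume "m \<in> Poly_Mapping.keys (standard_splitting_poly V g)"
  from keys_standard_splitting_poly[OF assms(1,2) this] obtain m'
    where m': "m' \<in> Poly_Mapping.keys g"
      "\<And>v. Poly_Mapping.lookup m' v = CHAR('k) * Poly_Mapping.lookup m v" by blast
  have "weight V w m' = CHAR('k) * weight V w m"
    by (simp add: weight_def m'(2) sum_distrib_left mult_ac)
  moreover have "Suc (CHAR('k) * n) \<le> weight V w m'" "Poly_Mapping.keys m' \<subseteq> V"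
    using assms(3) m'(1) by (auto simp: order_ge_def)
  moreover have "Poly_Mapping.keys m' = Poly_Mapping.keys m"
    using assms(2) by (auto simp: in_keys_iff m'(2))
  ultimately show "Poly_Mapping.keys m \<subseteq> V \<and> Suc n \<le> weight V w m"
    using Suc_le_eq by auto
qed

lemma standard_splitting_poly_eq_0:
  fixes g :: "('v, 'k::alg_closed_field) mpoly"
  assumes "finite V" "CHAR('k) > 0"
    and "\<And>m. m \<in> Poly_Mapping.keys g \<Longrightarrow> \<exists>v. \<not> CHAR('k) dvd Poly_Mapping.lookup m v"
  shows "standard_splitting_poly V g = 0"
proof (rule ccontr)
  assume "standard_splitting_poly V g \<noteq> 0"
  then obtain m where m: "m \<in> Poly_Mapping.keys (standard_splitting_poly V g)"
    by (metis ex_in_conv keys_eq_empty)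
  show False
    using keys_standard_splitting_poly[OF assms(1,2) m] assms(3) by (metis dvd_triv_left)
qed

section \<open>Four by four determinants\<close>

text \<open>Laplace expansion, up to sign, of the determinant with columns \<open>a\<close>,
  \<open>b\<close>, \<open>c\<close>, \<open>d\<close> along the row pairs 3, 2 and 0, 1. This shape
  exposes the first summand, which will carry the leading form.\<close>

definition det4 :: "(nat \<Rightarrow> 'a) \<Rightarrow> (nat \<Rightarrow> 'a) \<Rightarrow> (nat \<Rightarrow> 'a) \<Rightarrow> (nat \<Rightarrow> 'a) \<Rightarrow> 'a::comm_ring_1" where
  "det4 a b c d =
     (a 3 * b 2 - b 3 * a 2) * (c 0 * d 1 - d 0 * c 1)
   - (a 3 * c 2 - c 3 * a 2) * (b 0 * d 1 - d 0 * b 1)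
   + (a 3 * d 2 - d 3 * a 2) * (b 0 * c 1 - c 0 * b 1)
   + (b 3 * c 2 - c 3 * b 2) * (a 0 * d 1 - d 0 * a 1)
   - (b 3 * d 2 - d 3 * b 2) * (a 0 * c 1 - c 0 * a 1)
   + (c 3 * d 2 - d 3 * c 2) * (a 0 * b 1 - b 0 * a 1)"

lemma det_4:
  "det (A::'a::comm_ring_1^4^4) = - det4
     (\<lambda>i. A $ (of_nat (Suc i)) $ 1) (\<lambda>i. A $ (of_nat (Suc i)) $ 2)
     (\<lambda>i. A $ (of_nat (Suc i)) $ 3) (\<lambda>i. A $ (of_nat (Suc i)) $ 4)"
proof -
  have f1234: "finite {2::4, 3, 4}" "1 \<notin> {2::4, 3, 4}"
    by auto
  have f234: "finite {3::4, 4}" "2 \<notin> {3::4, 4}"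
    by auto
  have f34: "finite {4::4}" "3 \<notin> {4::4}"
    by auto
  show ?thesis
    unfolding det_def UNIV_4
    unfolding sum_over_permutations_insert[OF f1234]
    unfolding sum_over_permutations_insert[OF f234]
    unfolding sum_over_permutations_insert[OF f34]
    unfolding permutes_sing det4_def
    by (simp add: sign_swap_id permutation_swap_id sign_compose sign_id swap_id_eq permutation_compose algebra_simps)
qed

lemma less_4_iff: "i < 4 \<longleftrightarrow> i = 0 \<or> i = 1 \<or> i = 2 \<or> i = (3::nat)"
  by auto

text \<open>Bridge to matrices indexed by the type \<open>4\<close>, where invertibility is
  available. Only the vanishing of the determinant is transferred, so its sign need not be
  tracked.\<close>

lemma det4_matrix:
  fixes a b c d :: "nat \<Rightarrow> 'a::field"
  shows "\<exists>A :: 'a^4^4. (det A \<noteq> 0 \<longleftrightarrow> det4 a b c d \<noteq> 0) \<and> (\<forall>w v. A *v w = v \<longleftrightarrow>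
    (\<forall>i<4. w$1 * a i + w$2 * b i + w$3 * c i + w$4 * d i = v $ of_nat (Suc i)))"
proof (intro exI conjI allI)
  define A :: "'a^4^4" where "A = (\<chi> i j. (if j = 1 then a else if j = 2 then b else if j = 3 then c else d)
     (if i = 1 then 0 else if i = 2 then 1 else if i = 3 then 2 else 3))"
  show "det A \<noteq> 0 \<longleftrightarrow> det4 a b c d \<noteq> 0"
  proof -
    have "det A = - det4 a b c d"
      unfolding det_4 by (simp add: A_def det4_def)
    then show ?thesis by simp
  qed
  show "A *v w = v \<longleftrightarrow> (\<forall>i<4. w$1 * a i + w$2 * b i + w$3 * c i + w$4 * d i = v $ of_nat (Suc i))" for w v
    by (simp add: vec_eq_iff forall_4 matrix_vector_mult_def sum_4 A_def less_4_iff all_conj_distrib imp_disjL mult.commute)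
qed

lemma det4_nonzero_iff_solvable:
  fixes a b c d :: "nat \<Rightarrow> 'a::field"
  shows "det4 a b c d \<noteq> 0 \<longleftrightarrow>
    (\<forall>v :: nat \<Rightarrow> 'a. \<exists>\<alpha> \<beta> \<gamma> \<delta>. \<forall>i<4. \<alpha> * a i + \<beta> * b i + \<gamma> * c i + \<delta> * d i = v i)"
    (is "_ \<longleftrightarrow> ?R")
proof -
  obtain A :: "'a^4^4" where A: "det A \<noteq> 0 \<longleftrightarrow> det4 a b c d \<noteq> 0"
    "\<And>w v. A *v w = v \<longleftrightarrow> (\<forall>i<4. w$1 * a i + w$2 * b i + w$3 * c i + w$4 * d i = v $ of_nat (Suc i))"
    using det4_matrix[of a b c d] by blast
  have "det A \<noteq> 0 \<longleftrightarrow> surj ((*v) A)"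
    using invertible_det_nz[of A] invertible_right_inverse[of A]
      matrix_right_invertible_surjective[of A] by simp
  also have "\<dots> \<longleftrightarrow> ?R"
  proof
    assume s: "surj ((*v) A)"
    show ?R
    proof
      fix v :: "nat \<Rightarrow> 'a"
      obtain w where "A *v w = (vector [v 0, v 1, v 2, v 3] :: 'a^4)"
        using s by (metis surjD)
      then have "\<forall>i<4. w$1 * a i + w$2 * b i + w$3 * c i + w$4 * d i = v i"
        unfolding A(2) by (simp add: less_4_iff all_conj_distrib imp_disjL vector_def)
      then show "\<exists>\<alpha> \<beta> \<gamma> \<delta>. \<forall>i<4. \<alpha> * a i + \<beta> * b i + \<gamma> * c i + \<delta> * d i = v i"
        by blast
    qed
  next
    assume R: ?R
    show "surj ((*v) A)"
      unfolding surj_def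
    proof
      fix v :: "'a^4"
      obtain \<alpha> \<beta> \<gamma> \<delta> where "\<forall>i<4. \<alpha> * a i + \<beta> * b i + \<gamma> * c i + \<delta> * d i = v $ of_nat (Suc i)"
        using R[rule_format, of "\<lambda>i. v $ of_nat (Suc i)"] by blast
      then have "A *v vector [\<alpha>, \<beta>, \<gamma>, \<delta>] = v"
        unfolding A(2) by (simp add: vector_def)
      then show "\<exists>w. v = A *v w" by metis
    qed
  qed
  finally show ?thesis by (simp add: A(1))
qed

lemma det4_nonzero_imp_inj:
  fixes a b c d :: "nat \<Rightarrow> 'a::field"
  assumes "det4 a b c d \<noteq> 0" "\<And>i. i < 4 \<Longrightarrow> \<alpha> * a i + \<beta> * b i + \<gamma> * c i + \<delta> * d i = 0"
  shows "\<alpha> = 0" "\<beta> = 0" "\<gamma> = 0" "\<delta> = 0"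
proof -
  obtain A :: "'a^4^4" where A: "det A \<noteq> 0 \<longleftrightarrow> det4 a b c d \<noteq> 0"
    "\<And>w v. A *v w = v \<longleftrightarrow> (\<forall>i<4. w$1 * a i + w$2 * b i + w$3 * c i + w$4 * d i = v $ of_nat (Suc i))"
    using det4_matrix[of a b c d] by blast
  have "A *v vector [\<alpha>, \<beta>, \<gamma>, \<delta>] = 0"
    unfolding A(2) using assms(2) by (simp add: vector_def)
  moreover have "invertible A"
    using A(1) assms(1) by (simp add: invertible_det_nz)
  ultimately have "(vector [\<alpha>, \<beta>, \<gamma>, \<delta>] :: 'a^4) = 0"
    using matrix_left_invertible_ker[of A] invertible_left_inverse[of A] by blast
  then have "(vector [\<alpha>, \<beta>, \<gamma>, \<delta>] :: 'a^4) $ j = 0" for j by simp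
  from this[of 1] this[of 2] this[of 3] this[of 4]
  show "\<alpha> = 0" "\<beta> = 0" "\<gamma> = 0" "\<delta> = 0" by (simp_all add: vector_def)
qed

text \<open>Cramer's rule in a division-free form: a determinant is multilinear and alternating in
  its columns.\<close>

lemma det4_replace_column:
  assumes "\<And>i. i < 4 \<Longrightarrow> v i = \<alpha> * a i + \<beta> * b i + \<gamma> * c i + \<delta> * d i"
  shows "det4 a b v d = \<gamma> * det4 a b c d" "det4 a b c v = \<delta> * det4 a b c d"
  using assms[of 0] assms[of 1] assms[of 2] assms[of 3]
  by (simp_all add: det4_def) (simp_all add: algebra_simps)

lemma peval_det4 [simp]:
  "peval (det4 a b c d) z = det4 (\<lambda>i. peval (a i) z) (\<lambda>i. peval (b i) z) (\<lambda>i. peval (c i) z)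
     (\<lambda>i. peval (d i) z)" for z :: "'v \<Rightarrow> 'k::comm_ring_1"
  by (simp add: det4_def)

text \<open>Each of the five remaining Laplace terms is a product of two minors. The numbers
  \<open>m\<^sub>1\<close>, ..., \<open>m\<^sub>5\<close> bound the orders of the minors on rows 3,
  2 from below, and \<open>n\<^sub>1\<close>, ..., \<open>n\<^sub>5\<close> those on rows 0, 1; they
  stay parameters so that three different determinants can be treated alike.\<close>

lemma order_ge_det4_minus_leading:
  fixes a b c d :: "nat \<Rightarrow> ('v, 'k::comm_ring_1) mpoly"
  assumes o: "\<And>i. i < 4 \<Longrightarrow> order_ge V w (oa i) (a i)" "\<And>i. i < 4 \<Longrightarrow> order_ge V w (ob i) (b i)"
    "\<And>i. i < 4 \<Longrightarrow> order_ge V w (oc i) (c i)" "\<And>i. i < 4 \<Longrightarrow> order_ge V w (od i) (d i)"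
    and m: "m\<^sub>1 + n\<^sub>1 \<ge> N" "m\<^sub>2 + n\<^sub>2 \<ge> N" "m\<^sub>3 + n\<^sub>3 \<ge> N" "m\<^sub>4 + n\<^sub>4 \<ge> N" "m\<^sub>5 + n\<^sub>5 \<ge> N"
    and le: "m\<^sub>1 \<le> oa 3 + oc 2" "m\<^sub>1 \<le> oc 3 + oa 2" "n\<^sub>1 \<le> ob 0 + od 1" "n\<^sub>1 \<le> od 0 + ob 1"
    "m\<^sub>2 \<le> oa 3 + od 2" "m\<^sub>2 \<le> od 3 + oa 2" "n\<^sub>2 \<le> ob 0 + oc 1" "n\<^sub>2 \<le> oc 0 + ob 1"
    "m\<^sub>3 \<le> ob 3 + oc 2" "m\<^sub>3 \<le> oc 3 + ob 2" "n\<^sub>3 \<le> oa 0 + od 1" "n\<^sub>3 \<le> od 0 + oa 1"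
    "m\<^sub>4 \<le> ob 3 + od 2" "m\<^sub>4 \<le> od 3 + ob 2" "n\<^sub>4 \<le> oa 0 + oc 1" "n\<^sub>4 \<le> oc 0 + oa 1"
    "m\<^sub>5 \<le> oc 3 + od 2" "m\<^sub>5 \<le> od 3 + oc 2" "n\<^sub>5 \<le> oa 0 + ob 1" "n\<^sub>5 \<le> ob 0 + oa 1"
  shows "order_ge V w N (det4 a b c d - (a 3 * b 2 - b 3 * a 2) * (c 0 * d 1 - d 0 * c 1))"
proof -
  have *: "order_ge V w N (P * Q)" if "order_ge V w m P" "order_ge V w n Q" "N \<le> m + n" for P Q m n
    using order_ge_mult[OF that(1,2)] that(3) by (rule order_ge_mono)
  have **: "order_ge V w k (P * Q)" if "order_ge V w m P" "order_ge V w n Q" "k \<le> m + n" for P Q m n k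
    using order_ge_mult[OF that(1,2)] that(3) by (rule order_ge_mono)
  have eq: "det4 a b c d - (a 3 * b 2 - b 3 * a 2) * (c 0 * d 1 - d 0 * c 1) =
   - ((a 3 * c 2 - c 3 * a 2) * (b 0 * d 1 - d 0 * b 1))
   + (a 3 * d 2 - d 3 * a 2) * (b 0 * c 1 - c 0 * b 1)
   + (b 3 * c 2 - c 3 * b 2) * (a 0 * d 1 - d 0 * a 1)
   - (b 3 * d 2 - d 3 * b 2) * (a 0 * c 1 - c 0 * a 1)
   + (c 3 * d 2 - d 3 * c 2) * (a 0 * b 1 - b 0 * a 1)"
    by (simp add: det4_def)
  note o' = **[OF o(1) o(3)] **[OF o(3) o(1)] **[OF o(2) o(4)] **[OF o(4) o(2)]
        **[OF o(1) o(4)] **[OF o(4) o(1)] **[OF o(2) o(3)] **[OF o(3) o(2)]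
        **[OF o(3) o(4)] **[OF o(4) o(3)] **[OF o(1) o(2)] **[OF o(2) o(1)]
  show ?thesis
    unfolding eq
    apply (rule order_ge_add order_ge_diff order_ge_uminus)+
       apply (rule *[OF _ _ m(1)]; rule order_ge_diff; rule o'; (simp; fail | fact le))
      apply (rule *[OF _ _ m(2)]; rule order_ge_diff; rule o'; (simp; fail | fact le))
     apply (rule *[OF _ _ m(3)]; rule order_ge_diff; rule o'; (simp; fail | fact le))
    apply (rule *[OF _ _ m(4)]; rule order_ge_diff; rule o'; (simp; fail | fact le))
   apply (rule *[OF _ _ m(5)]; rule order_ge_diff; rule o'; (simp; fail | fact le))
    done
qed

text \<open>\<open>L\<close> stands for its class modulo order \<open>n + 1\<close> and may be zero
  or inhomogeneous. Such congruences multiply without any non-vanishing condition.\<close>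

definition leading_form :: "'v set \<Rightarrow> ('v \<Rightarrow> nat) \<Rightarrow> nat \<Rightarrow> ('v, 'k::comm_ring_1) mpoly \<Rightarrow> ('v, 'k) mpoly \<Rightarrow> bool" where
  "leading_form V w n P L \<longleftrightarrow> order_ge V w n L \<and> order_ge V w (Suc n) (P - L)"

lemma leading_form_mult:
  "leading_form V w n P L \<Longrightarrow> leading_form V w m Q M \<Longrightarrow> leading_form V w (n + m) (P * Q) (L * M)"
  unfolding leading_form_def using order_ge_mult_cong by blast

lemma leading_form_mult_eq:
  "leading_form V w n P L \<Longrightarrow> leading_form V w m Q M \<Longrightarrow> n + m = k \<Longrightarrow>
    leading_form V w k (P * Q) (L * M)"
  using leading_form_mult by blast

lemma leading_form_power: "leading_form V w n P L \<Longrightarrow> leading_form V w (n * k) (P ^ k) (L ^ k)"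
  unfolding leading_form_def using order_ge_power_cong by blast

lemma leading_form_diff:
  assumes "leading_form V w n P L" "leading_form V w n Q M"
  shows "leading_form V w n (P - Q) (L - M)"
proof -
  have eq: "P - Q - (L - M) = (P - L) - (Q - M)" by simp
  show ?thesis
    unfolding leading_form_def eq using assms by (auto simp: leading_form_def intro: order_ge_diff)
qed

lemma leading_form_add_higher:
  assumes "leading_form V w n P L" "order_ge V w (Suc n) (Q - P)"
  shows "leading_form V w n Q L"
proof -
  have eq: "Q - L = (Q - P) + (P - L)" by simp
  show ?thesis
    using assms order_ge_add[OF assms(2), of "P - L"] unfolding leading_form_def eq by blast
qed

lemma leading_form_order: "leading_form V w n P L \<Longrightarrow> order_ge V w n P"
  using order_ge_add[of V w n L "P - L"] order_ge_mono[of V w "Suc n" "P - L" n]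
  by (simp add: leading_form_def)

section \<open>The determinants expressing the chart coordinates\<close>

abbreviation vars5 :: "(nat + nat) set" where "vars5 \<equiv> plane_power_vars 5"

definition diff_x :: "nat \<Rightarrow> (nat + nat, 'k::comm_ring_1) mpoly" where
  "diff_x i = pvar (Inl i) - pvar (Inl 4)"

definition diff_y :: "nat \<Rightarrow> (nat + nat, 'k::comm_ring_1) mpoly" where
  "diff_y i = pvar (Inr i) - pvar (Inr 4)"

text \<open>The \<Delta> of the overview. Taking differences with point 4 splits off the basis
  element 1, which reduces a 5 by 5 determinant to 4 by 4. In \<open>det_xy\<close> (the D_s) the
  column \<open>xy\<close> is replaced by \<open>y^2\<close>, in \<open>det_xx\<close> (the D_t) the
  column \<open>x^2\<close>.\<close>

definition det_basis :: "(nat + nat, 'k::comm_ring_1) mpoly" where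
  "det_basis = det4 diff_x diff_y (\<lambda>i. diff_x i * diff_y i) (\<lambda>i. diff_x i ^ 2)"

definition det_xy :: "(nat + nat, 'k::comm_ring_1) mpoly" where
  "det_xy = det4 diff_x diff_y (\<lambda>i. diff_y i ^ 2) (\<lambda>i. diff_x i ^ 2)"

definition det_xx :: "(nat + nat, 'k::comm_ring_1) mpoly" where
  "det_xx = det4 diff_x diff_y (\<lambda>i. diff_x i * diff_y i) (\<lambda>i. diff_y i ^ 2)"

text \<open>Points 0 and 1 approach the origin slowest. Points 2 and 3 are of second order, one
  close to the y-axis and one close to the x-axis, and point 4 is of third order, so that it acts as
  the origin.\<close>

definition curve_weight :: "nat + nat \<Rightarrow> nat" where
  "curve_weight = case_sum (\<lambda>i. if i < 2 then 1 else if i = 3 then 2 else 3)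
     (\<lambda>i. if i < 2 then 1 else if i = 2 then 2 else 3)"

lemma curve_weight_simps [simp]:
  "curve_weight (Inl i) = (if i < 2 then 1 else if i = 3 then 2 else 3)"
  "curve_weight (Inr i) = (if i < 2 then 1 else if i = 2 then 2 else 3)"
  by (simp_all add: curve_weight_def)

abbreviation "cw_order \<equiv> order_ge vars5 curve_weight"
abbreviation "cw_leading \<equiv> leading_form vars5 curve_weight"

lemma finite_vars5 [simp]: "finite vars5"
  by (simp add: plane_power_vars_def)

lemma in_vars5 [simp]: "Inl i \<in> vars5 \<longleftrightarrow> i < 5" "Inr i \<in> vars5 \<longleftrightarrow> i < 5"
  by (auto simp: plane_power_vars_def)

lemma cw_order_pvar: "v \<in> vars5 \<Longrightarrow> n \<le> curve_weight v \<Longrightarrow> cw_order n (pvar v :: (nat + nat, 'k::comm_ring_1) mpoly)"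
  using order_ge_pvar[of vars5 v curve_weight] by (auto elim: order_ge_mono)

text \<open>Point 4 has the largest weight that occurs, so subtracting its coordinates lowers no
  order.\<close>

lemma cw_order_diff:
  "i < 4 \<Longrightarrow> cw_order (curve_weight (Inl i)) (diff_x i)"
  "i < 4 \<Longrightarrow> cw_order (curve_weight (Inr i)) (diff_y i)"
  by (auto simp: diff_x_def diff_y_def intro!: order_ge_diff cw_order_pvar)

text \<open>The excluded cases are x_2 and y_3: their weight 3 ties with that of point 4, so the
  difference does not reduce to one variable.\<close>

lemma cw_leading_diff:
  "i < 4 \<Longrightarrow> i \<noteq> 2 \<Longrightarrow> cw_leading (curve_weight (Inl i)) (diff_x i) (pvar (Inl i))"
  "i < 3 \<Longrightarrow> cw_leading (curve_weight (Inr i)) (diff_y i) (pvar (Inr i))"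
  by (auto simp: leading_form_def diff_x_def diff_y_def
      intro!: cw_order_pvar order_ge_uminus)

lemma cw_leading_diff_numeral:
  "cw_leading 1 (diff_x 0) (pvar (Inl 0))" "cw_leading 1 (diff_x 1) (pvar (Inl 1))"
  "cw_leading 2 (diff_x 3) (pvar (Inl 3))"
  "cw_leading 1 (diff_y 0) (pvar (Inr 0))" "cw_leading 1 (diff_y 1) (pvar (Inr 1))"
  "cw_leading 2 (diff_y 2) (pvar (Inr 2))"
  using cw_leading_diff(1)[of 0] cw_leading_diff(1)[of 1] cw_leading_diff(1)[of 3]
    cw_leading_diff(2)[of 0] cw_leading_diff(2)[of 1] cw_leading_diff(2)[of 2]
  by simp_all

text \<open>\<open>cross_u\<close>, \<open>cross_v\<close> and \<open>pivot\<close> are the u, v and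
  a of the overview. The difference u - v is the 2 by 2 determinant of points 0 and 1.\<close>

definition cross_u :: "(nat + nat, 'k::comm_ring_1) mpoly" where
  "cross_u = pvar (Inl 0) * pvar (Inr 1)"

definition cross_v :: "(nat + nat, 'k::comm_ring_1) mpoly" where
  "cross_v = pvar (Inl 1) * pvar (Inr 0)"

definition pivot :: "(nat + nat, 'k::comm_ring_1) mpoly" where
  "pivot = pvar (Inl 3) * pvar (Inr 2)"

lemma cw_leading_pivot:
  "cw_leading 4 (diff_x 3 * diff_y 2 - diff_y 3 * diff_x 2) (pivot :: (nat + nat, 'k::comm_ring_1) mpoly)"
proof -
  have lead: "cw_leading (2 + 2) (diff_x 3 * diff_y 2) (pivot :: (nat + nat, 'k) mpoly)"
    unfolding pivot_def by (intro leading_form_mult cw_leading_diff_numeral)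
  have 6: "cw_order 6 (diff_y 3 * diff_x 2 :: (nat + nat, 'k) mpoly)"
    by (rule order_ge_mono[OF order_ge_mult[OF cw_order_diff(2) cw_order_diff(1)]]) simp_all
  have 5: "cw_order 5 (diff_y 3 * diff_x 2 :: (nat + nat, 'k) mpoly)"
    by (rule order_ge_mono[OF 6]) simp
  have higher: "cw_order (Suc (2 + 2)) (diff_x 3 * diff_y 2 - diff_y 3 * diff_x 2 - diff_x 3 * diff_y 2 :: (nat + nat, 'k) mpoly)"
    using order_ge_uminus[OF 5] by simp
  show ?thesis
    using leading_form_add_higher[OF lead higher] by simp
qed

lemmas cw_order_square =
  order_ge_power[where k = 2, OF cw_order_diff(1)] order_ge_power[where k = 2, OF cw_order_diff(2)]
lemmas cw_order_prod = order_ge_mult[OF cw_order_diff(1) cw_order_diff(2)]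

text \<open>Order 8 is reached only with the columns \<open>x\<close>, \<open>y\<close> in the rows
  of points 3, 2 (order 4) and both quadratic columns in the rows of points 0, 1 (order 4). A
  quadratic entry in a row of point 2 or 3 has order at least 4, which makes every other Laplace
  term of order at least 9. The same holds for the next two determinants.\<close>

lemma cw_leading_det_basis:
  "cw_leading 8 det_basis (pivot * (pvar (Inl 0) * pvar (Inl 1) * (cross_v - cross_u)) :: (nat + nat, 'k::comm_ring_1) mpoly)"
proof -
  have "cw_leading (4 + 4)
    ((diff_x 3 * diff_y 2 - diff_y 3 * diff_x 2) *
      (diff_x 0 * diff_y 0 * diff_x 1 ^ 2 - diff_x 0 ^ 2 * (diff_x 1 * diff_y 1)))
    (pivot * (pvar (Inl 0) * pvar (Inr 0) * pvar (Inl 1) ^ 2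
        - pvar (Inl 0) ^ 2 * (pvar (Inl 1) * pvar (Inr 1))) :: (nat + nat, 'k::comm_ring_1) mpoly)"
    by (intro leading_form_mult[OF cw_leading_pivot] leading_form_diff;
      rule leading_form_mult_eq[OF leading_form_mult[OF cw_leading_diff_numeral(1,4)]
          leading_form_power[OF cw_leading_diff_numeral(2), where k = 2]]
        leading_form_mult_eq[OF leading_form_power[OF cw_leading_diff_numeral(1), where k = 2]
          leading_form_mult[OF cw_leading_diff_numeral(2,5)]]; simp)
  then have lead: "cw_leading 8 (((diff_x 3 * diff_y 2 - diff_y 3 * diff_x 2) *
      (diff_x 0 * diff_y 0 * diff_x 1 ^ 2 - diff_x 0 ^ 2 * (diff_x 1 * diff_y 1))) :: (nat + nat, 'k) mpoly) (pivot * (pvar (Inl 0) * pvar (Inr 0) * pvar (Inl 1) ^ 2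
        - pvar (Inl 0) ^ 2 * (pvar (Inl 1) * pvar (Inr 1))))" by simp
  have "cw_order (Suc 8) (det_basis - (diff_x 3 * diff_y 2 - diff_y 3 * diff_x 2) *
      (diff_x 0 * diff_y 0 * diff_x 1 ^ 2 - diff_x 0 ^ 2 * (diff_x 1 * diff_y 1)) :: (nat + nat, 'k) mpoly)"
    unfolding det_basis_def
    \<comment> \<open>The numbers are the least orders of the minors; the smallest sum,
      \<open>6 + 3\<close>, just meets the required 9.\<close>
    by (rule order_ge_det4_minus_leading[OF cw_order_diff cw_order_prod cw_order_square(1),
          where m\<^sub>1 = 7 and n\<^sub>1 = 3 and m\<^sub>2 = 7 and n\<^sub>2 = 3 and m\<^sub>3 = 7 and n\<^sub>3 = 3
          and m\<^sub>4 = 6 and n\<^sub>4 = 3 and m\<^sub>5 = 9 and n\<^sub>5 = 2])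
      simp_all
  from leading_form_add_higher[OF lead this]
  have "cw_leading 8 det_basis (pivot * (pvar (Inl 0) * pvar (Inr 0) * pvar (Inl 1) ^ 2
        - pvar (Inl 0) ^ 2 * (pvar (Inl 1) * pvar (Inr 1))) :: (nat + nat, 'k) mpoly)" .
  also have "pivot * (pvar (Inl 0) * pvar (Inr 0) * pvar (Inl 1) ^ 2
        - pvar (Inl 0) ^ 2 * (pvar (Inl 1) * pvar (Inr 1))) = (pivot * (pvar (Inl 0) * pvar (Inl 1) * (cross_v - cross_u)) :: (nat + nat, 'k) mpoly)"
    by (simp add: cross_u_def cross_v_def algebra_simps power2_eq_square)
  finally show ?thesis .
qed

lemma cw_leading_det_xx:
  "cw_leading 8 det_xx (pivot * (pvar (Inr 0) * pvar (Inr 1) * (cross_u - cross_v)) :: (nat + nat, 'k::comm_ring_1) mpoly)"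
proof -
  have "cw_leading (4 + 4)
    ((diff_x 3 * diff_y 2 - diff_y 3 * diff_x 2) *
      (diff_x 0 * diff_y 0 * diff_y 1 ^ 2 - diff_y 0 ^ 2 * (diff_x 1 * diff_y 1)))
    (pivot * (pvar (Inl 0) * pvar (Inr 0) * pvar (Inr 1) ^ 2
        - pvar (Inr 0) ^ 2 * (pvar (Inl 1) * pvar (Inr 1))) :: (nat + nat, 'k::comm_ring_1) mpoly)"
    by (intro leading_form_mult[OF cw_leading_pivot] leading_form_diff;
      rule leading_form_mult_eq[OF leading_form_mult[OF cw_leading_diff_numeral(1,4)]
          leading_form_power[OF cw_leading_diff_numeral(5), where k = 2]]
        leading_form_mult_eq[OF leading_form_power[OF cw_leading_diff_numeral(4), where k = 2]
          leading_form_mult[OF cw_leading_diff_numeral(2,5)]]; simp)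
  then have lead: "cw_leading 8 (((diff_x 3 * diff_y 2 - diff_y 3 * diff_x 2) *
      (diff_x 0 * diff_y 0 * diff_y 1 ^ 2 - diff_y 0 ^ 2 * (diff_x 1 * diff_y 1))) :: (nat + nat, 'k) mpoly) (pivot * (pvar (Inl 0) * pvar (Inr 0) * pvar (Inr 1) ^ 2
        - pvar (Inr 0) ^ 2 * (pvar (Inl 1) * pvar (Inr 1))))" by simp
  have "cw_order (Suc 8) (det_xx - (diff_x 3 * diff_y 2 - diff_y 3 * diff_x 2) *
      (diff_x 0 * diff_y 0 * diff_y 1 ^ 2 - diff_y 0 ^ 2 * (diff_x 1 * diff_y 1)) :: (nat + nat, 'k) mpoly)"
    unfolding det_xx_def
    by (rule order_ge_det4_minus_leading[OF cw_order_diff cw_order_prod cw_order_square(2),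
          where m\<^sub>1 = 7 and n\<^sub>1 = 3 and m\<^sub>2 = 6 and n\<^sub>2 = 3 and m\<^sub>3 = 7 and n\<^sub>3 = 3
          and m\<^sub>4 = 7 and n\<^sub>4 = 3 and m\<^sub>5 = 9 and n\<^sub>5 = 2])
      simp_all
  from leading_form_add_higher[OF lead this]
  have "cw_leading 8 det_xx (pivot * (pvar (Inl 0) * pvar (Inr 0) * pvar (Inr 1) ^ 2
        - pvar (Inr 0) ^ 2 * (pvar (Inl 1) * pvar (Inr 1))) :: (nat + nat, 'k) mpoly)" .
  also have "pivot * (pvar (Inl 0) * pvar (Inr 0) * pvar (Inr 1) ^ 2
        - pvar (Inr 0) ^ 2 * (pvar (Inl 1) * pvar (Inr 1))) = (pivot * (pvar (Inr 0) * pvar (Inr 1) * (cross_u - cross_v)) :: (nat + nat, 'k) mpoly)"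
    by (simp add: cross_u_def cross_v_def algebra_simps power2_eq_square)
  finally show ?thesis .
qed

text \<open>The factor \<open>cross_u + cross_v\<close> corresponds to the coordinate s; the middle
  term of its square is the source of the coefficient 2.\<close>

lemma cw_leading_det_xy:
  "cw_leading 8 det_xy (pivot * ((cross_v - cross_u) * (cross_u + cross_v)) :: (nat + nat, 'k::comm_ring_1) mpoly)"
proof -
  have "cw_leading (4 + 4)
    ((diff_x 3 * diff_y 2 - diff_y 3 * diff_x 2) *
      (diff_y 0 ^ 2 * diff_x 1 ^ 2 - diff_x 0 ^ 2 * diff_y 1 ^ 2))
    (pivot * (pvar (Inr 0) ^ 2 * pvar (Inl 1) ^ 2
        - pvar (Inl 0) ^ 2 * pvar (Inr 1) ^ 2) :: (nat + nat, 'k::comm_ring_1) mpoly)"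
    by (intro leading_form_mult[OF cw_leading_pivot] leading_form_diff;
      rule leading_form_mult_eq[OF leading_form_power[OF cw_leading_diff_numeral(4), where k = 2]
          leading_form_power[OF cw_leading_diff_numeral(2), where k = 2]]
        leading_form_mult_eq[OF leading_form_power[OF cw_leading_diff_numeral(1), where k = 2]
          leading_form_power[OF cw_leading_diff_numeral(5), where k = 2]]; simp)
  then have lead: "cw_leading 8 (((diff_x 3 * diff_y 2 - diff_y 3 * diff_x 2) *
      (diff_y 0 ^ 2 * diff_x 1 ^ 2 - diff_x 0 ^ 2 * diff_y 1 ^ 2)) :: (nat + nat, 'k) mpoly) (pivot * (pvar (Inr 0) ^ 2 * pvar (Inl 1) ^ 2
        - pvar (Inl 0) ^ 2 * pvar (Inr 1) ^ 2))" by simp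
  have "cw_order (Suc 8) (det_xy - (diff_x 3 * diff_y 2 - diff_y 3 * diff_x 2) *
      (diff_y 0 ^ 2 * diff_x 1 ^ 2 - diff_x 0 ^ 2 * diff_y 1 ^ 2) :: (nat + nat, 'k) mpoly)"
    unfolding det_xy_def
    by (rule order_ge_det4_minus_leading[OF cw_order_diff cw_order_square(2,1),
          where m\<^sub>1 = 6 and n\<^sub>1 = 3 and m\<^sub>2 = 7 and n\<^sub>2 = 3 and m\<^sub>3 = 7 and n\<^sub>3 = 3
          and m\<^sub>4 = 6 and n\<^sub>4 = 3 and m\<^sub>5 = 8 and n\<^sub>5 = 2])
      simp_all
  from leading_form_add_higher[OF lead this]
  have "cw_leading 8 det_xy (pivot * (pvar (Inr 0) ^ 2 * pvar (Inl 1) ^ 2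
        - pvar (Inl 0) ^ 2 * pvar (Inr 1) ^ 2) :: (nat + nat, 'k) mpoly)" .
  also have "pivot * (pvar (Inr 0) ^ 2 * pvar (Inl 1) ^ 2
        - pvar (Inl 0) ^ 2 * pvar (Inr 1) ^ 2) = (pivot * ((cross_v - cross_u) * (cross_u + cross_v)) :: (nat + nat, 'k) mpoly)"
    by (simp add: cross_u_def cross_v_def algebra_simps power2_eq_square)
  finally show ?thesis .
qed

section \<open>Affine space\<close>

abbreviation affine_points :: "'v set \<Rightarrow> ('v \<Rightarrow> 'k) set" where
  "affine_points V \<equiv> V \<rightarrow>\<^sub>E UNIV"

lemma zariski_affine_space: "zariski (affine_space V) = topology_generated_by
    {{z \<in> affine_points V. peval P z \<noteq> 0} | P. True}"
  by (simp add: affine_space_def variety_of_charts_def charts_topology_def)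

lemma openin_affine_space_basic: "openin (zariski (affine_space V)) {z \<in> affine_points V. peval P z \<noteq> 0}"
  unfolding zariski_affine_space by (rule topology_generated_by_Basis) blast

lemma openin_affine_space: "openin (zariski (affine_space V :: ('v \<Rightarrow> 'k::field, 'k) space)) (affine_points V)"
  using openin_affine_space_basic[of V 1] by simp

lemma topspace_affine_space [simp]: "topspace (zariski (affine_space V :: ('v \<Rightarrow> 'k::field, 'k) space)) = affine_points V"
proof
  show "topspace (zariski (affine_space V :: ('v \<Rightarrow> 'k, 'k) space)) \<subseteq> affine_points V"
    unfolding zariski_affine_space topology_generated_by_topspace by blast
qed (use openin_affine_space openin_subset in blast)

lemma regular_affine_spaceI:
  assumes "openin (zariski (affine_space V)) U" "f \<in> extensional U"
    and "\<And>z. z \<in> U \<Longrightarrow> peval Q z \<noteq> 0 \<and> f z = peval P z / peval Q z"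
  shows "f \<in> regular (affine_space V) U"
proof -
  have "U \<subseteq> affine_points V"
    using openin_subset[OF assms(1)] by simp
  then have "\<exists>W P Q. openin (zariski (affine_space V)) W \<and> x \<in> W \<and> W \<subseteq> U \<inter> affine_points V \<and>
      (\<forall>y\<in>W. peval Q y \<noteq> 0 \<and> f y = peval P y / peval Q y)" if "x \<in> U" for x
    using assms(1,3) that by (intro exI[of _ U] exI[of _ P] exI[of _ Q]) auto
  with assms(2) show ?thesis
    by (simp add: affine_space_def variety_of_charts_def charts_regular_def)
qed

lemma regular_affine_space_polynomial:
  assumes "openin (zariski (affine_space V)) U"
  shows "(\<lambda>z\<in>U. peval P z) \<in> regular (affine_space V) U"
  using assms by (intro regular_affine_spaceI[of V U _ 1 P]) auto

lemma standard_splittingD: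
  assumes "standard_splitting V \<tau>" "order_ge V w n g"
  shows "\<tau> (affine_points V) (\<lambda>z\<in>affine_points V. peval g z) =
    (\<lambda>z\<in>affine_points V. peval (standard_splitting_poly V g) z)"
  using assms(2) conjunct2[OF assms(1)[unfolded standard_splitting_def], rule_format, of g]
  by (simp add: order_ge_def)

lemma frobenius_splittingD:
  fixes X :: "('a, 'k::field) space"
  assumes "frobenius_splitting X \<phi>" "openin (zariski X) U" "f \<in> regular X U"
  shows "\<phi> U f \<in> regular X U"
    "openin (zariski X) W \<Longrightarrow> W \<subseteq> U \<Longrightarrow> \<phi> W (restrict f W) = restrict (\<phi> U f) W"
    "g \<in> regular X U \<Longrightarrow> \<phi> U (\<lambda>x\<in>U. f x + g x) = (\<lambda>x\<in>U. \<phi> U f x + \<phi> U g x)"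
    "g \<in> regular X U \<Longrightarrow> \<phi> U (\<lambda>x\<in>U. f x ^ CHAR('k) * g x) = (\<lambda>x\<in>U. f x * \<phi> U g x)"
    "\<phi> U (\<lambda>x\<in>U. f x ^ CHAR('k)) = f"
proof -
  note * = assms(1)[unfolded frobenius_splitting_def, rule_format, OF assms(2)]
  show "\<phi> U f \<in> regular X U"
    using conjunct1[OF *] assms(3) by simp
  show "openin (zariski X) W \<Longrightarrow> W \<subseteq> U \<Longrightarrow> \<phi> W (restrict f W) = restrict (\<phi> U f) W"
    using conjunct1[OF conjunct2[OF *]] assms(3) by simp
  show "g \<in> regular X U \<Longrightarrow> \<phi> U (\<lambda>x\<in>U. f x + g x) = (\<lambda>x\<in>U. \<phi> U f x + \<phi> U g x)"
    using conjunct1[OF conjunct2[OF conjunct2[OF *]]] assms(3) by simp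
  show "g \<in> regular X U \<Longrightarrow> \<phi> U (\<lambda>x\<in>U. f x ^ CHAR('k) * g x) = (\<lambda>x\<in>U. f x * \<phi> U g x)"
    using conjunct1[OF conjunct2[OF conjunct2[OF conjunct2[OF *]]]] assms(3) by simp
  show "\<phi> U (\<lambda>x\<in>U. f x ^ CHAR('k)) = f"
    using conjunct2[OF conjunct2[OF conjunct2[OF conjunct2[OF *]]]] assms(3) by simp
qed

text \<open>Additivity is inherited from the sheaf map \<open>\<tau>\<close> on polynomial
  functions, which avoids additivity of \<open>frobenius_root\<close>; hence the statement about
  values at points. The next two lemmas obtain p-linearity and the normalization in the same
  way.\<close>

lemma standard_splitting_poly_add:
  fixes P Q :: "('v, 'k::alg_closed_field) mpoly" and \<tau> :: "('v \<Rightarrow> 'k, 'k) sheaf_map"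
  assumes \<tau>: "standard_splitting V \<tau>" and P: "order_ge V w n P" and Q: "order_ge V w m Q"
    and z: "z \<in> affine_points V"
  shows "peval (standard_splitting_poly V (P + Q)) z =
    peval (standard_splitting_poly V P) z + peval (standard_splitting_poly V Q) z"
proof -
  let ?A = "affine_points V :: ('v \<Rightarrow> 'k) set"
  have fs: "frobenius_splitting (affine_space V) \<tau>"
    using \<tau> by (simp add: standard_splitting_def)
  have PQ: "order_ge V w 0 (P + Q)"
    using P Q by (auto intro: order_ge_add elim: order_ge_mono)
  have "\<tau> ?A (\<lambda>z\<in>?A. peval (P + Q) z)
      = \<tau> ?A (\<lambda>z\<in>?A. (\<lambda>z\<in>?A. peval P z) z + (\<lambda>z\<in>?A. peval Q z) z)"
    by (intro arg_cong[of _ _ "\<tau> ?A"] restrict_ext) simp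
  also have "\<dots> = (\<lambda>z\<in>?A. \<tau> ?A (\<lambda>z\<in>?A. peval P z) z + \<tau> ?A (\<lambda>z\<in>?A. peval Q z) z)"
    by (intro frobenius_splittingD(3)[OF fs] regular_affine_space_polynomial openin_affine_space)
  finally have "(\<lambda>z\<in>?A. peval (standard_splitting_poly V (P + Q)) z) z
      = (\<lambda>z\<in>?A. \<tau> ?A (\<lambda>z\<in>?A. peval P z) z + \<tau> ?A (\<lambda>z\<in>?A. peval Q z) z) z"
    by (simp only: standard_splittingD[OF \<tau> PQ])
  with z show ?thesis
    by (simp add: standard_splittingD[OF \<tau> P] standard_splittingD[OF \<tau> Q])
qed

lemma standard_splitting_poly_mult:
  fixes P Q :: "('v, 'k::alg_closed_field) mpoly" and \<tau> :: "('v \<Rightarrow> 'k, 'k) sheaf_map"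
  assumes \<tau>: "standard_splitting V \<tau>" and P: "order_ge V w n P" and Q: "order_ge V w m Q"
    and z: "z \<in> affine_points V"
  shows "peval (standard_splitting_poly V (P ^ CHAR('k) * Q)) z =
    peval P z * peval (standard_splitting_poly V Q) z"
proof -
  let ?A = "affine_points V :: ('v \<Rightarrow> 'k) set"
  have fs: "frobenius_splitting (affine_space V) \<tau>"
    using \<tau> by (simp add: standard_splitting_def)
  have PQ: "order_ge V w (n * CHAR('k) + m) (P ^ CHAR('k) * Q)"
    using P Q by (intro order_ge_mult order_ge_power)
  have "\<tau> ?A (\<lambda>z\<in>?A. peval (P ^ CHAR('k) * Q) z)
      = \<tau> ?A (\<lambda>z\<in>?A. (\<lambda>z\<in>?A. peval P z) z ^ CHAR('k) * (\<lambda>z\<in>?A. peval Q z) z)"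
    by (intro arg_cong[of _ _ "\<tau> ?A"] restrict_ext) simp
  also have "\<dots> = (\<lambda>z\<in>?A. (\<lambda>z\<in>?A. peval P z) z * \<tau> ?A (\<lambda>z\<in>?A. peval Q z) z)"
    by (intro frobenius_splittingD(4)[OF fs] regular_affine_space_polynomial openin_affine_space)
  finally have "(\<lambda>z\<in>?A. peval (standard_splitting_poly V (P ^ CHAR('k) * Q)) z) z
      = (\<lambda>z\<in>?A. (\<lambda>z\<in>?A. peval P z) z * \<tau> ?A (\<lambda>z\<in>?A. peval Q z) z) z"
    by (simp only: standard_splittingD[OF \<tau> PQ])
  with z show ?thesis
    by (simp add: standard_splittingD[OF \<tau> Q])
qed

lemma standard_splitting_poly_power:
  fixes P :: "('v, 'k::alg_closed_field) mpoly" and \<tau> :: "('v \<Rightarrow> 'k, 'k) sheaf_map"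
  assumes \<tau>: "standard_splitting V \<tau>" and P: "order_ge V w n P" and z: "z \<in> affine_points V"
  shows "peval (standard_splitting_poly V (P ^ CHAR('k))) z = peval P z"
proof -
  let ?A = "affine_points V :: ('v \<Rightarrow> 'k) set"
  have fs: "frobenius_splitting (affine_space V) \<tau>"
    using \<tau> by (simp add: standard_splitting_def)
  have "\<tau> ?A (\<lambda>z\<in>?A. peval (P ^ CHAR('k)) z) = \<tau> ?A (\<lambda>z\<in>?A. (\<lambda>z\<in>?A. peval P z) z ^ CHAR('k))"
    by (intro arg_cong[of _ _ "\<tau> ?A"] restrict_ext) simp
  also have "\<dots> = (\<lambda>z\<in>?A. peval P z)"
    by (intro frobenius_splittingD(5)[OF fs] regular_affine_space_polynomial openin_affine_space)
  finally have "(\<lambda>z\<in>?A. peval (standard_splitting_poly V (P ^ CHAR('k))) z) z = (\<lambda>z\<in>?A. peval P z) z"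
    by (simp only: standard_splittingD[OF \<tau> order_ge_power[OF P]])
  with z show ?thesis by simp
qed

section \<open>The splitting of the test polynomial\<close>

definition homogeneous_in :: "'v \<Rightarrow> nat \<Rightarrow> ('v, 'k::zero) mpoly \<Rightarrow> bool" where
  "homogeneous_in v n P \<longleftrightarrow> (\<forall>m\<in>Poly_Mapping.keys P. Poly_Mapping.lookup m v = n)"

lemma homogeneous_in_mult:
  assumes "homogeneous_in v n P" "homogeneous_in v m Q"
  shows "homogeneous_in v (n + m) (P * Q)"
  unfolding homogeneous_in_def
proof
  fix k assume "k \<in> Poly_Mapping.keys (P * Q)"
  then obtain a b where "a \<in> Poly_Mapping.keys P" "b \<in> Poly_Mapping.keys Q" "k = a + b"
    using keys_mult[of P Q] by blast
  with assms show "Poly_Mapping.lookup k v = n + m"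
    by (simp add: homogeneous_in_def lookup_add)
qed

lemma homogeneous_in_mult_eq:
  "homogeneous_in v n P \<Longrightarrow> homogeneous_in v m Q \<Longrightarrow> n + m = k \<Longrightarrow> homogeneous_in v k (P * Q)"
  using homogeneous_in_mult[of v n P m Q] by simp

lemma homogeneous_in_power: "homogeneous_in v n P \<Longrightarrow> homogeneous_in v (n * k) (P ^ k)"
proof (induction k)
  case 0
  then show ?case by (simp add: homogeneous_in_def)
next
  case (Suc k)
  then show ?case using homogeneous_in_mult[of v n P "n * k" "P ^ k"] by simp
qed

lemma homogeneous_in_pvar: "homogeneous_in v (if u = v then 1 else 0) (pvar u)"
  by (auto simp: homogeneous_in_def pvar_def lookup_single)

lemma standard_splitting_poly_homogeneous_in:
  fixes g :: "('v, 'k::alg_closed_field) mpoly"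
  assumes "finite V" "CHAR('k) > 0" "homogeneous_in v n g" "\<not> CHAR('k) dvd n"
  shows "standard_splitting_poly V g = 0"
proof (rule standard_splitting_poly_eq_0[OF assms(1,2)])
  fix m assume "m \<in> Poly_Mapping.keys g"
  then show "\<exists>v. \<not> CHAR('k) dvd Poly_Mapping.lookup m v"
    using assms(3,4) by (intro exI[of _ v]) (simp add: homogeneous_in_def)
qed

lemma homogeneous_in_cross:
  "homogeneous_in (Inl 0) 1 (cross_u :: (nat + nat, 'k::comm_ring_1) mpoly)"
  "homogeneous_in (Inl 0) 0 (cross_v :: (nat + nat, 'k::comm_ring_1) mpoly)"
  "homogeneous_in (Inl 1) 0 (cross_u :: (nat + nat, 'k::comm_ring_1) mpoly)"
  "homogeneous_in (Inl 1) 1 (cross_v :: (nat + nat, 'k::comm_ring_1) mpoly)"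
  unfolding cross_u_def cross_v_def
  by (rule homogeneous_in_mult_eq[OF homogeneous_in_pvar homogeneous_in_pvar]; simp)+

text \<open>By Cramer's rule s^2 t^(p-1) is D_s^2 D_t^(p-1) / \<Delta>^(p+1). Multiplying by the
  p-th power \<Delta>^(2p) clears the denominator and leaves this polynomial; the splitting turns
  that factor into \<Delta>^2.\<close>

definition test_poly :: "nat \<Rightarrow> (nat + nat, 'k::comm_ring_1) mpoly" where
  "test_poly p = det_xy ^ 2 * (det_xx * det_basis) ^ (p - 1)"

lemma cw_order_atoms:
  "cw_order 0 (cross_u :: (nat + nat, 'k::comm_ring_1) mpoly)"
  "cw_order 0 (cross_v :: (nat + nat, 'k::comm_ring_1) mpoly)"
  "cw_order 0 (pivot :: (nat + nat, 'k::comm_ring_1) mpoly)"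
  unfolding cross_u_def cross_v_def pivot_def
  by (rule order_ge_mono[OF order_ge_mult[OF cw_order_pvar[OF _ order.refl] cw_order_pvar[OF _ order.refl]]]; simp)+

text \<open>The leading form has weight 16 p and can be split by hand into p-th powers times
  remainders; all other terms have larger weight, hence after splitting weight at least 17.\<close>

lemma standard_splitting_test_poly:
  fixes \<tau> :: "(nat + nat \<Rightarrow> 'k::alg_closed_field, 'k) sheaf_map"
  assumes \<tau>: "standard_splitting vars5 \<tau>" and p: "CHAR('k) = p" "2 < p"
  shows "\<exists>R. cw_order 17 R \<and> (\<forall>z\<in>affine_points vars5.
    peval (standard_splitting_poly vars5 (test_poly p :: (nat + nat, 'k) mpoly)) z =
      2 * peval (pivot ^ 2 * (cross_u - cross_v) ^ 2 * (cross_u * cross_v)) z + peval R z)"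
proof -
  let ?S = "standard_splitting_poly vars5 :: (nat + nat, 'k) mpoly \<Rightarrow> (nat + nat, 'k) mpoly"
  define u where "u = (cross_u :: (nat + nat, 'k) mpoly)"
  define v where "v = (cross_v :: (nat + nat, 'k) mpoly)"
  define A where "A = pivot ^ 2 * (u - v) ^ 2"
  define N0 where "N0 = (pivot * ((v - u) * (u + v))) ^ 2 *
    ((pivot * (pvar (Inr 0) * pvar (Inr 1) * (u - v))) *
      (pivot * (pvar (Inl 0) * pvar (Inl 1) * (v - u)))) ^ (p - 1)"
  obtain q where q: "p = Suc q" using p(2) by (cases p) auto
  have "prime p"
    using p prime_CHAR_semidom[where ?'a = 'k] by simp
  then have "odd p" using p(2) prime_odd_nat by blast
  \<comment> \<open>Oddness of \<open>p\<close> removes the sign of the product of the leading forms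
    of \<open>det_xx\<close> and \<open>det_basis\<close>.\<close>
  then have "even q" by (simp add: q)
  \<comment> \<open>Expanding \<open>(u + v) ^ 2\<close> and writing each term as a
    \<open>p\<close>-th power times a remainder: the middle term gives \<open>(u * v) ^ p\<close>
    twice, the outer ones leave \<open>u * v ^ q\<close> and \<open>v * u ^ q\<close>.\<close>
  have N0: "N0 = A ^ p * ((u * v) ^ p + ((u * v) ^ p + (u ^ p * (u * v ^ q) + v ^ p * (v * u ^ q))))"
  proof -
    have "(pivot * (pvar (Inr 0) * pvar (Inr 1) * (u - v))) * (pivot * (pvar (Inl 0) * pvar (Inl 1) * (v - u)))
        = - (A * (u * v))"
      by (simp add: A_def u_def v_def cross_u_def cross_v_def power2_eq_square algebra_simps)
    moreover have "(- (A * (u * v))) ^ q = A ^ q * (u ^ q * v ^ q)"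
      using \<open>even q\<close> by (simp add: power_mult_distrib)
    ultimately have "N0 = (pivot * ((v - u) * (u + v))) ^ 2 * (A ^ q * (u ^ q * v ^ q))"
      by (simp add: N0_def q)
    also have "(pivot * ((v - u) * (u + v))) ^ 2 = A * (u + v) ^ 2"
      by (simp add: A_def power2_eq_square algebra_simps)
    also have "A * (u + v) ^ 2 * (A ^ q * (a * b)) =
        A * A ^ q * (u * v * (a * b) + (u * v * (a * b) + (u * a * (u * b) + v * b * (v * a))))" for a b
      by (simp add: power2_eq_square algebra_simps)
    finally show ?thesis
      by (simp only: q power_Suc power_mult_distrib)
  qed
  have ord: "cw_order 0 u" "cw_order 0 v"
    using cw_order_atoms by (simp_all add: u_def v_def)
  have ord_mult: "cw_order 0 (P * Q)" if "cw_order 0 P" "cw_order 0 Q" for P Q :: "(nat + nat, 'k) mpoly"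
    using order_ge_mult[OF that] by simp
  have ord_power: "cw_order 0 (P ^ n)" if "cw_order 0 P" for P :: "(nat + nat, 'k) mpoly" and n
    using order_ge_power[OF that, of n] by simp
  note ords = ord ord_mult ord_power order_ge_add order_ge_diff
  have ordA: "cw_order 0 A"
    unfolding A_def using cw_order_atoms(3) by (intro ords)
  \<comment> \<open>x_0 occurs in \<open>cross_u\<close> only, so this remainder has degree 1 in it,
    which is no multiple of \<open>p\<close>; the other remainder is killed by x_1.\<close>
  have "homogeneous_in (Inl 0) 1 (u * v ^ q)"
    unfolding u_def v_def
    by (rule homogeneous_in_mult_eq[OF homogeneous_in_cross(1) homogeneous_in_power[OF homogeneous_in_cross(2)]]) simp
  then have S1: "?S (u * v ^ q) = 0"
    using p by (intro standard_splitting_poly_homogeneous_in[of _ "Inl 0" 1]) auto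
  have "homogeneous_in (Inl 1) 1 (v * u ^ q)"
    unfolding u_def v_def
    by (rule homogeneous_in_mult_eq[OF homogeneous_in_cross(4) homogeneous_in_power[OF homogeneous_in_cross(3)]]) simp
  then have S2: "?S (v * u ^ q) = 0"
    using p by (intro standard_splitting_poly_homogeneous_in[of _ "Inl 1" 1]) auto
  have SN0: "peval (?S N0) z = 2 * peval (A * (u * v)) z" if z: "z \<in> affine_points vars5" for z
  proof -
    note mult = standard_splitting_poly_mult[OF \<tau> _ _ z, where w = curve_weight and n = 0 and m = 0, unfolded p(1)]
    note add = standard_splitting_poly_add[OF \<tau> _ _ z, where w = curve_weight and n = 0 and m = 0]
    have o: "cw_order 0 (u * v)" "cw_order 0 ((u * v) ^ p)" "cw_order 0 (u * v ^ q)" "cw_order 0 (v * u ^ q)"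
      "cw_order 0 (u ^ p * (u * v ^ q))" "cw_order 0 (v ^ p * (v * u ^ q))"
      by (intro ords)+
    have o': "cw_order 0 (u ^ p * (u * v ^ q) + v ^ p * (v * u ^ q))"
      "cw_order 0 ((u * v) ^ p + (u ^ p * (u * v ^ q) + v ^ p * (v * u ^ q)))"
      "cw_order 0 ((u * v) ^ p + ((u * v) ^ p + (u ^ p * (u * v ^ q) + v ^ p * (v * u ^ q))))"
      by (intro order_ge_add o)+
    have "peval (?S ((u * v) ^ p)) z = peval (u * v) z"
      using standard_splitting_poly_power[OF \<tau> o(1) z] by (simp add: p(1))
    then show ?thesis
      unfolding N0 mult[OF ordA o'(3)] add[OF o(2) o'(2)] add[OF o(2) o'(1)] add[OF o(5,6)]
        mult[OF ord(1) o(3)] mult[OF ord(2) o(4)] S1 S2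
      by (simp add: algebra_simps)
  qed
  define R where "R = ?S (test_poly p - N0)"
  have "cw_leading (8 * 2 + (8 + 8) * (p - 1)) (test_poly p) N0"
    unfolding test_poly_def N0_def u_def v_def
    by (intro leading_form_mult leading_form_power cw_leading_det_basis cw_leading_det_xx cw_leading_det_xy)
  \<comment> \<open>The weight is an exact multiple of \<open>p\<close>, as the order bound for the
    splitting requires.\<close>
  also have "8 * 2 + (8 + 8) * (p - 1) = p * 16"
    by (simp add: q)
  finally have lead: "cw_order (Suc (p * 16)) (test_poly p - N0)"
    by (simp add: leading_form_def)
  then have "cw_order (Suc 16) R"
    unfolding R_def using p by (intro order_ge_standard_splitting_poly) simp_all
  moreover have "peval (?S (test_poly p)) z = 2 * peval (A * (u * v)) z + peval R z"
    if z: "z \<in> affine_points vars5" for z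
  proof -
    have "cw_order 0 N0"
      unfolding N0 by (intro ords ordA)
    from standard_splitting_poly_add[OF \<tau> this lead z] show ?thesis
      by (simp add: SN0[OF z] R_def)
  qed
  ultimately show ?thesis
    by (auto simp: A_def u_def v_def)
qed

section \<open>Ideals and bases modulo ideals\<close>

lemma module_ring: "module ((*) :: 'a::comm_ring_1 \<Rightarrow> 'a \<Rightarrow> 'a)"
  by unfold_locales (simp_all add: algebra_simps)

lemma is_ideal_iff:
  "is_ideal I \<longleftrightarrow> 0 \<in> I \<and> (\<forall>f\<in>I. \<forall>g\<in>I. f + g \<in> I) \<and> (\<forall>r. \<forall>f\<in>I. r * f \<in> I)"
  by (simp add: module.subspace_def[OF module_ring])

lemma ideal_0: "is_ideal I \<Longrightarrow> 0 \<in> I"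
  and ideal_add: "is_ideal I \<Longrightarrow> f \<in> I \<Longrightarrow> g \<in> I \<Longrightarrow> f + g \<in> I"
  and ideal_mult: "is_ideal I \<Longrightarrow> f \<in> I \<Longrightarrow> r * f \<in> I"
  by (simp_all add: is_ideal_iff)

lemma ideal_uminus: "is_ideal I \<Longrightarrow> f \<in> I \<Longrightarrow> - f \<in> I"
  using ideal_mult[of I f "- 1"] by simp

lemma ideal_diff: "is_ideal I \<Longrightarrow> f \<in> I \<Longrightarrow> g \<in> I \<Longrightarrow> f - g \<in> I"
  using ideal_add[of I f "- g"] ideal_uminus[of I g] by simp

lemma ideal_sum: "is_ideal I \<Longrightarrow> (\<And>a. a \<in> A \<Longrightarrow> f a \<in> I) \<Longrightarrow> sum f A \<in> I"
  by (induction A rule: infinite_finite_induct) (auto simp: ideal_0 ideal_add)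

lemma smult_const_eq_mult: "smult [:c:] f = [:[:c:]:] * f"
  by simp

lemma ideal_smult: "is_ideal I \<Longrightarrow> f \<in> I \<Longrightarrow> smult [:c:] f \<in> I"
  unfolding smult_const_eq_mult by (rule ideal_mult)

definition lincomb :: "'i set \<Rightarrow> ('i \<Rightarrow> 'k::field poly poly) \<Rightarrow> ('i \<Rightarrow> 'k) \<Rightarrow> 'k poly poly" where
  "lincomb B e a = (\<Sum>b\<in>B. smult [:a b:] (e b))"

lemma smult_const_add: "smult [:a + b:] f = smult [:a:] f + smult [:b:] f"
  by (simp flip: smult_add_left)

lemma smult_const_diff: "smult [:a - b:] f = smult [:a:] f - smult [:b:] f"
  for f :: "'k::field poly poly"
  using smult_const_add[of "a - b" b f] by (simp add: eq_diff_eq)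

lemma smult_const_sum: "smult [:sum g A:] f = (\<Sum>a\<in>A. smult [:g a:] f)"
  by (induction A rule: infinite_finite_induct) (simp_all add: smult_const_add)

lemma smult_sum_right: "smult c (sum f A) = (\<Sum>a\<in>A. smult c (f a))"
  by (induction A rule: infinite_finite_induct) (simp_all add: smult_add_right)

lemma lincomb_add: "lincomb B e (\<lambda>b. a b + a' b) = lincomb B e a + lincomb B e a'"
  by (simp add: lincomb_def smult_const_add sum.distrib)

lemma lincomb_diff: "lincomb B e (\<lambda>b. a b - a' b) = lincomb B e a - lincomb B e a'"
  by (simp add: lincomb_def smult_const_diff sum_subtractf)

lemma lincomb_scale: "lincomb B e (\<lambda>b. c * a b) = smult [:c:] (lincomb B e a)"
  by (simp add: lincomb_def smult_sum_right mult.commute)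

lemma lincomb_cong: "(\<And>b. b \<in> B \<Longrightarrow> a b = a' b) \<Longrightarrow> lincomb B e a = lincomb B e a'"
  by (simp add: lincomb_def)

lemma lincomb_single: "finite B \<Longrightarrow> b \<in> B \<Longrightarrow> lincomb B e (\<lambda>b'. if b' = b then c else 0) = smult [:c:] (e b)"
proof -
  assume "finite B" "b \<in> B"
  have "lincomb B e (\<lambda>b'. if b' = b then c else 0) = (\<Sum>b'\<in>B. if b' = b then smult [:c:] (e b) else 0)"
    unfolding lincomb_def by (intro sum.cong) auto
  then show ?thesis using \<open>finite B\<close> \<open>b \<in> B\<close> by simp
qed

lemma basis_mod_iff:
  assumes I: "is_ideal I"
  shows "basis_mod I B e \<longleftrightarrow> (\<forall>f. \<exists>a. f - lincomb B e a \<in> I) \<and>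
    (\<forall>a. lincomb B e a \<in> I \<longrightarrow> (\<forall>b\<in>B. a b = 0))"
proof (intro iffI conjI allI impI)
  assume bm: "basis_mod I B e"
  show "\<exists>a. f - lincomb B e a \<in> I" for f
    using bm by (auto simp: basis_mod_def represents_def lincomb_def)
  fix a assume a: "lincomb B e a \<in> I"
  obtain a0 where a0: "\<And>a. represents I B e 0 a \<Longrightarrow> a = a0"
    using bm unfolding basis_mod_def by blast
  have "represents I B e 0 (restrict a B)"
    using ideal_uminus[OF I a] by (simp add: represents_def lincomb_def)
  moreover have "represents I B e 0 (\<lambda>b\<in>B. 0)"
    using ideal_0[OF I] by (simp add: represents_def)
  ultimately have "restrict a B = (\<lambda>b\<in>B. 0)" using a0 by metis
  then show "\<forall>b\<in>B. a b = 0" by (metis restrict_apply')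
next
  assume R: "(\<forall>f. \<exists>a. f - lincomb B e a \<in> I) \<and> (\<forall>a. lincomb B e a \<in> I \<longrightarrow> (\<forall>b\<in>B. a b = 0))"
  show "basis_mod I B e"
    unfolding basis_mod_def
  proof
    fix f
    obtain a where a: "f - lincomb B e a \<in> I" using R by blast
    show "\<exists>!a. represents I B e f a"
    proof (rule ex1I)
      show "represents I B e f (restrict a B)"
        using a by (simp add: represents_def lincomb_def)
      fix a' assume a': "represents I B e f a'"
      then have "f - lincomb B e a' \<in> I" by (simp add: represents_def lincomb_def)
      from ideal_diff[OF I this a] have "lincomb B e (\<lambda>b. a b - a' b) \<in> I"
        by (simp add: lincomb_diff)
      then have "\<forall>b\<in>B. a b - a' b = 0" using R by blast
      moreover have "a' \<in> extensional B" using a' by (simp add: represents_def PiE_def)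
      ultimately show "a' = restrict a B"
        by (intro extensionalityI[of a' B]) auto
    qed
  qed
qed

lemma basis_mod_reindex:
  assumes I: "is_ideal I" and e: "basis_mod I B e" and h: "bij_betw h A B"
  shows "basis_mod I A (\<lambda>i. e (h i))"
proof -
  have *: "lincomb A (\<lambda>i. e (h i)) (\<lambda>i. a (h i)) = lincomb B e a" for a
    unfolding lincomb_def by (rule sum.reindex_bij_betw[OF h])
  have inv: "the_inv_into A h (h i) = i" if "i \<in> A" for i
    using h that by (simp add: bij_betw_def the_inv_into_f_f)
  show ?thesis
    unfolding basis_mod_iff[OF I]
  proof (intro conjI allI impI)
    show "\<exists>a. f - lincomb A (\<lambda>i. e (h i)) a \<in> I" for f
      using e * unfolding basis_mod_iff[OF I] by metis
    fix a assume a: "lincomb A (\<lambda>i. e (h i)) a \<in> I"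
    have "lincomb A (\<lambda>i. e (h i)) a = lincomb B e (\<lambda>b. a (the_inv_into A h b))"
      unfolding *[of "\<lambda>b. a (the_inv_into A h b)", symmetric]
      by (rule lincomb_cong) (simp add: inv)
    with a have "lincomb B e (\<lambda>b. a (the_inv_into A h b)) \<in> I" by simp
    with e have "\<forall>b\<in>B. a (the_inv_into A h b) = 0"
      unfolding basis_mod_iff[OF I] by blast
    then show "\<forall>i\<in>A. a i = 0"
      using h inv by (metis bij_betwE)
  qed
qed

lemma hilb_chart_domain_iff:
  assumes "finite B" "card B = n"
  shows "I \<in> hilb_chart_domain n B \<longleftrightarrow> is_ideal I \<and> basis_mod I B xy_monom"
proof -
  obtain h where "bij_betw h {..<n} B"
    using ex_bij_betw_nat_finite[OF assms(1)] assms(2) by (auto simp: atLeast0LessThan)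
  then have "is_ideal I \<Longrightarrow> basis_mod I B xy_monom \<Longrightarrow> basis_mod I {..<n} (\<lambda>i. xy_monom (h i))"
    by (rule basis_mod_reindex[rotated 2])
  then show ?thesis by (auto simp: hilb_chart_domain_def hilb_points_def)
qed

lemma hilb_coord_eqI:
  assumes I: "is_ideal I" and bm: "basis_mod I B xy_monom"
    and a: "xy_monom m - lincomb B xy_monom a \<in> I" and b: "b \<in> B"
  shows "hilb_coord B I (m, b) = a b"
proof -
  have "represents I B xy_monom (xy_monom m) (restrict a B)"
    using a by (simp add: represents_def lincomb_def)
  then have "(THE a. represents I B xy_monom (xy_monom m) a) = restrict a B"
    using bm unfolding basis_mod_def by (intro the1_equality) auto
  then show ?thesis using b by (simp add: hilb_coord_def)
qed

lemma hilb_coord_expansion: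
  assumes I: "is_ideal I" and bm: "basis_mod I B xy_monom"
  shows "xy_monom m - lincomb B xy_monom (\<lambda>b. hilb_coord B I (m, b)) \<in> I"
proof -
  obtain a where a: "xy_monom m - lincomb B xy_monom a \<in> I"
    using bm unfolding basis_mod_iff[OF I] by blast
  have "lincomb B xy_monom (\<lambda>b. hilb_coord B I (m, b)) = lincomb B xy_monom a"
    by (rule lincomb_cong) (rule hilb_coord_eqI[OF I bm a])
  with a show ?thesis by simp
qed

lemma xy_poly_induct [case_names zero one add scale x y]:
  fixes f :: "'k::field poly poly"
  assumes "P 0" "P 1" "\<And>f g. P f \<Longrightarrow> P g \<Longrightarrow> P (f + g)" "\<And>c f. P f \<Longrightarrow> P (smult [:c:] f)"
    and "\<And>f. P f \<Longrightarrow> P (var_x * f)" "\<And>f. P f \<Longrightarrow> P (var_y * f)"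
  shows "P f"
proof -
  have const: "P [:c:]" for c :: "'k poly"
  proof (induction c)
    case 0
    then show ?case using assms(1) by simp
  next
    case (pCons a c)
    have "[:pCons a c:] = smult [:a:] 1 + var_x * [:c:]"
      by (simp add: var_x_def)
    then show ?case using assms pCons by metis
  qed
  show ?thesis
  proof (induction f)
    case 0
    then show ?case using assms(1) .
  next
    case (pCons c f)
    have "pCons c f = [:c:] + var_y * f"
      by (simp add: var_y_def)
    then show ?case using assms const pCons by metis
  qed
qed

text \<open>If the matrices of multiplication by \<open>x\<close> and \<open>y\<close> depend polynomially on a parameter, so do all
  normal forms.\<close>

lemma normal_form_family:
  fixes I :: "'k::field \<Rightarrow> 'k poly poly set"
  assumes B: "finite B" "(0, 0) \<in> B"
    and I: "\<And>t. t \<in> T \<Longrightarrow> is_ideal (I t)"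
    and x: "\<And>b. b \<in> B \<Longrightarrow> \<exists>a. \<forall>t\<in>T. var_x * xy_monom b - lincomb B xy_monom (\<lambda>b'. poly (a b') t) \<in> I t"
    and y: "\<And>b. b \<in> B \<Longrightarrow> \<exists>a. \<forall>t\<in>T. var_y * xy_monom b - lincomb B xy_monom (\<lambda>b'. poly (a b') t) \<in> I t"
  shows "\<exists>a. \<forall>t\<in>T. f - lincomb B xy_monom (\<lambda>b. poly (a b) t) \<in> I t"
proof (induction f rule: xy_poly_induct)
  have mult: "\<exists>a. \<forall>t\<in>T. v * f - lincomb B xy_monom (\<lambda>b. poly (a b) t) \<in> I t"
    if f: "\<exists>a. \<forall>t\<in>T. f - lincomb B xy_monom (\<lambda>b. poly (a b) t) \<in> I t"
      and v: "\<And>b. b \<in> B \<Longrightarrow> \<exists>a. \<forall>t\<in>T. v * xy_monom b - lincomb B xy_monom (\<lambda>b'. poly (a b') t) \<in> I t"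
    for v f
  proof -
    obtain a where a: "\<And>t. t \<in> T \<Longrightarrow> f - lincomb B xy_monom (\<lambda>b. poly (a b) t) \<in> I t"
      using f by blast
    have "\<forall>b\<in>B. \<exists>a. \<forall>t\<in>T. v * xy_monom b - lincomb B xy_monom (\<lambda>b'. poly (a b') t) \<in> I t"
      using v by blast
    from bchoice[OF this] obtain M where M: "\<And>b t. b \<in> B \<Longrightarrow> t \<in> T \<Longrightarrow>
        v * xy_monom b - lincomb B xy_monom (\<lambda>b'. poly (M b b') t) \<in> I t"
      by auto
    \<comment> \<open>The new coefficients are the coefficient vector of \<open>f\<close> times the
      matrix \<open>M\<close>. The error is \<open>v\<close> times the error of \<open>f\<close>
      plus a combination of the errors of the rows of \<open>M\<close>, all in the ideal.\<close>
    have "v * f - lincomb B xy_monom (\<lambda>b'. poly (\<Sum>b\<in>B. a b * M b b') t) \<in> I t" if t: "t \<in> T" for t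
    proof -
      have "lincomb B xy_monom (\<lambda>b'. poly (\<Sum>b\<in>B. a b * M b b') t)
          = (\<Sum>b'\<in>B. \<Sum>b\<in>B. smult [:poly (a b) t * poly (M b b') t:] (xy_monom b'))"
        unfolding lincomb_def poly_sum poly_mult
        by (simp add: smult_const_sum)
      also have "\<dots> = (\<Sum>b\<in>B. smult [:poly (a b) t:] (lincomb B xy_monom (\<lambda>b'. poly (M b b') t)))"
        by (subst sum.swap) (simp add: lincomb_def smult_sum_right mult.commute)
      finally have eq: "v * f - lincomb B xy_monom (\<lambda>b'. poly (\<Sum>b\<in>B. a b * M b b') t)
          = v * (f - lincomb B xy_monom (\<lambda>b. poly (a b) t)) +
            (\<Sum>b\<in>B. smult [:poly (a b) t:] (v * xy_monom b - lincomb B xy_monom (\<lambda>b'. poly (M b b') t)))"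
        by (simp add: right_diff_distrib smult_diff_right sum_subtractf lincomb_def sum_distrib_left)
      show ?thesis
        unfolding eq
        by (rule ideal_add[OF I[OF t] ideal_mult[OF I[OF t] a[OF t]]
              ideal_sum[OF I[OF t] ideal_smult[OF I[OF t] M[OF _ t]]]])
    qed
    then show ?thesis by (intro exI[of _ "\<lambda>b'. \<Sum>b\<in>B. a b * M b b'"]) simp
  qed
  {
    case zero
    show ?case using ideal_0[OF I] by (intro exI[of _ "\<lambda>_. 0"]) (simp add: lincomb_def)
  next
    case one
    have eq: "(\<lambda>b. poly (if b = (0, 0) then 1 else 0) t) = (\<lambda>b. if b = (0, 0) then 1 else 0)" for t :: 'k
      by auto
    have "lincomb B xy_monom (\<lambda>b. if b = (0, 0) then 1 else 0 :: 'k) = 1"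
      using lincomb_single[OF B, of xy_monom 1] by (simp add: xy_monom_def one_pCons)
    then have "\<forall>t\<in>T. 1 - lincomb B xy_monom (\<lambda>b. poly (if b = (0, 0) then 1 else 0) t) \<in> I t"
      unfolding eq using ideal_0[OF I] by simp
    then show ?case by (rule exI[of _ "\<lambda>b. if b = (0, 0) then 1 else 0"])
  next
    case (add f g)
    then obtain a a' where "\<forall>t\<in>T. f - lincomb B xy_monom (\<lambda>b. poly (a b) t) \<in> I t"
      "\<forall>t\<in>T. g - lincomb B xy_monom (\<lambda>b. poly (a' b) t) \<in> I t" by blast
    then have "f + g - lincomb B xy_monom (\<lambda>b. poly (a b + a' b) t) \<in> I t" if "t \<in> T" for t
      using ideal_add[OF I[OF that], of "f - lincomb B xy_monom (\<lambda>b. poly (a b) t)"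
          "g - lincomb B xy_monom (\<lambda>b. poly (a' b) t)"] that
      by (simp add: lincomb_add algebra_simps)
    then show ?case by (intro exI[of _ "\<lambda>b. a b + a' b"]) simp
  next
    case (scale c f)
    then obtain a where "\<forall>t\<in>T. f - lincomb B xy_monom (\<lambda>b. poly (a b) t) \<in> I t" by blast
    then have "smult [:c:] f - lincomb B xy_monom (\<lambda>b. poly (smult c (a b)) t) \<in> I t" if "t \<in> T" for t
      using ideal_smult[OF I[OF that], of "f - lincomb B xy_monom (\<lambda>b. poly (a b) t)" c] that
      by (simp add: lincomb_scale smult_diff_right)
    then show ?case by (intro exI[of _ "\<lambda>b. smult c (a b)"]) simp
  next
    case (x f)
    then show ?case using assms(4) by (rule mult[of f var_x])
  next
    case (y f)
    then show ?case using assms(5) by (rule mult[of f var_y])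
  }
qed

section \<open>Ideals of points\<close>

definition xy_eval :: "'k::field poly poly \<Rightarrow> 'k \<times> 'k \<Rightarrow> 'k" where
  "xy_eval f P = poly (poly f [:snd P:]) (fst P)"

lemma xy_eval_simps [simp]:
  "xy_eval 0 P = 0" "xy_eval 1 P = 1" "xy_eval (f + g) P = xy_eval f P + xy_eval g P"
  "xy_eval (f - g) P = xy_eval f P - xy_eval g P" "xy_eval (- f) P = - xy_eval f P"
  "xy_eval (f * g) P = xy_eval f P * xy_eval g P" "xy_eval (smult [:c:] f) P = c * xy_eval f P"
  "xy_eval (f ^ n) P = xy_eval f P ^ n"
  "xy_eval var_x P = fst P" "xy_eval var_y P = snd P"
  "xy_eval (xy_monom m) P = fst P ^ fst m * snd P ^ snd m"
  by (simp_all add: xy_eval_def var_x_def var_y_def xy_monom_def poly_power)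

lemma xy_eval_sum [simp]: "xy_eval (sum f A) P = (\<Sum>a\<in>A. xy_eval (f a) P)"
  by (induction A rule: infinite_finite_induct) auto

lemma xy_eval_lincomb [simp]:
  "xy_eval (lincomb B xy_monom a) P = (\<Sum>b\<in>B. a b * (fst P ^ fst b * snd P ^ snd b))"
  by (simp add: lincomb_def)

lemma vanishing_ideal_iff: "f \<in> vanishing_ideal S \<longleftrightarrow> (\<forall>P\<in>S. xy_eval f P = 0)"
  by (auto simp: vanishing_ideal_def xy_eval_def split: prod.splits)

lemma is_ideal_vanishing_ideal: "is_ideal (vanishing_ideal S)"
  by (simp add: is_ideal_iff vanishing_ideal_iff)

section \<open>Open sets of the Hilbert scheme\<close>

lemma zariski_hilb: "zariski (hilb n) = charts_topology
    {(hilb_chart_domain n B, hilb_coord B) | B. finite B \<and> card B = n \<and> order_ideal B}"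
  and regular_hilb: "regular (hilb n) = charts_regular
    {(hilb_chart_domain n B, hilb_coord B) | B. finite B \<and> card B = n \<and> order_ideal B}"
  by (simp_all add: hilb_def variety_of_charts_def)

lemma openin_hilb_basic:
  assumes "finite B" "card B = n" "order_ideal B"
  shows "openin (zariski (hilb n)) {I \<in> hilb_chart_domain n B. peval P (hilb_coord B I) \<noteq> 0}"
  unfolding zariski_hilb charts_topology_def
  using assms by (intro topology_generated_by_Basis CollectI exI[of _ "hilb_chart_domain n B"]
      exI[of _ "hilb_coord B"] exI[of _ P] conjI refl exI[of _ B])

lemma openin_hilb_chart_domain:
  assumes "finite B" "card B = n" "order_ideal B"
  shows "openin (zariski (hilb n)) (hilb_chart_domain n B :: 'k::field poly poly set set)"
  using openin_hilb_basic[OF assms, of "1 :: (_, 'k) mpoly"] by simp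

lemma regular_hilb_polynomial:
  assumes B: "finite B" "card B = n" "order_ideal B"
    and U: "openin (zariski (hilb n)) U" "U \<subseteq> hilb_chart_domain n B"
  shows "(\<lambda>I\<in>U. peval P (hilb_coord B I)) \<in> regular (hilb n) U" (is "?f \<in> _")
  unfolding regular_hilb charts_regular_def zariski_hilb[symmetric]
proof (intro CollectI conjI ballI)
  let ?D = "hilb_chart_domain n B"
  fix x assume "x \<in> U"
  then have "\<exists>W P Q. openin (zariski (hilb n)) W \<and> x \<in> W \<and> W \<subseteq> U \<inter> ?D \<and>
      (\<forall>y\<in>W. peval Q (hilb_coord B y) \<noteq> 0 \<and>
        ?f y = peval P (hilb_coord B y) / peval Q (hilb_coord B y))"
    using U by (intro exI[of _ U] exI[of _ P] exI[of _ 1]) auto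
  then show "\<exists>(D, c)\<in>{(hilb_chart_domain n B, hilb_coord B) | B. finite B \<and> card B = n \<and> order_ideal B}.
      \<exists>W P Q. openin (zariski (hilb n)) W \<and> x \<in> W \<and> W \<subseteq> U \<inter> D \<and>
      (\<forall>y\<in>W. peval Q (c y) \<noteq> 0 \<and> ?f y = peval P (c y) / peval Q (c y))"
    by (intro bexI[of _ "(?D, hilb_coord B)"]) (use B in auto)
qed simp

lemma peval_numeral: "peval (numeral n) z = numeral n"
  using peval_of_nat[of "numeral n" z] by simp

section \<open>The chart of curvilinear ideals\<close>

text \<open>Ideals in this chart have the form (f(x), y - q(x)) with f a monic quintic. Five
  distinct points means that f has simple roots, a condition expressible by a polynomial in the
  chart coordinates.\<close>

definition line5 :: "(nat \<times> nat) set" where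
  "line5 = (\<lambda>l. (l, 0)) ` {..<5}"

lemma line5: "finite line5" "card line5 = 5" "order_ideal line5"
  by (auto simp: line5_def card_image inj_on_def order_ideal_def)

lemma sum_line5: "sum g line5 = (\<Sum>l<5. g (l, 0))"
  unfolding line5_def by (subst sum.reindex) (auto simp: inj_on_def)

lemma xy_monom_x: "xy_monom (l, 0) = [:monom 1 l:]"
  by (simp add: xy_monom_def var_x_def poly_const_pow monom_altdef)

lemma const_poly_add: "[:a + b:] = [:a:] + [:b:]"
  by simp

lemma const_poly_sum: "[:sum f A:] = (\<Sum>a\<in>A. [:f a:])"
  by (induction A rule: infinite_finite_induct) (simp_all add: const_poly_add del: add_pCons)

lemma lincomb_line5: "lincomb line5 xy_monom a = [:\<Sum>l<5. monom (a (l, 0)) l:]"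
  by (simp add: lincomb_def sum_line5 xy_monom_x const_poly_sum smult_monom)

lemma poly_eq_sum_monom_5:
  assumes "\<And>n. n \<ge> 5 \<Longrightarrow> poly.coeff P n = 0"
  shows "P = (\<Sum>l<5. monom (poly.coeff P l) l)"
proof (rule poly_eqI)
  fix n
  have "poly.coeff (\<Sum>l<5. monom (poly.coeff P l) l) n = (\<Sum>l<5. if l = n then poly.coeff P l else 0)"
    by (simp add: coeff_sum)
  then show "poly.coeff P n = poly.coeff (\<Sum>l<5. monom (poly.coeff P l) l) n"
    using assms[of n] by (auto simp: not_le)
qed

lemma coeff_sum_monom_5: "poly.coeff (\<Sum>l<5. monom (a l) l) n = (if n < 5 then a n else 0)"
  by (simp add: coeff_sum)

lemma eq_0_of_five_roots:
  fixes P :: "'k::field poly"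
  assumes "\<And>n. n \<ge> 5 \<Longrightarrow> poly.coeff P n = 0" and "finite R" "card R \<ge> 5" "\<And>r. r \<in> R \<Longrightarrow> poly P r = 0"
  shows "P = 0"
proof -
  have "degree P < 5"
    using assms(1) by (metis le_degree leading_coeff_0_iff not_le_imp_less degree_0 zero_less_numeral)
  then show ?thesis
    using assms(3,4) by (intro poly_eqI_degree[of R P 0]) auto
qed

lemma poly_interpolation:
  fixes v :: "'k::field \<Rightarrow> 'k"
  assumes "finite R"
  shows "\<exists>P. (\<forall>r\<in>R. poly P r = v r) \<and> (\<forall>n\<ge>card R. poly.coeff P n = 0)"
  using assms
proof (induction R rule: finite_induct)
  case empty
  show ?case by (intro exI[of _ 0]) simp
next
  case (insert s R)
  then obtain P where P: "\<And>r. r \<in> R \<Longrightarrow> poly P r = v r" "\<And>n. n \<ge> card R \<Longrightarrow> poly.coeff P n = 0"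
    by blast
  define Q where "Q = (\<Prod>r\<in>R. [:- r, 1:])"
  have "poly Q s \<noteq> 0" and 0: "\<And>r. r \<in> R \<Longrightarrow> poly Q r = 0"
    using insert by (auto simp: Q_def poly_prod)
  have "degree Q = card R"
    unfolding Q_def by (subst degree_prod_eq_sum_degree) auto
  then have deg: "\<And>n. n > card R \<Longrightarrow> poly.coeff Q n = 0"
    by (simp add: coeff_eq_0)
  show ?case
    using insert P 0 deg \<open>poly Q s \<noteq> 0\<close>
    by (intro exI[of _ "P + smult ((v s - poly P s) / poly Q s) Q"]) auto
qed

lemma poly_poly_eq_xy_eval: "poly (poly F q) r = xy_eval F (r, poly q r)"
  by (induction F) (auto simp: xy_eval_def)

abbreviation line_coord :: "'k::field poly poly set \<Rightarrow> nat \<Rightarrow> nat \<Rightarrow> 'k" where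
  "line_coord I m l \<equiv> hilb_coord line5 I ((m, 0), (l, 0))"

text \<open>Modulo an ideal of the chart, \<open>x\<close> satisfies a monic quintic equation. The following is the matrix
  of multiplication by the derivative of this quintic; its determinant is the discriminant.\<close>

definition deriv_matrix :: "'k::field poly poly set \<Rightarrow> nat \<Rightarrow> nat \<Rightarrow> 'k" where
  "deriv_matrix I i j = 5 * line_coord I (i + 4) j -
     (\<Sum>l<5. of_nat l * line_coord I 5 l * line_coord I (i + l - 1) j)"

text \<open>An arbitrary enumeration suffices: a determinant does not change when rows and columns
  are relabelled together.\<close>

definition index5 :: "5 \<Rightarrow> nat" where
  "index5 = (SOME h. bij_betw h UNIV {..<5})"

lemma bij_index5: "bij_betw index5 UNIV {..<5}"
proof -
  have "\<exists>h. bij_betw h (UNIV :: 5 set) {..<5::nat}"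
    by (rule finite_same_card_bij) auto
  then show ?thesis unfolding index5_def by (rule someI_ex)
qed

lemma sum_index5: "(\<Sum>r\<in>UNIV. f (index5 r)) = (\<Sum>l<5. f l)"
  by (rule sum.reindex_bij_betw[OF bij_index5])

text \<open>The normal forms of x^m for m up to 8 are chart coordinates themselves, so the matrix
  entries are polynomial in the coordinates without reducing the higher powers.\<close>

definition disc_poly :: "((nat \<times> nat) \<times> (nat \<times> nat), 'k::field) mpoly" where
  "disc_poly = det (\<chi> r s. of_nat 5 * pvar ((index5 r + 4, 0), (index5 s, 0)) -
     (\<Sum>l<5. of_nat l * pvar ((5, 0), (l, 0)) * pvar ((index5 r + l - 1, 0), (index5 s, 0))) :: _^5^5)"

lemma peval_disc_poly:
  "peval disc_poly (hilb_coord line5 I) = det (\<chi> r s. deriv_matrix I (index5 r) (index5 s) :: 'k::field^5^5)"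
  by (simp add: disc_poly_def det_def deriv_matrix_def peval_numeral)

lemma pderiv_sum: "pderiv (sum f A) = (\<Sum>a\<in>A. pderiv (f a))"
  by (induction A rule: infinite_finite_induct) (simp_all add: pderiv_add)

text \<open>At a common zero of the ideal with x-coordinate r, the vector (1, r, ..., r^4) is an
  eigenvector of multiplication by f', with eigenvalue f'(r).\<close>

lemma deriv_matrix_eval:
  assumes I: "is_ideal I" "basis_mod I line5 xy_monom" and P: "\<And>G. G \<in> I \<Longrightarrow> xy_eval G P = 0"
  shows "(\<Sum>j<5. deriv_matrix I i j * fst P ^ j) =
    fst P ^ i * poly (pderiv (monom 1 5 - (\<Sum>l<5. monom (line_coord I 5 l) l))) (fst P)"
proof -
  have c: "(\<Sum>j<5. line_coord I m j * fst P ^ j) = fst P ^ m" for m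
    using P[OF hilb_coord_expansion[OF I, of "(m, 0)"]] by (simp add: sum_line5)
  have "(\<Sum>j<5. deriv_matrix I i j * fst P ^ j) = 5 * (\<Sum>j<5. line_coord I (i + 4) j * fst P ^ j) -
      (\<Sum>l<5. of_nat l * line_coord I 5 l * (\<Sum>j<5. line_coord I (i + l - 1) j * fst P ^ j))"
  proof -
    have "(\<Sum>j<5. (\<Sum>l<5. of_nat l * line_coord I 5 l * line_coord I (i + l - 1) j) * fst P ^ j) =
        (\<Sum>l<5. of_nat l * line_coord I 5 l * (\<Sum>j<5. line_coord I (i + l - 1) j * fst P ^ j))"
      unfolding sum_distrib_left sum_distrib_right by (subst sum.swap) (simp add: mult.assoc)
    then show ?thesis
      by (simp add: deriv_matrix_def left_diff_distrib sum_subtractf sum_distrib_left mult.assoc)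
  qed
  also have "\<dots> = 5 * fst P ^ (i + 4) - (\<Sum>l<5. of_nat l * line_coord I 5 l * fst P ^ (i + l - 1))"
    by (simp only: c)
  also have "(\<Sum>l<5. of_nat l * line_coord I 5 l * fst P ^ (i + l - 1)) =
      fst P ^ i * (\<Sum>l<5. of_nat l * line_coord I 5 l * fst P ^ (l - 1))"
    unfolding sum_distrib_left
  proof (rule sum.cong)
    fix l :: nat
    show "of_nat l * line_coord I 5 l * fst P ^ (i + l - 1) =
        fst P ^ i * (of_nat l * line_coord I 5 l * fst P ^ (l - 1))"
      \<comment> \<open>For \<open>l = 0\<close> the truncated exponents disagree with the intended
        ones, but the factor \<open>of_nat l\<close> vanishes.\<close>
      by (cases l) (simp_all add: power_add)
  qed simp
  finally show ?thesis
    by (simp add: pderiv_diff pderiv_sum pderiv_monom poly_monom poly_sum power_add right_diff_distrib)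
qed

text \<open>Substituting y = q(x) turns membership in \<open>I\<close> into divisibility by the
  quintic \<open>f\<close>. The nonzero determinant excludes multiple roots, so over the
  algebraically closed field \<open>f\<close> has five distinct roots r, and \<open>I\<close> is the
  ideal of the points (r, q(r)).\<close>

lemma distinct_locus_if_disc_nonzero:
  fixes I :: "'k::alg_closed_field poly poly set"
  assumes I: "is_ideal I" "basis_mod I line5 xy_monom"
    and disc: "peval disc_poly (hilb_coord line5 I) \<noteq> 0"
  shows "I \<in> distinct_locus 5"
proof -
  define f where "f = monom 1 5 - (\<Sum>l<5. monom (line_coord I 5 l) l)"
  define q where "q = (\<Sum>l<5. monom (hilb_coord line5 I ((0, 1), (l, 0))) l)"
  have coeff_f: "poly.coeff f n = (if n = 5 then 1 else if n < 5 then - line_coord I 5 n else 0)" for n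
    by (simp add: f_def coeff_sum_monom_5)
  have deg_f: "degree f = 5"
    by (rule antisym) (auto simp: coeff_f intro!: degree_le le_degree)
  then have f0: "f \<noteq> 0" by auto
  have fI: "[:f:] \<in> I"
    using hilb_coord_expansion[OF I, of "(5, 0)"] by (simp add: lincomb_line5 xy_monom_x f_def)
  have qI: "[:- q, 1:] \<in> I"
    using hilb_coord_expansion[OF I, of "(0, 1)"]
    by (simp add: lincomb_line5 xy_monom_def var_y_def q_def)
  \<comment> \<open>As a polynomial in y over k[x], the difference has the root \<open>q\<close>, so
    it is divisible by y - q.\<close>
  have red: "F - [:poly F q:] \<in> I" for F
  proof -
    have "[:- q, 1:] dvd F - [:poly F q:]"
      by (simp flip: poly_eq_0_iff_dvd)
    then obtain g where "F - [:poly F q:] = [:- q, 1:] * g" ..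
    then show ?thesis using ideal_mult[OF I(1) qI, of g] by (simp only: mult.commute)
  qed
  have indep: "P = 0" if "[:P:] \<in> I" "\<And>n. n \<ge> 5 \<Longrightarrow> poly.coeff P n = 0" for P
  proof -
    have P: "P = (\<Sum>l<5. monom (poly.coeff P l) l)"
      by (rule poly_eq_sum_monom_5) (rule that(2))
    then have "lincomb line5 xy_monom (\<lambda>b. poly.coeff P (fst b)) \<in> I"
      using that(1) by (simp add: lincomb_line5)
    then have "\<forall>l<5. poly.coeff P l = 0"
      using I(2) unfolding basis_mod_iff[OF I(1)] by (force simp: line5_def)
    then show ?thesis by (subst P) simp
  qed
  have dvd_iff: "[:P:] \<in> I \<longleftrightarrow> f dvd P" for P
  proof
    assume "f dvd P"
    then obtain g where "P = f * g" ..
    then have "[:P:] = [:g:] * [:f:]" by simp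
    then show "[:P:] \<in> I" using ideal_mult[OF I(1) fI] by metis
  next
    assume P: "[:P:] \<in> I"
    have "[:P mod f:] = [:P:] - [:P div f:] * [:f:]"
      by (simp add: minus_mult_div_eq_mod)
    then have "[:P mod f:] \<in> I"
      using ideal_diff[OF I(1) P ideal_mult[OF I(1) fI]] by metis
    moreover have "poly.coeff (P mod f) n = 0" if "n \<ge> 5" for n
      using degree_mod_less[OF f0, of P] that deg_f by (auto simp: coeff_eq_0)
    ultimately have "P mod f = 0" by (rule indep)
    then show "f dvd P" by (simp add: dvd_eq_mod_eq_0)
  qed
  have mem_iff: "F \<in> I \<longleftrightarrow> f dvd poly F q" for F
  proof -
    have "F \<in> I \<longleftrightarrow> [:poly F q:] \<in> I"
      using ideal_diff[OF I(1) _ red[of F], of F] ideal_add[OF I(1) _ red[of F], of "[:poly F q:]"]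
      by auto
    then show ?thesis by (simp add: dvd_iff)
  qed
  have eval: "xy_eval G (r, poly q r) = 0" if "G \<in> I" "poly f r = 0" for G r
    using that unfolding mem_iff poly_poly_eq_xy_eval[symmetric] by (auto elim!: dvdE)
  \<comment> \<open>At a multiple root the eigenvalue f'(r) is 0, so the vector of powers of
    \<open>r\<close> would lie in the kernel of an invertible matrix; its entry \<open>r ^ 0\<close>
    is nonzero.\<close>
  have simple: "poly (pderiv f) r \<noteq> 0" if r: "poly f r = 0" for r
  proof
    assume d: "poly (pderiv f) r = 0"
    let ?A = "\<chi> r s. deriv_matrix I (index5 r) (index5 s) :: 'k^5^5"
    let ?v = "\<chi> s. r ^ index5 s :: 'k^5"
    have "(\<Sum>j<5. deriv_matrix I i j * r ^ j) = 0" for i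
      using deriv_matrix_eval[OF I eval[OF _ r], of i] d by (simp add: f_def)
    then have "?A *v ?v = 0"
      by (simp add: vec_eq_iff matrix_vector_mult_def sum_index5[of "\<lambda>j. deriv_matrix I _ j * r ^ j"])
    moreover have "?v \<noteq> 0"
    proof -
      obtain s where "index5 s = 0"
        using bij_betw_imp_surj_on[OF bij_index5] by (metis imageE lessThan_iff zero_less_numeral)
      then have "?v $ s \<noteq> 0" by simp
      then show ?thesis unfolding vec_eq_iff by auto
    qed
    moreover have "invertible ?A"
      using disc by (simp add: peval_disc_poly invertible_det_nz)
    ultimately show False
      using matrix_left_invertible_ker[of ?A] invertible_left_inverse[of ?A] by blast
  qed
  obtain A where A: "size A = degree f" "f = smult (lead_coeff f) (\<Prod>x\<in>#A. [:- x, 1:])"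
    using alg_closed_imp_factorization[OF f0] by blast
  have lc: "lead_coeff f = 1" by (simp add: deg_f coeff_f)
  have count: "count A r = 1" if "r \<in># A" for r
  proof (rule ccontr)
    assume ne: "count A r \<noteq> 1"
    obtain A' where A': "A = add_mset r A'" using \<open>r \<in># A\<close> by (meson mset_add)
    with ne have "r \<in># A'" by (auto simp: count_eq_zero_iff)
    then obtain A'' where A'': "A = add_mset r (add_mset r A'')" using A' by (metis mset_add)
    define g where "g = (\<Prod>x\<in>#A''. [:- x, 1:])"
    have f: "f = [:- r, 1:] * ([:- r, 1:] * g)"
      using A(2) lc by (simp add: A'' g_def)
    have "poly f r = 0" "poly (pderiv f) r = 0"
      unfolding f pderiv_mult by simp_all
    then show False using simple by blast
  qed
  define R where "R = set_mset A"
  have cardR: "card R = 5"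
  proof -
    have "size A = (\<Sum>r\<in>set_mset A. count A r)" by (simp add: size_multiset_overloaded_eq)
    also have "\<dots> = card R" using count by (simp add: R_def)
    finally show ?thesis using A(1) deg_f by simp
  qed
  have root: "poly f r = 0" if "r \<in> R" for r
  proof -
    obtain A' where A': "A = add_mset r A'" using \<open>r \<in> R\<close> unfolding R_def by (meson mset_add)
    then show ?thesis by (subst A(2)) simp
  qed
  define S where "S = (\<lambda>r. (r, poly q r)) ` R"
  have "card S = 5" unfolding S_def using cardR by (subst card_image) (auto simp: inj_on_def)
  moreover have "finite S" by (simp add: S_def R_def)
  moreover have "I = vanishing_ideal S"
  proof (intro equalityI subsetI)
    fix F assume "F \<in> I"
    then show "F \<in> vanishing_ideal S" using eval root by (auto simp: vanishing_ideal_iff S_def)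
  next
    fix F assume F: "F \<in> vanishing_ideal S"
    let ?P = "poly F q mod f"
    have "poly ?P r = 0" if "r \<in> R" for r
    proof -
      have "poly (poly F q) r = 0"
        using F that by (simp add: poly_poly_eq_xy_eval vanishing_ideal_iff S_def)
      moreover have "poly (poly F q) r = poly (poly F q div f * f + ?P) r" by simp
      then have "poly (poly F q) r = poly (poly F q div f) r * poly f r + poly ?P r"
        by (simp only: poly_add poly_mult)
      ultimately show ?thesis using root[OF that] by simp
    qed
    moreover have "poly.coeff ?P n = 0" if "n \<ge> 5" for n
      using degree_mod_less[OF f0, of "poly F q"] that deg_f by (auto simp: coeff_eq_0)
    ultimately have "?P = 0"
      using cardR by (intro eq_0_of_five_roots[of ?P R]) (simp_all add: R_def)
    then show "F \<in> I" unfolding mem_iff by (simp add: dvd_eq_mod_eq_0)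
  qed
  ultimately show ?thesis unfolding distinct_locus_def by blast
qed

section \<open>Configurations of five points\<close>

definition base_chart :: "(nat \<times> nat) set" where
  "base_chart = {(0, 0), (1, 0), (2, 0), (0, 1), (1, 1)}"

lemma base_chart: "finite base_chart" "card base_chart = 5" "order_ideal base_chart"
proof -
  have "i \<le> (0::nat) \<longleftrightarrow> i = 0" "i \<le> (1::nat) \<longleftrightarrow> i = 0 \<or> i = 1" "i \<le> (2::nat) \<longleftrightarrow> i = 0 \<or> i = 1 \<or> i = 2" for i
    by auto
  then show "order_ideal base_chart"
    by (auto simp: base_chart_def order_ideal_def)
qed (simp_all add: base_chart_def)

abbreviation point :: "(nat + nat \<Rightarrow> 'k) \<Rightarrow> nat \<Rightarrow> 'k \<times> 'k" where
  "point z i \<equiv> (z (Inl i), z (Inr i))"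

abbreviation point_ideal :: "(nat + nat \<Rightarrow> 'k::field) \<Rightarrow> 'k poly poly set" where
  "point_ideal z \<equiv> vanishing_ideal (point z ` {..<5})"

lemma set_mset_orbit: "set_mset (orbit n z) = point z ` {..<n}"
  by (simp add: orbit_def)

lemma point_ideal_iff: "f \<in> point_ideal z \<longleftrightarrow> (\<forall>i<5. xy_eval f (point z i) = 0)"
  by (auto simp: vanishing_ideal_iff)

abbreviation rel_x :: "(nat + nat \<Rightarrow> 'k::field) \<Rightarrow> nat \<Rightarrow> 'k" where
  "rel_x z i \<equiv> z (Inl i) - z (Inl 4)"

abbreviation rel_y :: "(nat + nat \<Rightarrow> 'k::field) \<Rightarrow> nat \<Rightarrow> 'k" where
  "rel_y z i \<equiv> z (Inr i) - z (Inr 4)"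

lemma peval_dets:
  fixes z :: "nat + nat \<Rightarrow> 'k::field"
  shows "peval det_basis z = det4 (rel_x z) (rel_y z) (\<lambda>i. rel_x z i * rel_y z i) (\<lambda>i. rel_x z i ^ 2)"
    "peval det_xy z = det4 (rel_x z) (rel_y z) (\<lambda>i. rel_y z i ^ 2) (\<lambda>i. rel_x z i ^ 2)"
    "peval det_xx z = det4 (rel_x z) (rel_y z) (\<lambda>i. rel_x z i * rel_y z i) (\<lambda>i. rel_y z i ^ 2)"
  by (simp_all add: det_basis_def det_xy_def det_xx_def diff_x_def diff_y_def)

lemma xy_eval_lincomb_base_chart:
  "xy_eval (lincomb base_chart xy_monom a) P = a (0,0) + a (1,0) * fst P + a (2,0) * fst P ^ 2
     + a (0,1) * snd P + a (1,1) * (fst P * snd P)"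
  by (simp add: base_chart_def)

text \<open>Moving the origin to point 4 alters the coefficients of x and y but not those of xy and
  x^2, the two that Cramer's rule has to deliver.\<close>

lemma xy_eval_lincomb_rel:
  fixes z :: "nat + nat \<Rightarrow> 'k::field"
  shows "xy_eval (lincomb base_chart xy_monom a) (point z i) - xy_eval (lincomb base_chart xy_monom a) (point z 4) =
    (a (1,0) + a (1,1) * z (Inr 4) + 2 * a (2,0) * z (Inl 4)) * rel_x z i
    + (a (0,1) + a (1,1) * z (Inl 4)) * rel_y z i
    + a (1,1) * (rel_x z i * rel_y z i) + a (2,0) * rel_x z i ^ 2"
  unfolding xy_eval_lincomb_base_chart by (simp add: algebra_simps power2_eq_square)

lemma less_5_iff: "i < 5 \<longleftrightarrow> i < 4 \<or> i = (4::nat)"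
  by auto

text \<open>If two x-coordinates agree, the product of the x - r over the at most four values r lies
  in the ideal and is a nontrivial combination of 1, ..., x^4.\<close>

lemma inj_if_line_chart:
  fixes z :: "nat + nat \<Rightarrow> 'k::field"
  assumes "basis_mod (point_ideal z) line5 xy_monom"
  shows "inj_on (\<lambda>i. z (Inl i)) {..<5}"
proof (rule ccontr)
  assume "\<not> inj_on (\<lambda>i. z (Inl i)) {..<5}"
  let ?R = "(\<lambda>i. z (Inl i)) ` {..<5}"
  have card: "card ?R < 5"
    using \<open>\<not> inj_on _ _\<close> card_image_le[of "{..<5::nat}" "\<lambda>i. z (Inl i)"] eq_card_imp_inj_on[of "{..<5::nat}" "\<lambda>i. z (Inl i)"]
    by force
  define P where "P = (\<Prod>r\<in>?R. [:- r, 1:])"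
  have "degree P = card ?R"
    unfolding P_def by (subst degree_prod_eq_sum_degree) auto
  then have deg: "poly.coeff P n = 0" if "n \<ge> 5" for n
    using that card by (intro coeff_eq_0) simp
  have "lincomb line5 xy_monom (\<lambda>b. poly.coeff P (fst b)) = [:P:]"
    using poly_eq_sum_monom_5[OF deg] by (simp add: lincomb_line5)
  moreover have "[:P:] \<in> point_ideal z"
    by (auto simp: point_ideal_iff xy_eval_def P_def poly_prod)
  ultimately have "\<forall>b\<in>line5. poly.coeff P (fst b) = 0"
    using assms unfolding basis_mod_iff[OF is_ideal_vanishing_ideal]
    by (elim conjE allE[of _ "\<lambda>b. poly.coeff P (fst b)"]) simp
  then have "\<forall>l<5. poly.coeff P l = 0"
    by (auto simp: line5_def)
  with deg have "P = 0"
    by (intro poly_eqI) (metis coeff_0 not_le)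
  moreover have "P \<noteq> 0" by (auto simp: P_def)
  ultimately show False by simp
qed

text \<open>For distinct x-coordinates, interpolation by a polynomial in x alone attains any
  prescribed values at the points. Expanding that polynomial in the basis solves the linear
  system.\<close>

lemma det_basis_nonzero_if_base_chart:
  fixes z :: "nat + nat \<Rightarrow> 'k::field"
  assumes inj: "inj_on (\<lambda>i. z (Inl i)) {..<5}" and bm: "basis_mod (point_ideal z) base_chart xy_monom"
  shows "peval det_basis z \<noteq> 0"
  unfolding peval_dets det4_nonzero_iff_solvable
proof
  fix v :: "nat \<Rightarrow> 'k"
  let ?x = "\<lambda>i. z (Inl i)"
  obtain P where P: "\<And>r. r \<in> ?x ` {..<5} \<Longrightarrow> poly P r = (if the_inv_into {..<5} ?x r < 4 then v (the_inv_into {..<5} ?x r) else 0)"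
    using poly_interpolation[of "?x ` {..<5}" "\<lambda>r. if the_inv_into {..<5} ?x r < 4 then v (the_inv_into {..<5} ?x r) else 0"]
    by auto
  have Pi: "poly P (?x i) = (if i < 4 then v i else 0)" if "i < 5" for i
    using P[of "?x i"] that the_inv_into_f_f[OF inj, of i] by simp
  obtain a where a: "[:P:] - lincomb base_chart xy_monom a \<in> point_ideal z"
    using bm unfolding basis_mod_iff[OF is_ideal_vanishing_ideal] by blast
  have val: "xy_eval (lincomb base_chart xy_monom a) (point z i) = (if i < 4 then v i else 0)" if "i < 5" for i
  proof -
    have "xy_eval ([:P:] - lincomb base_chart xy_monom a) (point z i) = 0"
      using a that by (simp only: point_ideal_iff)
    then show ?thesis using Pi[OF that] by (simp add: xy_eval_def[of "[:P:]"])
  qed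
  have "(a (1,0) + a (1,1) * z (Inr 4) + 2 * a (2,0) * z (Inl 4)) * rel_x z i
    + (a (0,1) + a (1,1) * z (Inl 4)) * rel_y z i
    + a (1,1) * (rel_x z i * rel_y z i) + a (2,0) * rel_x z i ^ 2 = v i" if "i < 4" for i
    using that unfolding xy_eval_lincomb_rel[symmetric] by (simp add: val del: xy_eval_lincomb)
  then show "\<exists>\<alpha> \<beta> \<gamma> \<delta>. \<forall>i<4. \<alpha> * rel_x z i + \<beta> * rel_y z i + \<gamma> * (rel_x z i * rel_y z i) + \<delta> * rel_x z i ^ 2 = v i"
    by (intro exI allI impI)
qed

lemma base_chart_if_det_basis_nonzero:
  fixes z :: "nat + nat \<Rightarrow> 'k::field"
  assumes det: "peval det_basis z \<noteq> 0"
  shows "basis_mod (point_ideal z) base_chart xy_monom"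
  unfolding basis_mod_iff[OF is_ideal_vanishing_ideal]
proof (intro conjI allI impI)
  fix f :: "'k poly poly"
  have solvable: "\<forall>v :: nat \<Rightarrow> 'k. \<exists>\<alpha> \<beta> \<gamma> \<delta>. \<forall>i<4. \<alpha> * rel_x z i + \<beta> * rel_y z i
      + \<gamma> * (rel_x z i * rel_y z i) + \<delta> * rel_x z i ^ 2 = v i"
    using det unfolding peval_dets det4_nonzero_iff_solvable .
  obtain \<alpha> \<beta> \<gamma> \<delta> where sol: "\<And>i. i < 4 \<Longrightarrow> \<alpha> * rel_x z i + \<beta> * rel_y z i
      + \<gamma> * (rel_x z i * rel_y z i) + \<delta> * rel_x z i ^ 2 = xy_eval f (point z i) - xy_eval f (point z 4)"
    using solvable[rule_format, of "\<lambda>i. xy_eval f (point z i) - xy_eval f (point z 4)"] by blast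
  \<comment> \<open>\<open>a1\<close>, \<open>a2\<close> and \<open>a0\<close> undo the translation
    to point 4, and \<open>a0\<close> also adjusts the value there.\<close>
  define a1 where "a1 = \<alpha> - \<gamma> * z (Inr 4) - 2 * \<delta> * z (Inl 4)"
  define a2 where "a2 = \<beta> - \<gamma> * z (Inl 4)"
  define a0 where "a0 = xy_eval f (point z 4) - a1 * z (Inl 4) - \<delta> * z (Inl 4) ^ 2 - a2 * z (Inr 4)
    - \<gamma> * (z (Inl 4) * z (Inr 4))"
  define a where "a = (\<lambda>b :: nat \<times> nat. if b = (0,0) then a0 else if b = (1,0) then a1 else if b = (2,0) then \<delta>
    else if b = (0,1) then a2 else \<gamma>)"
  have a_simps: "a (0,0) = a0" "a (1,0) = a1" "a (2,0) = \<delta>" "a (0,1) = a2" "a (1,1) = \<gamma>"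
    by (simp_all add: a_def)
  have 4: "xy_eval (lincomb base_chart xy_monom a) (point z 4) = xy_eval f (point z 4)"
    unfolding xy_eval_lincomb_base_chart a_simps by (simp add: a0_def)
  have "xy_eval (lincomb base_chart xy_monom a) (point z i) = xy_eval f (point z i)" if "i < 4" for i
    using xy_eval_lincomb_rel[of a z i] sol[OF that] unfolding 4 a_simps by (simp add: a1_def a2_def)
  with 4 have "f - lincomb base_chart xy_monom a \<in> point_ideal z"
    unfolding point_ideal_iff less_5_iff by (auto simp del: xy_eval_lincomb)
  then show "\<exists>a. f - lincomb base_chart xy_monom a \<in> point_ideal z" by blast
next
  fix a :: "nat \<times> nat \<Rightarrow> 'k"
  assume a: "lincomb base_chart xy_monom a \<in> point_ideal z"
  have 0: "xy_eval (lincomb base_chart xy_monom a) (point z i) = 0" if "i < 5" for i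
    using a that by (simp only: point_ideal_iff)
  have "(a (1,0) + a (1,1) * z (Inr 4) + 2 * a (2,0) * z (Inl 4)) * rel_x z i
    + (a (0,1) + a (1,1) * z (Inl 4)) * rel_y z i
    + a (1,1) * (rel_x z i * rel_y z i) + a (2,0) * rel_x z i ^ 2 = 0" if "i < 4" for i
    using that unfolding xy_eval_lincomb_rel[symmetric] by (simp add: 0 del: xy_eval_lincomb)
  note * = det4_nonzero_imp_inj[OF det[unfolded peval_dets] this]
  then have "a (1,1) = 0" "a (2,0) = 0" "a (1,0) = 0" "a (0,1) = 0"
    by simp_all
  moreover have "a (0,0) = 0"
    using 0[of 4] calculation unfolding xy_eval_lincomb_base_chart by simp
  ultimately show "\<forall>b\<in>base_chart. a b = 0"
    by (simp add: base_chart_def)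
qed

lemma line_chart_if_inj:
  fixes z :: "nat + nat \<Rightarrow> 'k::field"
  assumes inj: "inj_on (\<lambda>i. z (Inl i)) {..<5}"
  shows "basis_mod (point_ideal z) line5 xy_monom"
  unfolding basis_mod_iff[OF is_ideal_vanishing_ideal]
proof (intro conjI allI impI)
  let ?x = "\<lambda>i. z (Inl i)"
  have card: "card (?x ` {..<5}) = 5"
    using inj by (simp add: card_image)
  {
    fix f :: "'k poly poly"
    let ?v = "\<lambda>r. xy_eval f (point z (the_inv_into {..<5} ?x r))"
    obtain P where P: "\<And>r. r \<in> ?x ` {..<5} \<Longrightarrow> poly P r = ?v r" "\<And>n. n \<ge> 5 \<Longrightarrow> poly.coeff P n = 0"
      using poly_interpolation[of "?x ` {..<5}" ?v] card by auto
    have "poly P (?x i) = xy_eval f (point z i)" if "i < 5" for i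
      using P(1)[of "?x i"] that the_inv_into_f_f[OF inj, of i] by simp
    then have "f - [:P:] \<in> point_ideal z"
      by (simp add: point_ideal_iff xy_eval_def[of "[:P:]"])
    moreover have "[:P:] = lincomb line5 xy_monom (\<lambda>b. poly.coeff P (fst b))"
      using poly_eq_sum_monom_5[OF P(2)] by (simp add: lincomb_line5)
    ultimately show "\<exists>a. f - lincomb line5 xy_monom a \<in> point_ideal z" by auto
  next
    fix a :: "nat \<times> nat \<Rightarrow> 'k"
    assume a: "lincomb line5 xy_monom a \<in> point_ideal z"
    let ?P = "\<Sum>l<5. monom (a (l, 0)) l"
    have "poly ?P (?x i) = 0" if "i < 5" for i
      using a that by (simp add: lincomb_line5 point_ideal_iff xy_eval_def)
    then have "?P = 0"
      using card by (intro eq_0_of_five_roots[of ?P "?x ` {..<5}"]) (auto simp: coeff_sum_monom_5)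
    then have "a (l, 0) = 0" if "l < 5" for l
      using coeff_sum_monom_5[of "\<lambda>l. a (l, 0)" l] that by simp
    then show "\<forall>b\<in>line5. a b = 0" by (auto simp: line5_def)
  }
qed

text \<open>A left kernel vector of the matrix is read as a polynomial U of degree below 5. Then
  U(r) f'(r) = 0 at the five simple roots, so U = 0; passing to the transpose turns this into
  injectivity.\<close>

lemma disc_nonzero_if_inj:
  fixes z :: "nat + nat \<Rightarrow> 'k::field"
  assumes inj: "inj_on (\<lambda>i. z (Inl i)) {..<5}"
  shows "peval disc_poly (hilb_coord line5 (point_ideal z)) \<noteq> 0"
proof -
  let ?I = "point_ideal z" and ?x = "\<lambda>i. z (Inl i)"
  let ?R = "?x ` {..<5}"
  define f where "f = monom 1 5 - (\<Sum>l<5. monom (line_coord ?I 5 l) l)"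
  note I = is_ideal_vanishing_ideal line_chart_if_inj[OF inj]
  have card: "card ?R = 5"
    using inj by (simp add: card_image)
  have coeff_f: "poly.coeff f n = (if n = 5 then 1 else if n < 5 then - line_coord ?I 5 n else 0)" for n
    by (simp add: f_def coeff_sum_monom_5)
  have root: "poly f (?x i) = 0" if "i < 5" for i
  proof -
    have "[:f:] \<in> ?I"
      using hilb_coord_expansion[OF I, of "(5, 0)"] by (simp add: lincomb_line5 xy_monom_x f_def)
    then show ?thesis using that by (simp add: point_ideal_iff xy_eval_def)
  qed
  have simple: "poly (pderiv f) (?x i) \<noteq> 0" if i: "i < 5" for i
  proof
    assume d: "poly (pderiv f) (?x i) = 0"
    obtain g where g: "f = [:- ?x i, 1:] * g"
      using root[OF i] by (metis poly_eq_0_iff_dvd dvdE)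
    have "poly g (?x i) = 0"
      using d unfolding g pderiv_mult by (simp add: pderiv_pCons)
    then have "poly g r = 0" if "r \<in> ?R" for r
      using root that unfolding g by (cases "r = ?x i") auto
    moreover have "poly.coeff g n = 0" if "n \<ge> 5" for n
    proof -
      have "degree f \<le> 5" by (rule degree_le) (simp add: coeff_f)
      then have "degree g < 5 \<or> g = 0"
        unfolding g by (cases "g = 0") (simp_all add: degree_mult_eq del: mult_pCons_left)
      with that show ?thesis by (auto intro: coeff_eq_0)
    qed
    ultimately have "g = 0"
      using card by (intro eq_0_of_five_roots[of g ?R]) simp_all
    then have "f = 0" by (simp add: g)
    then show False using coeff_f[of 5] by simp
  qed
  let ?A = "\<chi> r s. deriv_matrix ?I (index5 r) (index5 s) :: 'k^5^5"
  have "w = 0" if w: "transpose ?A *v w = 0" for w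
  proof -
    have wA: "(\<Sum>r\<in>UNIV. w $ r * deriv_matrix ?I (index5 r) (index5 s)) = 0" for s
    proof -
      have "(transpose ?A *v w) $ s = 0" using w by simp
      then show ?thesis by (simp add: matrix_vector_mult_def transpose_def mult.commute)
    qed
    define u where "u l = w $ inv_into UNIV index5 l" for l
    have u: "w $ r = u (index5 r)" for r
      using bij_index5 by (simp add: u_def bij_betw_def inv_into_f_f)
    have wA': "(\<Sum>i<5. u i * deriv_matrix ?I i j) = 0" if "j < 5" for j
    proof -
      obtain s where s: "index5 s = j"
        using bij_betw_imp_surj_on[OF bij_index5] \<open>j < 5\<close> by (metis imageE lessThan_iff)
      show ?thesis
        using wA[of s] sum_index5[of "\<lambda>i. u i * deriv_matrix ?I i j"] by (simp add: u s)
    qed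
    let ?U = "\<Sum>l<5. monom (u l) l"
    have "poly ?U (?x l) = 0" if l: "l < 5" for l
    proof -
      have van: "xy_eval G (point z l) = 0" if "G \<in> ?I" for G
        using that l by (simp only: point_ideal_iff)
      have "poly ?U (?x l) * poly (pderiv f) (?x l) =
          (\<Sum>i<5. u i * (?x l ^ i * poly (pderiv f) (?x l)))"
        by (simp add: poly_sum poly_monom sum_distrib_right mult.assoc)
      also have "\<dots> = (\<Sum>i<5. u i * (\<Sum>j<5. deriv_matrix ?I i j * ?x l ^ j))"
        using deriv_matrix_eval[OF I van] by (simp add: f_def)
      also have "\<dots> = (\<Sum>j<5. (\<Sum>i<5. u i * deriv_matrix ?I i j) * ?x l ^ j)"
        unfolding sum_distrib_left sum_distrib_right by (subst sum.swap) (simp add: mult.assoc)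
      also have "\<dots> = 0" using wA' by simp
      finally show ?thesis using simple[OF l] by simp
    qed
    then have "?U = 0"
      using card by (intro eq_0_of_five_roots[of ?U ?R]) (auto simp: coeff_sum_monom_5)
    then have "u l = 0" if "l < 5" for l
      using coeff_sum_monom_5[of u l] that by simp
    moreover have "index5 r < 5" for r
      using bij_index5 by (auto simp: bij_betw_def)
    ultimately show ?thesis by (simp add: vec_eq_iff u)
  qed
  then have "invertible (transpose ?A)"
    using matrix_left_invertible_ker[of "transpose ?A"] invertible_left_inverse[of "transpose ?A"] by blast
  then show ?thesis
    by (simp add: peval_disc_poly invertible_det_nz det_transpose)
qed

lemma base_chart_coord:
  fixes z :: "nat + nat \<Rightarrow> 'k::field"
  assumes det: "peval det_basis z \<noteq> 0"
  shows "hilb_coord base_chart (point_ideal z) ((0,2),(1,1)) = peval det_xy z / peval det_basis z"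
    "hilb_coord base_chart (point_ideal z) ((0,2),(2,0)) = peval det_xx z / peval det_basis z"
proof -
  let ?a = "\<lambda>b. hilb_coord base_chart (point_ideal z) ((0,2), b)"
  have 0: "xy_eval (lincomb base_chart xy_monom ?a) (point z i) = z (Inr i) ^ 2" if "i < 5" for i
  proof -
    have "xy_eval (xy_monom (0,2) - lincomb base_chart xy_monom ?a) (point z i) = 0"
      using hilb_coord_expansion[OF is_ideal_vanishing_ideal base_chart_if_det_basis_nonzero[OF det], of "(0,2)"] that
      by (simp only: point_ideal_iff)
    then show ?thesis by (simp del: xy_eval_lincomb)
  qed
  \<comment> \<open>Translating y^2 itself creates the term - 2 y_4 (y - y_4), which affects the
    coefficient of y only; the two relevant coefficients stay those of the chart.\<close>
  have *: "rel_y z i ^ 2 =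
      (?a (1,0) + ?a (1,1) * z (Inr 4) + 2 * ?a (2,0) * z (Inl 4)) * rel_x z i
    + (?a (0,1) + ?a (1,1) * z (Inl 4) - 2 * z (Inr 4)) * rel_y z i
    + ?a (1,1) * (rel_x z i * rel_y z i) + ?a (2,0) * rel_x z i ^ 2" if "i < 4" for i
  proof -
    have "rel_y z i ^ 2 = z (Inr i) ^ 2 - z (Inr 4) ^ 2 - 2 * z (Inr 4) * rel_y z i"
      by (simp add: power2_eq_square algebra_simps)
    moreover have "z (Inr i) ^ 2 - z (Inr 4) ^ 2 =
      (?a (1,0) + ?a (1,1) * z (Inr 4) + 2 * ?a (2,0) * z (Inl 4)) * rel_x z i
    + (?a (0,1) + ?a (1,1) * z (Inl 4)) * rel_y z i
    + ?a (1,1) * (rel_x z i * rel_y z i) + ?a (2,0) * rel_x z i ^ 2"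
      using xy_eval_lincomb_rel[of ?a z i] 0[of i] 0[of 4] that by simp
    ultimately show ?thesis by (simp add: algebra_simps)
  qed
  show "?a (1,1) = peval det_xy z / peval det_basis z" "?a (2,0) = peval det_xx z / peval det_basis z"
    using det det4_replace_column[OF *] unfolding peval_dets by (simp_all add: field_simps)
qed

section \<open>Comparison with the splitting of affine space\<close>

text \<open>An open set of the Hilbert scheme inside \<open>distinct_locus\<close>, as
  \<open>agrees_along\<close> demands, on which moreover the test function has the denominator-free
  multiple \<open>test_poly\<close>. The \<open>line5\<close> condition amounts to distinct
  x-coordinates, the other one to \<Delta> being nonzero.\<close>

definition good_locus :: "'k::field poly poly set set" where
  "good_locus = {I \<in> hilb_chart_domain 5 line5. peval disc_poly (hilb_coord line5 I) \<noteq> 0}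
     \<inter> hilb_chart_domain 5 base_chart"

lemma openin_good_locus: "openin (zariski (hilb 5)) (good_locus :: 'k::field poly poly set set)"
  unfolding good_locus_def
  by (intro openin_Int openin_hilb_basic[OF line5] openin_hilb_chart_domain[OF base_chart])

lemma good_locus_subset:
  "(good_locus :: 'k::field poly poly set set) \<subseteq> hilb_chart_domain 5 base_chart"
  "(good_locus :: 'k'::alg_closed_field poly poly set set) \<subseteq> distinct_locus 5"
  using distinct_locus_if_disc_nonzero by (auto simp: good_locus_def hilb_chart_domain_iff[OF line5(1,2)])

lemma point_ideal_in_good_locus_iff:
  "point_ideal z \<in> good_locus \<longleftrightarrow> peval det_basis z \<noteq> 0 \<and> inj_on (\<lambda>i. z (Inl i)) {..<5}"
  using inj_if_line_chart[of z] det_basis_nonzero_if_base_chart[of z] base_chart_if_det_basis_nonzero[of z]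
    line_chart_if_inj[of z] disc_nonzero_if_inj[of z]
  by (auto simp: good_locus_def hilb_chart_domain_iff[OF line5(1,2)] hilb_chart_domain_iff[OF base_chart(1,2)]
      is_ideal_vanishing_ideal)

definition good_points :: "(nat + nat \<Rightarrow> 'k::field) set" where
  "good_points = {z \<in> affine_points vars5. point_ideal z \<in> good_locus}"

lemma openin_good_points: "openin (zariski (affine_space vars5)) (good_points :: (nat + nat \<Rightarrow> 'k::field) set)"
proof -
  let ?J = "{(i, j) \<in> {..<5} \<times> {..<5}. i \<noteq> (j::nat)}"
  define D where "D = (det_basis * (\<Prod>(i, j)\<in>?J. pvar (Inl i) - pvar (Inl j)) :: (nat + nat, 'k) mpoly)"
  have fin: "finite ?J"
    by (rule finite_subset[of _ "{..<5} \<times> {..<5}"]) auto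
  have "good_points = {z \<in> affine_points vars5. peval D z \<noteq> 0}"
    using fin by (auto simp: good_points_def point_ideal_in_good_locus_iff D_def inj_on_def case_prod_beta)
  then show ?thesis
    using openin_affine_space_basic[of vars5 D] by simp
qed

lemma openin_symmetric_product:
  "openin (zariski (symmetric_product n)) U \<longleftrightarrow>
    U \<subseteq> orbit n ` affine_points (plane_power_vars n) \<and>
    openin (zariski (affine_space (plane_power_vars n)))
      (map_preimage (affine_space (plane_power_vars n)) (orbit n) U)"
  for U :: "('k::field \<times> 'k) multiset set"
  using topology_inverse'[OF istopology_quotient[where X = "affine_space (plane_power_vars n) :: (nat + nat \<Rightarrow> 'k, 'k) space" and q = "orbit n"]]
  by (simp add: symmetric_product_def quotient_space_def)

lemma regular_symmetric_product:
  "f \<in> regular (symmetric_product n) U \<longleftrightarrow> f \<in> extensional U \<and>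
    pullback (affine_space (plane_power_vars n)) (orbit n) U f \<in>
      regular (affine_space (plane_power_vars n)) (map_preimage (affine_space (plane_power_vars n)) (orbit n) U)"
  by (simp add: symmetric_product_def quotient_space_def)

lemma topspace_symmetric_product:
  "topspace (zariski (symmetric_product n :: (('k::field \<times> 'k) multiset, 'k) space)) =
    orbit n ` affine_points (plane_power_vars n)"
proof
  show "topspace (zariski (symmetric_product n :: (('k \<times> 'k) multiset, 'k) space)) \<subseteq>
      orbit n ` affine_points (plane_power_vars n)"
    using openin_symmetric_product[of n "topspace (zariski (symmetric_product n))"] by blast
  have "map_preimage (affine_space (plane_power_vars n)) (orbit n) (orbit n ` affine_points (plane_power_vars n))
      = (affine_points (plane_power_vars n) :: (nat + nat \<Rightarrow> 'k) set)"
    by (auto simp: map_preimage_def)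
  then have "openin (zariski (symmetric_product n))
      (orbit n ` (affine_points (plane_power_vars n) :: (nat + nat \<Rightarrow> 'k) set))"
    unfolding openin_symmetric_product using openin_affine_space by simp
  then show "orbit n ` affine_points (plane_power_vars n) \<subseteq>
      topspace (zariski (symmetric_product n :: (('k \<times> 'k) multiset, 'k) space))"
    by (rule openin_subset)
qed

text \<open>The function \<open>s\<^sup>2 t\<^bsup>p-1\<^esup>\<close>, where \<open>y\<^sup>2\<close> reduces to \<open>s xy + t x\<^sup>2 + \<dots>\<close> in the chart with basis
  \<open>1, x, x\<^sup>2, y, xy\<close>; the curve is \<open>s = 0\<close> in the plane of all ideals containing the cubics.\<close>

definition test_monom :: "nat \<Rightarrow> ((nat \<times> nat) \<times> (nat \<times> nat), 'k::field) mpoly" where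
  "test_monom p = pvar ((0, 2), (1, 1)) ^ 2 * pvar ((0, 2), (2, 0)) ^ (p - 1)"

text \<open>The function is restricted to \<open>good_locus\<close>, pulled back to the symmetric
  product and then to affine space. There its \<Delta>^(2p)-fold multiple extends to a polynomial on
  the whole space, where the formula for the standard splitting applies; p-linearity takes
  \<Delta>^2 out again.\<close>

lemma induced_splitting_value:
  fixes \<phi> :: "('k::alg_closed_field poly poly set, 'k) sheaf_map"
  assumes p: "CHAR('k) = p" "0 < p" and ind: "induced_splitting 5 \<phi>"
    and \<tau>: "standard_splitting vars5 \<tau>"
    and \<sigma>: "agrees_along (affine_space vars5) \<tau> (orbit 5) (symmetric_product 5) \<sigma>
      (topspace (zariski (symmetric_product 5)))"
    and \<sigma>\<phi>: "agrees_along (symmetric_product 5) \<sigma> (\<lambda>s. vanishing_ideal (set_mset s))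
      (hilb 5) \<phi> (distinct_locus 5)"
    and z: "z \<in> good_points"
  shows "\<phi> (hilb_chart_domain 5 base_chart) (\<lambda>I\<in>hilb_chart_domain 5 base_chart.
      peval (test_monom p) (hilb_coord base_chart I)) (point_ideal z) =
    peval (standard_splitting_poly vars5 (test_poly p)) z / peval det_basis z ^ 2"
proof -
  let ?A = "affine_space vars5 :: (nat + nat \<Rightarrow> 'k, 'k) space"
  let ?Z = "symmetric_product 5 :: (('k \<times> 'k) multiset, 'k) space"
  let ?U = "hilb_chart_domain 5 base_chart :: 'k poly poly set set"
  let ?W = "good_locus :: 'k poly poly set set"
  let ?h = "\<lambda>s :: ('k \<times> 'k) multiset. vanishing_ideal (set_mset s)"
  define g where "g = (\<lambda>I\<in>?U. peval (test_monom p) (hilb_coord base_chart I))"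
  define gW where "gW = (\<lambda>I\<in>?W. peval (test_monom p) (hilb_coord base_chart I))"
  define S where "S = map_preimage ?Z ?h ?W"
  define f where "f = pullback ?Z ?h ?W gW"
  define P where "P = (det_xy ^ 2 * det_xx ^ (p - 1) :: (nat + nat, 'k) mpoly)"
  define G where "G = pullback ?A (orbit 5) S f"
  let ?V = "good_points :: (nat + nat \<Rightarrow> 'k) set"
  have V_sub: "?V \<subseteq> affine_points vars5" by (auto simp: good_points_def)
  have V: "map_preimage ?A (orbit 5) S = ?V"
    by (auto simp: map_preimage_def S_def topspace_symmetric_product good_points_def set_mset_orbit)
  have S_sub: "S \<subseteq> orbit 5 ` affine_points vars5"
    by (auto simp: S_def map_preimage_def topspace_symmetric_product)
  have openS: "openin (zariski ?Z) S"
    unfolding openin_symmetric_product V using S_sub openin_good_points by simp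
  have fs: "frobenius_splitting (hilb 5) \<phi>"
    using ind by (simp add: induced_splitting_def)
  have fsA: "frobenius_splitting ?A \<tau>"
    using \<tau> by (simp add: standard_splitting_def)
  have reg_gW: "gW \<in> regular (hilb 5) ?W"
    unfolding gW_def by (rule regular_hilb_polynomial[OF base_chart openin_good_locus good_locus_subset(1)])
  have reg_g: "g \<in> regular (hilb 5) ?U"
    unfolding g_def by (rule regular_hilb_polynomial[OF base_chart openin_hilb_chart_domain[OF base_chart] order.refl])
  have gW: "gW = restrict g ?W"
    using good_locus_subset(1) by (auto simp: gW_def g_def restrict_def fun_eq_iff)
  have G_eq: "G = (\<lambda>z\<in>?V. peval P z / peval (det_basis ^ (p + 1)) z)"
  proof
    fix z :: "nat + nat \<Rightarrow> 'k"
    show "G z = (\<lambda>z\<in>?V. peval P z / peval (det_basis ^ (p + 1)) z) z"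
    proof (cases "z \<in> ?V")
      case True
      then have W: "point_ideal z \<in> ?W" and det: "peval det_basis z \<noteq> 0"
        and zA: "z \<in> affine_points vars5"
        by (auto simp: good_points_def point_ideal_in_good_locus_iff)
      then have "orbit 5 z \<in> S"
        using True V by (auto simp: map_preimage_def)
      then have "G z = gW (point_ideal z)"
        using True by (simp add: G_def pullback_def V f_def S_def[symmetric] set_mset_orbit)
      also have "\<dots> = (peval det_xy z / peval det_basis z) ^ 2 * (peval det_xx z / peval det_basis z) ^ (p - 1)"
        using W by (simp add: gW_def test_monom_def base_chart_coord[OF det, unfolded One_nat_def])
      also have "\<dots> = peval P z / peval (det_basis ^ (p + 1)) z"
      proof -
        have "p + 1 = 2 + (p - 1)" using p(2) by simp
        then have "peval (det_basis ^ (p + 1)) z = peval det_basis z ^ 2 * peval det_basis z ^ (p - 1)"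
          by (simp only: peval_power peval_mult power_add)
        then show ?thesis by (simp add: P_def power_divide)
      qed
      finally show ?thesis using True by simp
    qed (simp add: G_def pullback_def V)
  qed
  have reg_G: "G \<in> regular ?A ?V"
    by (rule regular_affine_spaceI[OF openin_good_points, of _ "det_basis ^ (p + 1)" P])
      (auto simp: G_eq good_points_def point_ideal_in_good_locus_iff)
  have reg_f: "f \<in> regular ?Z S"
    using reg_G unfolding regular_symmetric_product V by (simp add: G_def f_def pullback_def S_def)
  have eq1: "pullback ?Z ?h ?W (\<phi> ?W gW) = \<sigma> S f"
    using \<sigma>\<phi>[unfolded agrees_along_def, rule_format, OF conjI[OF openin_good_locus good_locus_subset(2)] reg_gW]
    by (simp add: S_def f_def)
  have eq2: "pullback ?A (orbit 5) S (\<sigma> S f) = \<tau> ?V G"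
    using \<sigma>[unfolded agrees_along_def, rule_format, OF conjI[OF openS openin_subset[OF openS]] reg_f]
    by (simp add: G_def V)
  \<comment> \<open>Its \<open>p\<close>-th power \<Delta>^(2p) exceeds the denominator
    \<Delta>^(p+1) by exactly the \<Delta>^(p-1) in \<open>test_poly\<close>.\<close>
  let ?b = "\<lambda>z\<in>?V. peval (det_basis ^ 2) z"
  have e1: "\<tau> ?V (\<lambda>z\<in>?V. ?b z ^ CHAR('k) * G z) = (\<lambda>z\<in>?V. ?b z * \<tau> ?V G z)"
    by (intro frobenius_splittingD(4)[OF fsA openin_good_points _ reg_G]
        regular_affine_space_polynomial openin_good_points)
  have e2: "(\<lambda>z\<in>?V. ?b z ^ CHAR('k) * G z) = restrict (\<lambda>z\<in>affine_points vars5. peval (test_poly p) z) ?V"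
  proof
    fix z :: "nat + nat \<Rightarrow> 'k"
    show "(\<lambda>z\<in>?V. ?b z ^ CHAR('k) * G z) z = restrict (\<lambda>z\<in>affine_points vars5. peval (test_poly p) z) ?V z"
    proof (cases "z \<in> ?V")
      case True
      then have det: "peval det_basis z \<noteq> 0" and zA: "z \<in> affine_points vars5"
        by (auto simp: good_points_def point_ideal_in_good_locus_iff)
      have "2 * p = (p - 1) + (p + 1)" using p(2) by simp
      then have "(peval det_basis z ^ 2) ^ p = peval det_basis z ^ (p - 1) * peval det_basis z ^ (p + 1)"
        by (simp only: power_mult[symmetric] power_add)
      then show ?thesis
        using True zA det by (simp add: G_eq p(1) test_poly_def P_def power_mult_distrib)
    qed simp
  qed
  have e3: "\<tau> ?V (restrict (\<lambda>z\<in>affine_points vars5. peval (test_poly p) z) ?V) = restrict (\<tau> (affine_points vars5) (\<lambda>z\<in>affine_points vars5. peval (test_poly p) z)) ?V"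
    by (intro frobenius_splittingD(2)[OF fsA openin_affine_space] regular_affine_space_polynomial
        openin_affine_space openin_good_points V_sub)
  have e4: "\<tau> (affine_points vars5) (\<lambda>z\<in>affine_points vars5. peval (test_poly p) z) =
      (\<lambda>z\<in>affine_points vars5. peval (standard_splitting_poly vars5 (test_poly p)) z)"
  proof (rule standard_splittingD[OF \<tau>])
    show "cw_order (8 * 2 + (8 + 8) * (p - 1)) (test_poly p :: (nat + nat, 'k) mpoly)"
      unfolding test_poly_def
      by (intro order_ge_mult order_ge_power leading_form_order[OF cw_leading_det_basis]
          leading_form_order[OF cw_leading_det_xx] leading_form_order[OF cw_leading_det_xy])
  qed
  have eq: "restrict (\<lambda>z\<in>affine_points vars5. peval (standard_splitting_poly vars5 (test_poly p)) z) ?V =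
      (\<lambda>z\<in>?V. ?b z * \<tau> ?V G z)"
    using e1 unfolding e2 e3 e4 .
  have "peval (standard_splitting_poly vars5 (test_poly p)) z = peval det_basis z ^ 2 * \<tau> ?V G z"
    using fun_cong[OF eq, of z] z subsetD[OF V_sub z] by simp
  moreover have "\<phi> ?U g (point_ideal z) = \<tau> ?V G z"
  proof -
    have W: "point_ideal z \<in> ?W" using z by (simp add: good_points_def)
    have orb: "orbit 5 z \<in> S" using z V by (auto simp: map_preimage_def)
    have "\<phi> ?U g (point_ideal z) = \<phi> ?W gW (point_ideal z)"
      unfolding gW using W
        frobenius_splittingD(2)[OF fs openin_hilb_chart_domain[OF base_chart] reg_g openin_good_locus good_locus_subset(1)]
      by simp
    also have "\<dots> = pullback ?Z ?h ?W (\<phi> ?W gW) (orbit 5 z)"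
      using orb by (simp add: pullback_def S_def[symmetric] set_mset_orbit)
    also have "\<dots> = pullback ?A (orbit 5) S (\<sigma> S f) z"
      unfolding eq1 using z V by (simp add: pullback_def)
    finally show ?thesis by (simp add: eq2)
  qed
  moreover have "peval det_basis z \<noteq> 0"
    using z by (simp add: good_points_def point_ideal_in_good_locus_iff)
  ultimately show ?thesis by (simp add: g_def)
qed

section \<open>A curve of ideals degenerating to a point of the curve Y\<close>

definition const :: "'k::field \<Rightarrow> 'k poly poly" where
  "const c = [:[:c:]:]"

lemma const_simps [simp]:
  "const 0 = 0" "const 1 = 1" "const (a + b) = const a + const b" "const (a - b) = const a - const b"
  "const (- a) = - const a" "const (a * b) = const a * const b" "const (numeral n) = numeral n"
  by (simp_all add: const_def one_pCons numeral_poly)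

lemma const_power [simp]: "const (a ^ n) = const a ^ n"
  by (induction n) simp_all

lemma smult_eq_const: "smult [:c:] f = const c * f"
  by (simp add: const_def)

lemma const_mult_in_ideal: "is_ideal I \<Longrightarrow> f \<in> I \<Longrightarrow> const c * f \<in> I"
  by (rule ideal_mult)

text \<open>The relations satisfied by the ideal of the five points \<open>curve_point t\<close> below: the conic through
  them is the line pair \<open>(y - x) (x + y - 4 t\<^sup>2)\<close>, and the cubics \<open>x\<^sup>3\<close> and \<open>x\<^sup>2 y\<close> are interpolated on each line.\<close>

definition curve_relations :: "'k::field \<Rightarrow> 'k poly poly set" where
  "curve_relations t = (let e = const t in {
     var_y ^ 2 - (var_x ^ 2 - 4 * e ^ 2 * var_x + 4 * e ^ 2 * var_y),
     var_x ^ 3 - (8 * e ^ 4 * var_x + 2 * e ^ 2 * var_x ^ 2 - 4 * e ^ 4 * var_y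
       + 2 * e * (1 - e - e ^ 2) * (var_x * var_y)),
     var_x ^ 2 * var_y - (- 8 * e ^ 3 * (1 + e) * var_x + 2 * e * (1 + e) * var_x ^ 2 + 4 * e ^ 4 * var_y
       + 2 * e ^ 2 * (1 + e) * (var_x * var_y))})"

text \<open>The transpose of \<open>base_chart\<close>. Since y^2 and x^2 agree modulo the limit
  ideal, this chart contains it as well, and a regular function may be presented as a quotient
  there.\<close>

definition opposite_chart :: "(nat \<times> nat) set" where
  "opposite_chart = {(0, 0), (1, 0), (0, 1), (0, 2), (1, 1)}"

lemma opposite_chart: "finite opposite_chart" "card opposite_chart = 5"
  by (simp_all add: opposite_chart_def)

lemma lincomb_base_chart: "lincomb base_chart xy_monom a =
    const (a (0,0)) + const (a (1,0)) * var_x + const (a (2,0)) * var_x ^ 2 + const (a (0,1)) * var_y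
    + const (a (1,1)) * (var_x * var_y)"
  by (simp add: lincomb_def base_chart_def smult_eq_const xy_monom_def)

lemma lincomb_opposite_chart: "lincomb opposite_chart xy_monom a =
    const (a (0,0)) + const (a (1,0)) * var_x + const (a (0,1)) * var_y + const (a (0,2)) * var_y ^ 2
    + const (a (1,1)) * (var_x * var_y)"
  by (simp add: lincomb_def opposite_chart_def smult_eq_const xy_monom_def)

lemma base_chart_polyI:
  assumes "\<And>t. F - (const (poly c0 t) + const (poly c1 t) * var_x + const (poly c2 t) * var_x ^ 2
    + const (poly c3 t) * var_y + const (poly c4 t) * (var_x * var_y)) \<in> I t"
  shows "\<exists>a. \<forall>t\<in>UNIV. F - lincomb base_chart xy_monom (\<lambda>b. poly (a b) t) \<in> I t"
  using assms unfolding lincomb_base_chart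
  by (intro exI[of _ "\<lambda>b. if b = (0,0) then c0 else if b = (1,0) then c1 else if b = (2,0) then c2
    else if b = (0,1) then c3 else c4"]) simp

lemma opposite_chart_polyI:
  assumes "\<And>t. F - (const (poly c0 t) + const (poly c1 t) * var_x + const (poly c2 t) * var_y
    + const (poly c3 t) * var_y ^ 2 + const (poly c4 t) * (var_x * var_y)) \<in> I t"
  shows "\<exists>a. \<forall>t\<in>UNIV. F - lincomb opposite_chart xy_monom (\<lambda>b. poly (a b) t) \<in> I t"
  using assms unfolding lincomb_opposite_chart
  by (intro exI[of _ "\<lambda>b. if b = (0,0) then c0 else if b = (1,0) then c1 else if b = (0,1) then c2
    else if b = (0,2) then c3 else c4"]) simp

lemma xy_monom_simps:
  "xy_monom (0,0) = 1" "xy_monom (1,0) = var_x" "xy_monom (0,1) = var_y" "xy_monom (1,1) = var_x * var_y"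
  "xy_monom (2,0) = var_x ^ 2" "xy_monom (0,2) = var_y ^ 2"
  by (simp_all add: xy_monom_def)

text \<open>Covers the ideals of five points and the limit ideal at once. The relations alone yield
  normal forms polynomial in the parameter; independence of the monomials has to come from
  elsewhere.\<close>

locale curve_family =
  fixes I :: "'k::field \<Rightarrow> 'k poly poly set"
  assumes ideal: "\<And>t. is_ideal (I t)" and rel: "\<And>t. curve_relations t \<subseteq> I t"
begin

abbreviation (input) "x \<equiv> var_x :: 'k poly poly"
abbreviation (input) "y \<equiv> var_y :: 'k poly poly"


lemma relations:
  "y ^ 2 - (x ^ 2 - 4 * const t ^ 2 * x + 4 * const t ^ 2 * y) \<in> I t"
  "x ^ 3 - (8 * const t ^ 4 * x + 2 * const t ^ 2 * x ^ 2 - 4 * const t ^ 4 * y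
     + 2 * const t * (1 - const t - const t ^ 2) * (x * y)) \<in> I t"
  "x ^ 2 * y - (- 8 * const t ^ 3 * (1 + const t) * x + 2 * const t * (1 + const t) * x ^ 2 + 4 * const t ^ 4 * y
     + 2 * const t ^ 2 * (1 + const t) * (x * y)) \<in> I t"
  using rel[of t] by (simp_all add: curve_relations_def Let_def)

text \<open>Reduces membership to an identity in the polynomial ring, with cofactors for the
  relations of y^2, x^3 and x^2 y in this order.\<close>

lemma membership:
  assumes "F - G = r1 * (y ^ 2 - (x ^ 2 - 4 * const t ^ 2 * x + 4 * const t ^ 2 * y))
    + r2 * (x ^ 3 - (8 * const t ^ 4 * x + 2 * const t ^ 2 * x ^ 2 - 4 * const t ^ 4 * y
       + 2 * const t * (1 - const t - const t ^ 2) * (x * y)))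
    + r3 * (x ^ 2 * y - (- 8 * const t ^ 3 * (1 + const t) * x + 2 * const t * (1 + const t) * x ^ 2 + 4 * const t ^ 4 * y
       + 2 * const t ^ 2 * (1 + const t) * (x * y)))"
  shows "F - G \<in> I t"
  unfolding assms by (intro ideal_add[OF ideal] ideal_mult[OF ideal] relations)

lemma base_chart_normal_form:
  "\<exists>a. \<forall>t\<in>UNIV. f - lincomb base_chart xy_monom (\<lambda>b. poly (a b) t) \<in> I t"
proof (rule normal_form_family)
  fix b assume "b \<in> base_chart"
  then consider "b = (0,0)" | "b = (1,0)" | "b = (2,0)" | "b = (0,1)" | "b = (1,1)"
    by (auto simp: base_chart_def)
  note cases = this
  show "\<exists>a. \<forall>t\<in>UNIV. x * xy_monom b - lincomb base_chart xy_monom (\<lambda>b. poly (a b) t) \<in> I t"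
  proof (cases rule: cases)
    case 1
    show ?thesis unfolding 1 xy_monom_simps
      by (rule base_chart_polyI[of _ 0 1 0 0 0], rule membership[of _ _ 0 _ 0 0]) simp
  next
    case 2
    show ?thesis unfolding 2 xy_monom_simps
      by (rule base_chart_polyI[of _ 0 0 1 0 0], rule membership[of _ _ 0 _ 0 0]) (simp add: power2_eq_square)
  next
    case 3
    show ?thesis unfolding 3 xy_monom_simps
      by (rule base_chart_polyI[of _ 0 "[:0, 0, 0, 0, 8:]" "[:0, 0, 2:]" "[:0, 0, 0, 0, -4:]" "[:0, 2, -2, -2:]"],
          rule membership[of _ _ 0 _ 1 0]) (simp add: algebra_simps eval_nat_numeral)
  next
    case 4
    show ?thesis unfolding 4 xy_monom_simps
      by (rule base_chart_polyI[of _ 0 0 0 0 1], rule membership[of _ _ 0 _ 0 0]) simp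
  next
    case 5
    show ?thesis unfolding 5 xy_monom_simps
      by (rule base_chart_polyI[of _ 0 "[:0, 0, 0, -8, -8:]" "[:0, 2, 2:]" "[:0, 0, 0, 0, 4:]" "[:0, 0, 2, 2:]"],
          rule membership[of _ _ 0 _ 0 1]) (simp add: algebra_simps eval_nat_numeral)
  qed
  show "\<exists>a. \<forall>t\<in>UNIV. y * xy_monom b - lincomb base_chart xy_monom (\<lambda>b. poly (a b) t) \<in> I t"
  proof (cases rule: cases)
    case 1
    show ?thesis unfolding 1 xy_monom_simps
      by (rule base_chart_polyI[of _ 0 0 0 1 0], rule membership[of _ _ 0 _ 0 0]) simp
  next
    case 2
    show ?thesis unfolding 2 xy_monom_simps
      by (rule base_chart_polyI[of _ 0 0 0 0 1], rule membership[of _ _ 0 _ 0 0]) (simp add: mult.commute)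
  next
    case 3
    show ?thesis unfolding 3 xy_monom_simps
      by (rule base_chart_polyI[of _ 0 "[:0, 0, 0, -8, -8:]" "[:0, 2, 2:]" "[:0, 0, 0, 0, 4:]" "[:0, 0, 2, 2:]"],
          rule membership[of _ _ 0 _ 0 1]) (simp add: algebra_simps eval_nat_numeral)
  next
    case 4
    show ?thesis unfolding 4 xy_monom_simps
      by (rule base_chart_polyI[of _ 0 "[:0, 0, -4:]" 1 "[:0, 0, 4:]" 0],
          rule membership[of _ _ 1 _ 0 0]) (simp add: algebra_simps eval_nat_numeral)
  next
    case 5
    \<comment> \<open>For x y^2 the conic is multiplied by x, and the resulting x^3 is reduced by
      its own relation.\<close>
    show ?thesis unfolding 5 xy_monom_simps
      by (rule base_chart_polyI[of _ 0 "[:0, 0, 0, 0, 8:]" "[:0, 0, -2:]" "[:0, 0, 0, 0, -4:]" "[:0, 2, 2, -2:]"],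
          rule membership[of _ _ x _ 1 0]) (simp add: algebra_simps eval_nat_numeral)
  qed
qed (simp_all add: base_chart ideal, simp add: base_chart_def)

lemma opposite_chart_normal_form:
  "\<exists>a. \<forall>t\<in>UNIV. f - lincomb opposite_chart xy_monom (\<lambda>b. poly (a b) t) \<in> I t"
proof (rule normal_form_family)
  fix b assume "b \<in> opposite_chart"
  then consider "b = (0,0)" | "b = (1,0)" | "b = (0,1)" | "b = (0,2)" | "b = (1,1)"
    by (auto simp: opposite_chart_def)
  note cases = this
  show "\<exists>a. \<forall>t\<in>UNIV. x * xy_monom b - lincomb opposite_chart xy_monom (\<lambda>b. poly (a b) t) \<in> I t"
  proof (cases rule: cases)
    case 1
    show ?thesis unfolding 1 xy_monom_simps
      by (rule opposite_chart_polyI[of _ 0 1 0 0 0], rule membership[of _ _ 0 _ 0 0]) simp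
  next
    case 2
    \<comment> \<open>The conic is read backwards to eliminate x^2, hence the cofactor - 1.\<close>
    show ?thesis unfolding 2 xy_monom_simps
      by (rule opposite_chart_polyI[of _ 0 "[:0, 0, 4:]" "[:0, 0, -4:]" 1 0], rule membership[of _ _ "- 1" _ 0 0])
        (simp add: algebra_simps eval_nat_numeral)
  next
    case 3
    show ?thesis unfolding 3 xy_monom_simps
      by (rule opposite_chart_polyI[of _ 0 0 0 0 1], rule membership[of _ _ 0 _ 0 0]) simp
  next
    case 4
    \<comment> \<open>As for x y^2 in the other chart, but the remaining multiple of x^2 is removed
      by the conic once more; this adds \<open>2 * const t ^ 2\<close> to the cofactor. The cases
      below follow the same pattern.\<close>
    show ?thesis unfolding 4 xy_monom_simps
      apply (rule opposite_chart_polyI[of _ 0 0 "[:0, 0, 0, 0, 4:]" "[:0, 0, -2:]" "[:0, 2, 2, -2:]"])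
      subgoal for t
        by (rule membership[of _ _ "x + 2 * const t ^ 2" t 1 0]) (simp add: algebra_simps eval_nat_numeral)
      done
  next
    case 5
    show ?thesis unfolding 5 xy_monom_simps
      apply (rule opposite_chart_polyI[of _ 0 0 "[:0, 0, 0, -8, -4:]" "[:0, 2, 2:]" "[:0, 0, 2, 2:]"])
      subgoal for t
        by (rule membership[of _ _ "- 2 * const t * (1 + const t)" t 0 1]) (simp add: algebra_simps eval_nat_numeral)
      done
  qed
  show "\<exists>a. \<forall>t\<in>UNIV. y * xy_monom b - lincomb opposite_chart xy_monom (\<lambda>b. poly (a b) t) \<in> I t"
  proof (cases rule: cases)
    case 1
    show ?thesis unfolding 1 xy_monom_simps
      by (rule opposite_chart_polyI[of _ 0 0 1 0 0], rule membership[of _ _ 0 _ 0 0]) simp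
  next
    case 2
    show ?thesis unfolding 2 xy_monom_simps
      by (rule opposite_chart_polyI[of _ 0 0 0 0 1], rule membership[of _ _ 0 _ 0 0]) (simp add: mult.commute)
  next
    case 3
    show ?thesis unfolding 3 xy_monom_simps
      by (rule opposite_chart_polyI[of _ 0 0 0 1 0], rule membership[of _ _ 0 _ 0 0]) (simp add: power2_eq_square)
  next
    case 4
    show ?thesis unfolding 4 xy_monom_simps
      apply (rule opposite_chart_polyI[of _ 0 0 "[:0, 0, 0, -8, -4:]" "[:0, 2, 6:]" "[:0, 0, -2, 2:]"])
      subgoal for t
        by (rule membership[of _ _ "y - 2 * const t * (1 + const t)" t 0 1]) (simp add: algebra_simps eval_nat_numeral)
      done
  next
    case 5
    show ?thesis unfolding 5 xy_monom_simps
      apply (rule opposite_chart_polyI[of _ 0 0 "[:0, 0, 0, 0, 4:]" "[:0, 0, -2:]" "[:0, 2, 2, -2:]"])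
      subgoal for t
        by (rule membership[of _ _ "x + 2 * const t ^ 2" t 1 0]) (simp add: algebra_simps eval_nat_numeral)
      done
  qed
qed (simp_all add: opposite_chart ideal, simp add: opposite_chart_def)

lemma base_chart_basisI:
  assumes "\<And>a. lincomb base_chart xy_monom a \<in> I t \<Longrightarrow> \<forall>b\<in>base_chart. a b = 0"
  shows "basis_mod (I t) base_chart xy_monom"
  unfolding basis_mod_iff[OF ideal] using base_chart_normal_form assms by (meson UNIV_I)

text \<open>In the conic x^2 and y^2 have coefficients 1 and - 1 for every parameter, so exchanging
  them is an invertible change of basis.\<close>

lemma opposite_chart_basisI:
  assumes base: "basis_mod (I t) base_chart xy_monom"
  shows "basis_mod (I t) opposite_chart xy_monom"
  unfolding basis_mod_iff[OF ideal]
proof (intro conjI allI impI)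
  show "\<exists>a. f - lincomb opposite_chart xy_monom a \<in> I t" for f
    using opposite_chart_normal_form[of f] by (meson UNIV_I)
  fix a :: "nat \<times> nat \<Rightarrow> 'k"
  assume a: "lincomb opposite_chart xy_monom a \<in> I t"
  let ?c = "4 * t ^ 2 * a (0,2)"
  \<comment> \<open>The coefficients after substituting the conic for y^2; the leftover value at
    \<open>(0,2)\<close> is not seen by \<open>base_chart\<close>.\<close>
  define a' where "a' = a((1,0) := a (1,0) - ?c, (0,1) := a (0,1) + ?c, (2,0) := a (0,2))"
  have "lincomb base_chart xy_monom a' = lincomb opposite_chart xy_monom a -
      const (a (0,2)) * (y ^ 2 - (x ^ 2 - 4 * const t ^ 2 * x + 4 * const t ^ 2 * y))"
    unfolding lincomb_base_chart lincomb_opposite_chart by (simp add: a'_def algebra_simps)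
  then have "lincomb base_chart xy_monom a' \<in> I t"
    using ideal_diff[OF ideal a const_mult_in_ideal[OF ideal relations(1)]] by simp
  then have "\<forall>b\<in>base_chart. a' b = 0"
    using base unfolding basis_mod_iff[OF ideal] by blast
  then show "\<forall>b\<in>opposite_chart. a b = 0"
    by (auto simp: base_chart_def opposite_chart_def a'_def)
qed

end

text \<open>Points 0 and 4 lie on y = x, points 1, 2, 3 on x + y = 4 t^2. The directions of points 0
  and 1 tend to slopes 1 and - 1, which selects s = 0, t = 1 in the limit. With these even
  coordinates the interpolation coefficients in \<open>curve_relations\<close> are integral.\<close>

definition curve_coord :: "nat + nat \<Rightarrow> 'k::field poly" where
  "curve_coord = case_sum
     (\<lambda>i. if i = 0 then [:2:] else if i = 1 then [:- 2:] else if i = 2 then [:2:] else if i = 3 then [:4:] else 0)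
     (\<lambda>i. if i = 0 then [:2:] else if i = 1 then [:2, 4:] else if i = 2 then [:4, - 2:] else 0)"

definition curve_point :: "'k::field \<Rightarrow> nat + nat \<Rightarrow> 'k" where
  "curve_point t = (\<lambda>v\<in>vars5. t ^ curve_weight v * poly (curve_coord v) t)"

lemma curve_point_simps [simp]:
  "curve_point t (Inl 0) = 2 * t" "curve_point t (Inr 0) = 2 * t"
  "curve_point t (Inl (Suc 0)) = - 2 * t" "curve_point t (Inr (Suc 0)) = 2 * t + 4 * t ^ 2"
  "curve_point t (Inl 2) = 2 * t ^ 3" "curve_point t (Inr 2) = 4 * t ^ 2 - 2 * t ^ 3"
  "curve_point t (Inl 3) = 4 * t ^ 2" "curve_point t (Inr 3) = 0"
  "curve_point t (Inl 4) = 0" "curve_point t (Inr 4) = 0"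
  by (simp_all add: curve_point_def curve_coord_def algebra_simps power2_eq_square power3_eq_cube)

lemma xy_eval_const [simp]: "xy_eval (const c) P = c"
  by (simp add: xy_eval_def const_def)

lemma xy_eval_numeral [simp]: "xy_eval (numeral n) P = numeral n"
  using xy_eval_const[of "numeral n" P] by simp

lemma less_5_cases: "i < 5 \<longleftrightarrow> i = 0 \<or> i = 1 \<or> i = 2 \<or> i = 3 \<or> i = (4::nat)"
  by auto

lemma curve_relations_point_ideal:
  "curve_relations t \<subseteq> point_ideal (curve_point t)"
  unfolding curve_relations_def Let_def
  by (auto simp: point_ideal_iff less_5_cases; simp add: algebra_simps eval_nat_numeral)

section \<open>Generic values of the parameter\<close>

lemma eventually_poly_nonzero: "p \<noteq> 0 \<Longrightarrow> eventually (\<lambda>t. poly p t \<noteq> (0::'k::field)) cofinite"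
  by (simp add: eventually_cofinite poly_roots_finite)

text \<open>Over a finite field the product of all X - a, plus 1, has no root.\<close>

lemma infinite_alg_closed: "infinite (UNIV :: 'k::alg_closed_field set)"
proof
  assume fin: "finite (UNIV :: 'k set)"
  define p where "p = (\<Prod>a\<in>UNIV. [:- a, 1:]) + (1 :: 'k poly)"
  have "degree (\<Prod>a\<in>(UNIV :: 'k set). [:- a, 1:]) = card (UNIV :: 'k set)"
    by (subst degree_prod_eq_sum_degree) auto
  moreover have "card (UNIV :: 'k set) > 0" using fin by (simp add: card_gt_0_iff)
  ultimately have "degree p > 0"
    unfolding p_def by (subst degree_add_eq_left) auto
  then obtain r where "poly p r = 0" using alg_closed_imp_poly_has_root by blast
  moreover have "(\<Prod>a\<in>UNIV. r - a) = 0"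
    using fin by (auto simp: prod_zero_iff)
  ultimately show False by (simp add: p_def poly_prod)
qed

lemma poly_eqI_eventually:
  fixes p q :: "'k::alg_closed_field poly"
  assumes "eventually (\<lambda>t. poly p t = poly q t) cofinite"
  shows "p = q"
proof (rule ccontr)
  assume "p \<noteq> q"
  then have "eventually (\<lambda>t. poly (p - q) t \<noteq> 0) cofinite"
    by (intro eventually_poly_nonzero) simp
  with assms have "eventually (\<lambda>t::'k. False) cofinite"
    by eventually_elim simp
  then show False using infinite_alg_closed[where ?'k = 'k] by (simp add: eventually_cofinite)
qed

lemma two_nonzero:
  assumes "CHAR('k) > 2"
  shows "(2 :: 'k::field) \<noteq> 0" "(4 :: 'k) \<noteq> 0"
proof -
  have "of_nat 2 \<noteq> (0 :: 'k)"
    using assms by (auto simp only: of_nat_eq_0_iff_char_dvd dest: dvd_imp_le)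
  then show "(2 :: 'k) \<noteq> 0" by simp
  have "(4 :: 'k) = 2 * 2" by simp
  then show "(4 :: 'k) \<noteq> 0" using \<open>(2 :: 'k) \<noteq> 0\<close> by (metis mult_eq_0_iff)
qed

lemma curve_point_weights: "v \<in> vars5 \<Longrightarrow> curve_point t v = t ^ curve_weight v * poly (curve_coord v) t"
  by (simp add: curve_point_def)

lemma curve_point_affine: "curve_point t \<in> affine_points vars5"
  by (simp add: curve_point_def)

lemma peval_curve_point:
  fixes P :: "(nat + nat, 'k::field) mpoly"
  assumes "cw_order n P"
  shows "\<exists>r. \<forall>t. peval P (curve_point t) = t ^ n * poly r t"
  using peval_along_curve[OF finite_vars5 assms, of curve_coord] curve_point_weights by metis

lemma det_basis_curve_point:
  "\<exists>r. \<forall>t. peval det_basis (curve_point t) = t ^ 8 * poly r (t :: 'k::field) \<and> poly r 0 = 2 ^ 9"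
proof -
  define L where "L = (pivot * (pvar (Inl 0) * pvar (Inl 1) * (cross_v - cross_u)) :: (nat + nat, 'k) mpoly)"
  have "cw_leading 8 det_basis L"
    unfolding L_def by (rule cw_leading_det_basis)
  then have "cw_order 9 (det_basis - L)"
    by (simp add: leading_form_def)
  then obtain r where r: "\<And>t. peval (det_basis - L) (curve_point t) = t ^ 9 * poly r t"
    using peval_curve_point by blast
  \<comment> \<open>The constant polynomials and linear factors are a, x_0 x_1 and v - u with t^4,
    t^2 and t^2 taken out; at 0 they give 16 * (- 4) * (- 8) = 2^9.\<close>
  have "peval det_basis (curve_point t) = t ^ 8 * poly ([:16, - 8:] * [:- 4:] * [:- 8, - 8:] + [:0, 1:] * r) t" for t
  proof -
    have "peval det_basis (curve_point t) = peval L (curve_point t) + t ^ 9 * poly r t"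
      using r[of t] by (simp add: algebra_simps)
    then show ?thesis
      by (simp add: L_def pivot_def cross_u_def cross_v_def) (simp add: algebra_simps eval_nat_numeral)
  qed
  then show ?thesis
    by (intro exI[of _ "[:16, - 8:] * [:- 4:] * [:- 8, - 8:] + [:0, 1:] * r"]) simp
qed

lemma test_poly_curve_point:
  fixes \<tau> :: "(nat + nat \<Rightarrow> 'k::alg_closed_field, 'k) sheaf_map"
  assumes \<tau>: "standard_splitting vars5 \<tau>" and p: "CHAR('k) = p" "2 < p"
  shows "\<exists>r. \<forall>t. peval (standard_splitting_poly vars5 (test_poly p)) (curve_point t) = t ^ 16 * poly r (t :: 'k)
    \<and> poly r 0 = - (2 ^ 19)"
proof -
  define L where "L = (pivot ^ 2 * (cross_u - cross_v) ^ 2 * (cross_u * cross_v) :: (nat + nat, 'k) mpoly)"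
  obtain R where R: "cw_order 17 R" "\<And>z. z \<in> affine_points vars5 \<Longrightarrow>
      peval (standard_splitting_poly vars5 (test_poly p)) z = 2 * peval L z + peval R z"
    using standard_splitting_test_poly[OF assms] unfolding L_def by blast
  obtain r where r: "\<And>t. peval R (curve_point t) = t ^ 17 * poly r t"
    using peval_curve_point[OF R(1)] by blast
  \<comment> \<open>The factors 2, a^2, (u - v)^2 and u v without their powers of t; at 0 the
    product is - 2^19. Divided by the square of 2^9 it gives the limit value - 2.\<close>
  let ?q = "[:2:] * [:16, - 8:] ^ 2 * [:8, 8:] ^ 2 * ([:4, 8:] * [:- 4:])"
  have L: "2 * peval L (curve_point t) = t ^ 16 * poly ?q t" for t
  proof -
    have "peval pivot (curve_point t) = t ^ 4 * (16 - 8 * t)"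
      "peval (cross_u - cross_v) (curve_point t) = t ^ 2 * (8 + 8 * t)"
      "peval (cross_u * cross_v) (curve_point t) = t ^ 4 * ((4 + 8 * t) * - 4)"
      by (simp_all add: pivot_def cross_u_def cross_v_def) (simp_all add: algebra_simps eval_nat_numeral)
    then have "2 * peval L (curve_point t) =
        2 * ((t ^ 4 * (16 - 8 * t)) ^ 2 * (t ^ 2 * (8 + 8 * t)) ^ 2 * (t ^ 4 * ((4 + 8 * t) * - 4)))"
      unfolding L_def by (simp only: peval_mult peval_power)
    also have "\<dots> = (t ^ 4) ^ 2 * (t ^ 2) ^ 2 * t ^ 4 *
        (2 * (16 - 8 * t) ^ 2 * (8 + 8 * t) ^ 2 * ((4 + 8 * t) * - 4))"
      by (simp only: power_mult_distrib mult_ac)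
    also have "(t ^ 4) ^ 2 * (t ^ 2) ^ 2 * t ^ 4 = t ^ 16"
      by (simp flip: power_mult power_add)
    also have "2 * (16 - 8 * t) ^ 2 * (8 + 8 * t) ^ 2 * ((4 + 8 * t) * - 4) = poly ?q t"
      by (simp add: algebra_simps)
    finally show ?thesis .
  qed
  have "peval (standard_splitting_poly vars5 (test_poly p)) (curve_point t) = t ^ 16 * poly (?q + [:0, 1:] * r) t" for t
  proof -
    have "t ^ 17 = t ^ 16 * t" by (simp add: eval_nat_numeral)
    then show ?thesis
      unfolding R(2)[OF curve_point_affine] L r poly_add by (simp add: algebra_simps)
  qed
  moreover have "poly (?q + [:0, 1:] * r) 0 = - (2 ^ 19)" by simp
  ultimately show ?thesis by blast
qed

lemma eventually_good_points:
  assumes "CHAR('k::field) > 2"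
  shows "eventually (\<lambda>t :: 'k. curve_point t \<in> good_points) cofinite"
proof -
  note two = two_nonzero[OF assms]
  define X :: "nat \<Rightarrow> 'k poly" where "X i = monom 1 (curve_weight (Inl i)) * curve_coord (Inl i)" for i
  have X: "curve_point t (Inl i) = poly (X i) t" if "i < 5" for t i
    using that by (simp add: X_def curve_point_def poly_monom)
  have "X i \<noteq> X j" if "i < 5" "j < 5" "i \<noteq> j" for i j
  proof -
    have "(2 :: 'k) \<noteq> - 2" "- (2 :: 'k) \<noteq> 2" using two by (metis add_eq_0_iff numeral_Bit0)+
    then show ?thesis
      using that two unfolding less_5_cases X_def curve_coord_def
      by (auto simp: monom_altdef eval_nat_numeral)
  qed
  then have "eventually (\<lambda>t. poly (X (fst ij) - X (snd ij)) t \<noteq> 0) cofinite"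
    if "ij \<in> {(i, j) \<in> {..<5} \<times> {..<5}. i \<noteq> j}" for ij
    using that by (intro eventually_poly_nonzero) auto
  moreover have "finite {(i, j) \<in> {..<5} \<times> {..<5::nat}. i \<noteq> j}"
    by (rule finite_subset[of _ "{..<5} \<times> {..<5}"]) auto
  ultimately have 1: "eventually (\<lambda>t. \<forall>ij\<in>{(i, j) \<in> {..<5} \<times> {..<5}. i \<noteq> j}.
      poly (X (fst ij) - X (snd ij)) t \<noteq> 0) cofinite"
    by (intro eventually_ball_finite ballI)
  obtain r where r: "\<And>t :: 'k. peval det_basis (curve_point t) = t ^ 8 * poly r t" "poly r 0 = 2 ^ 9"
    using det_basis_curve_point by blast
  have "poly r 0 \<noteq> 0" unfolding r(2) by (rule power_not_zero[OF two(1)])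
  then have "r \<noteq> 0" by auto
  then have 2: "eventually (\<lambda>t. poly r t \<noteq> 0) cofinite"
    by (rule eventually_poly_nonzero)
  have 3: "eventually (\<lambda>t :: 'k. t \<noteq> 0) cofinite"
    using eventually_poly_nonzero[of "[:0, 1:]"] by simp
  from 1 2 3 show ?thesis
  proof eventually_elim
    case (elim t)
    have "inj_on (\<lambda>i. curve_point t (Inl i)) {..<5}"
      using elim(1) X by (auto simp: inj_on_def)
    moreover have "peval det_basis (curve_point t) \<noteq> 0"
      using elim(2,3) r(1) by simp
    ultimately show ?case
      by (simp add: good_points_def curve_point_affine point_ideal_in_good_locus_iff)
  qed
qed

section \<open>The limit ideal\<close>

text \<open>The point [1, -1] of the curve, with the generators kept in the literal form of
  \<open>curve_Y\<close>.\<close>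

definition limit_ideal :: "'k::field poly poly set" where
  "limit_ideal = ideal_generated
      {var_y ^ 3, var_x * var_y ^ 2, var_x ^ 2 * var_y, var_x ^ 3,
       smult [:1:] (var_y ^ 2) + smult [:- 1:] (var_x ^ 2)}"

lemma is_ideal_generated: "is_ideal (ideal_generated S)"
  by (rule module.subspace_span[OF module_ring])

lemma mem_ideal_generated: "f \<in> S \<Longrightarrow> f \<in> ideal_generated S"
  by (rule module.span_base[OF module_ring])

lemma limit_ideal_in_curve_Y: "limit_ideal \<in> curve_Y"
  unfolding curve_Y_def limit_ideal_def by (rule CollectI, intro exI[of _ 1] exI[of _ "- 1"]) simp

lemma is_ideal_limit_ideal: "is_ideal limit_ideal"
  unfolding limit_ideal_def by (rule is_ideal_generated)

lemma limit_ideal_generators: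
  "var_y ^ 3 \<in> limit_ideal" "var_x * var_y ^ 2 \<in> limit_ideal" "var_x ^ 2 * var_y \<in> limit_ideal"
  "var_x ^ 3 \<in> limit_ideal" "var_y ^ 2 - var_x ^ 2 \<in> limit_ideal"
proof -
  have eq: "smult [:1:] (var_y ^ 2) + smult [:- 1:] (var_x ^ 2) = (var_y ^ 2 - var_x ^ 2 :: 'k::field poly poly)"
    by (simp add: smult_eq_const)
  show "var_y ^ 3 \<in> limit_ideal" "var_x * var_y ^ 2 \<in> limit_ideal" "var_x ^ 2 * var_y \<in> limit_ideal"
    "var_x ^ 3 \<in> limit_ideal" "var_y ^ 2 - var_x ^ 2 \<in> limit_ideal"
    unfolding limit_ideal_def eq by (auto intro!: mem_ideal_generated)
qed

lemma curve_relations_limit_ideal: "curve_relations 0 \<subseteq> limit_ideal"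
  using limit_ideal_generators by (simp add: curve_relations_def)

lemma coeff_xy_monom:
  "poly.coeff (poly.coeff (xy_monom (i, j) :: 'k::field poly poly) l) k = (if k = i \<and> l = j then 1 else 0)"
proof -
  have "(xy_monom (i, j) :: 'k poly poly) = monom (monom 1 i) j"
    by (simp add: xy_monom_def var_x_def var_y_def monom_altdef poly_const_pow)
  then show ?thesis by simp
qed

text \<open>Five linear conditions on the coefficients of degree at most 2, from which independence
  of the chart monomials can be read off. The coefficients of x^2 and y^2 are added because y^2 -
  x^2 has to satisfy the condition.\<close>

lemma limit_ideal_subset:
  "limit_ideal \<subseteq> {f :: 'k::field poly poly. poly.coeff (poly.coeff f 0) 0 = 0 \<and> poly.coeff (poly.coeff f 0) 1 = 0 \<and>
    poly.coeff (poly.coeff f 1) 0 = 0 \<and> poly.coeff (poly.coeff f 1) 1 = 0 \<and>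
    poly.coeff (poly.coeff f 0) 2 + poly.coeff (poly.coeff f 2) 0 = 0}" (is "_ \<subseteq> ?J")
  unfolding limit_ideal_def
proof (rule module.span_minimal[OF module_ring])
  have "(var_y :: 'k poly poly) ^ 3 = xy_monom (0, 3)" "(var_x :: 'k poly poly) * var_y ^ 2 = xy_monom (1, 2)" "(var_x :: 'k poly poly) ^ 2 * var_y = xy_monom (2, 1)"
    "(var_x :: 'k poly poly) ^ 3 = xy_monom (3, 0)" "smult [:1:] (var_y ^ 2) + smult [:- 1:] (var_x ^ 2) = (xy_monom (0, 2) - xy_monom (2, 0) :: 'k poly poly)"
    by (simp_all add: xy_monom_def smult_eq_const)
  then show "{var_y ^ 3, var_x * var_y ^ 2, var_x ^ 2 * var_y, var_x ^ 3,
       smult [:1:] (var_y ^ 2) + smult [:- 1:] (var_x ^ 2)} \<subseteq> ?J"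
    by (simp add: coeff_xy_monom)
  show "is_ideal ?J"
    unfolding is_ideal_iff
  proof (intro conjI ballI allI)
    fix r f :: "'k poly poly"
    assume "f \<in> ?J"
    \<comment> \<open>\<open>f\<close> has no terms of degree below 2, so its quadratic coefficients
      are merely scaled by the constant term of \<open>r\<close>.\<close>
    then show "r * f \<in> ?J"
      by (simp add: coeff_mult coeff_sum eval_nat_numeral) (metis distrib_left mult_zero_right)
  qed (simp_all add: algebra_simps)
qed

text \<open>At parameter 0 the five points collide and their vanishing ideal no longer has colength
  5, so the flat limit is put in by hand.\<close>

definition ideal_family :: "'k::field \<Rightarrow> 'k poly poly set" where
  "ideal_family t = (if t = 0 then limit_ideal else point_ideal (curve_point t))"

lemma curve_family_ideal_family: "curve_family ideal_family"
  by unfold_locales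
    (simp_all add: ideal_family_def is_ideal_limit_ideal is_ideal_vanishing_ideal
      curve_relations_limit_ideal curve_relations_point_ideal)

lemma is_ideal_ideal_family: "is_ideal (ideal_family t)"
  by (rule curve_family.ideal[OF curve_family_ideal_family])

lemma coeff_lincomb_base_chart:
  "b \<in> base_chart \<Longrightarrow> poly.coeff (poly.coeff (lincomb base_chart xy_monom a) (snd b)) (fst b) = a b"
  "poly.coeff (poly.coeff (lincomb base_chart xy_monom a) 2) 0 = 0"
  by (auto simp: lincomb_def base_chart_def coeff_xy_monom)

lemma limit_ideal_base_chart: "basis_mod (limit_ideal :: 'k::field poly poly set) base_chart xy_monom"
proof -
  have "basis_mod (ideal_family (0 :: 'k)) base_chart xy_monom"
  proof (rule curve_family.base_chart_basisI[OF curve_family_ideal_family])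
    fix a :: "nat \<times> nat \<Rightarrow> 'k"
    assume "lincomb base_chart xy_monom a \<in> ideal_family 0"
    then have "lincomb base_chart xy_monom a \<in> limit_ideal"
      by (simp add: ideal_family_def)
    note J = subsetD[OF limit_ideal_subset this]
    have "(0,0) \<in> base_chart" "(1,0) \<in> base_chart" "(2,0) \<in> base_chart" "(0,1) \<in> base_chart" "(1,1) \<in> base_chart"
      by (simp_all add: base_chart_def)
    note this[THEN coeff_lincomb_base_chart(1), of a]
    then have "a (0,0) = 0" "a (1,0) = 0" "a (2,0) = 0" "a (0,1) = 0" "a (1,1) = 0"
      using J coeff_lincomb_base_chart(2)[of a] by simp_all
    then show "\<forall>b\<in>base_chart. a b = 0" by (simp add: base_chart_def)
  qed
  then show ?thesis by (simp add: ideal_family_def)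
qed

lemma eventually_base_chart:
  assumes "CHAR('k::field) > 2"
  shows "eventually (\<lambda>t :: 'k. basis_mod (ideal_family t) base_chart xy_monom) cofinite"
  using eventually_good_points[OF assms]
proof eventually_elim
  case (elim t)
  then show ?case
    using limit_ideal_base_chart base_chart_if_det_basis_nonzero[of "curve_point t"]
    by (auto simp: ideal_family_def good_points_def point_ideal_in_good_locus_iff)
qed

section \<open>Charts containing the limit and continuity of the family\<close>

lemma xy_monom_add: "xy_monom (i + i', j + j') = xy_monom (i, j) * xy_monom (i', j')"
  by (simp add: xy_monom_def power_add mult_ac)

lemma limit_ideal_high_monom:
  assumes ij: "3 \<le> i + j"
  shows "xy_monom (i, j) \<in> (limit_ideal :: 'k::field poly poly set)"
proof -
  have *: "xy_monom (i, j) \<in> (limit_ideal :: 'k poly poly set)" if "i' \<le> i" "j' \<le> j" "xy_monom (i', j') \<in> (limit_ideal :: 'k poly poly set)" for i' j'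
    using ideal_mult[OF is_ideal_limit_ideal that(3), of "xy_monom (i - i', j - j')"] that(1,2)
    by (simp add: xy_monom_add[of "i - i'" i' "j - j'" j', symmetric])
  have "3 \<le> i \<or> 2 \<le> i \<and> 1 \<le> j \<or> 1 \<le> i \<and> 2 \<le> j \<or> 3 \<le> j"
    using ij by linarith
  then show ?thesis
    using *[of 3 0] *[of 2 1] *[of 1 2] *[of 0 3] limit_ideal_generators
    by (auto simp: xy_monom_def)
qed

text \<open>Monomials of degree at least 3 lie in the ideal, and x^2, y^2 are dependent modulo it.
  Five of the six monomials of degree below 3 must form the basis, so exactly one of these two is
  missing.\<close>

lemma limit_ideal_charts:
  fixes B :: "(nat \<times> nat) set"
  assumes B: "finite B" "card B = 5" and bm: "basis_mod (limit_ideal :: 'k::field poly poly set) B xy_monom"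
  shows "B = base_chart \<or> B = opposite_chart"
proof -
  have indep: "a b = 0" if "lincomb B xy_monom a \<in> (limit_ideal :: 'k poly poly set)" "b \<in> B" for a b
    using bm that unfolding basis_mod_iff[OF is_ideal_limit_ideal] by blast
  have "xy_monom b \<notin> (limit_ideal :: 'k poly poly set)" if "b \<in> B" for b
  proof
    assume "xy_monom b \<in> (limit_ideal :: 'k poly poly set)"
    then have "lincomb B xy_monom (\<lambda>b'. if b' = b then 1 else 0) \<in> (limit_ideal :: 'k poly poly set)"
      using lincomb_single[OF B(1) that, of xy_monom "1 :: 'k"] by (simp add: one_pCons[symmetric])
    from indep[OF this that] show False by simp
  qed
  then have low: "i + j < 3" if "(i, j) \<in> B" for i j
    using limit_ideal_high_monom[of i j] that by (metis not_le)
  let ?M = "{(0,0), (1,0), (0,1), (2,0), (1,1), (0,2)} :: (nat \<times> nat) set"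
  have sub: "B \<subseteq> ?M"
  proof
    fix b assume "b \<in> B"
    obtain i j where b: "b = (i, j)" by (cases b)
    then have "i + j < 3" using low \<open>b \<in> B\<close> by simp
    then have "i = 0 \<and> j = 0 \<or> i = 1 \<and> j = 0 \<or> i = 0 \<and> j = 1 \<or> i = 2 \<and> j = 0 \<or> i = 1 \<and> j = 1 \<or> i = 0 \<and> j = 2"
      by linarith
    then show "b \<in> ?M" unfolding b by auto
  qed
  have "\<not> ((2,0) \<in> B \<and> (0,2) \<in> B)"
  proof
    assume both: "(2,0) \<in> B \<and> (0,2) \<in> B"
    have "lincomb B xy_monom (\<lambda>b. (if b = (0,2) then 1 else 0) - (if b = (2,0) then 1 else 0))
        = (xy_monom (0,2) - xy_monom (2,0) :: 'k poly poly)"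
      unfolding lincomb_diff using both by (simp add: lincomb_single[OF B(1)] one_pCons[symmetric])
    also have "\<dots> \<in> limit_ideal"
      using limit_ideal_generators(5) by (simp add: xy_monom_def)
    finally have "(if (0::nat,2::nat) = (0,2) then 1 else 0) - (if (0::nat,2::nat) = (2,0) then 1 else 0) = (0 :: 'k)"
      using both by (intro indep) simp_all
    then show False by simp
  qed
  then consider "B \<subseteq> opposite_chart" | "B \<subseteq> base_chart"
    using sub by (auto simp: base_chart_def opposite_chart_def)
  then show ?thesis
    using card_subset_eq[OF base_chart(1), of B] card_subset_eq[OF opposite_chart(1), of B] B
      base_chart(2) opposite_chart(2) by (cases; simp)
qed

text \<open>A single polynomial vector \<open>C\<close> describes the coordinates at parameter 0 and
  at nearly all others; this is what carries values to the limit.\<close>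

lemma ideal_family_coord_polynomial:
  fixes B :: "(nat \<times> nat) set"
  assumes char: "CHAR('k::field) > 2" and B: "finite B" "card B = 5"
    and bm: "basis_mod (limit_ideal :: 'k poly poly set) B xy_monom"
  shows "\<exists>C. eventually (\<lambda>t :: 'k. basis_mod (ideal_family t) B xy_monom) cofinite \<and>
    (\<forall>t :: 'k. basis_mod (ideal_family t) B xy_monom \<longrightarrow> hilb_coord B (ideal_family t) = (\<lambda>v. poly (C v) t))"
proof -
  have cf: "curve_family (ideal_family :: 'k \<Rightarrow> _)"
    by (rule curve_family_ideal_family)
  have B_cases: "B = base_chart \<or> B = opposite_chart"
    by (rule limit_ideal_charts[OF B bm])
  have "\<forall>m. \<exists>a. \<forall>t. xy_monom m - lincomb B xy_monom (\<lambda>b. poly (a b) t) \<in> ideal_family (t :: 'k)"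
    using B_cases curve_family.base_chart_normal_form[OF cf] curve_family.opposite_chart_normal_form[OF cf]
    by auto
  from choice[OF this] obtain N where N: "\<And>m t. xy_monom m - lincomb B xy_monom (\<lambda>b. poly (N m b) t) \<in> ideal_family (t :: 'k)"
    by auto
  \<comment> \<open>Matches the default value 0 of \<open>hilb_coord\<close> for indices outside
    \<open>B\<close>.\<close>
  define C where "C = (\<lambda>(m, b). if b \<in> B then N m b else 0)"
  have "hilb_coord B (ideal_family t) v = poly (C v) t" if bt: "basis_mod (ideal_family t) B xy_monom" for t v
  proof -
    obtain m b where v: "v = (m, b)" by (cases v)
    show ?thesis
      using hilb_coord_eqI[OF is_ideal_ideal_family bt N, of b m] by (simp add: v C_def hilb_coord_def)
  qed
  moreover have "eventually (\<lambda>t :: 'k. basis_mod (ideal_family t) B xy_monom) cofinite"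
    using eventually_base_chart[OF char]
  proof eventually_elim
    case (elim t)
    then show ?case
      using B_cases curve_family.opposite_chart_basisI[OF cf elim] by auto
  qed
  ultimately show ?thesis
    by (intro exI[of _ C] conjI allI impI ext) simp_all
qed

lemma peval_polynomial_family: "\<exists>q. \<forall>t. peval P (\<lambda>v. poly (C v) t) = poly q (t :: 'k::field)"
  by (rule exI[of _ "\<Sum>m\<in>Poly_Mapping.keys P. smult (Poly_Mapping.lookup P m)
      (\<Prod>v\<in>Poly_Mapping.keys m. C v ^ Poly_Mapping.lookup m v)"])
    (simp add: peval_def poly_sum poly_prod)

text \<open>Zariski continuity at the limit, by induction on how the open set is generated. On a
  basic open set the defining polynomial becomes a polynomial in the parameter that is nonzero at 0,
  so it has finitely many zeros.\<close>

lemma eventually_ideal_family_open: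
  fixes W :: "'k::field poly poly set set"
  assumes char: "CHAR('k) > 2" and W: "openin (zariski (hilb 5)) W" and lim: "limit_ideal \<in> W"
  shows "eventually (\<lambda>t. ideal_family t \<in> W) cofinite"
proof -
  have "limit_ideal \<in> W \<longrightarrow> eventually (\<lambda>t. ideal_family t \<in> W) cofinite"
    using W unfolding zariski_hilb charts_topology_def openin_topology_generated_by_iff
  proof (induction rule: generate_topology_on.induct)
    case (Int a b)
    then show ?case by (auto simp: eventually_conj_iff)
  next
    case (UN K)
    show ?case
    proof
      assume "limit_ideal \<in> \<Union>K"
      then obtain k where k: "k \<in> K" "limit_ideal \<in> k" by blast
      then have "eventually (\<lambda>t. ideal_family t \<in> k) cofinite" using UN by blast
      then show "eventually (\<lambda>t. ideal_family t \<in> \<Union>K) cofinite"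
        by eventually_elim (use k(1) in blast)
    qed
  next
    case (Basis s)
    then obtain B P where s: "s = {I \<in> hilb_chart_domain 5 B. peval P (hilb_coord B I) \<noteq> 0}"
      and B: "finite B" "card B = 5" by auto
    show ?case
    proof
      assume "limit_ideal \<in> s"
      then have bm: "basis_mod (limit_ideal :: 'k poly poly set) B xy_monom"
        and nz: "peval P (hilb_coord B limit_ideal) \<noteq> 0"
        by (simp_all add: s hilb_chart_domain_iff[OF B])
      obtain C where C: "eventually (\<lambda>t :: 'k. basis_mod (ideal_family t) B xy_monom) cofinite"
        "\<And>t :: 'k. basis_mod (ideal_family t) B xy_monom \<Longrightarrow> hilb_coord B (ideal_family t) = (\<lambda>v. poly (C v) t)"
        using ideal_family_coord_polynomial[OF char B bm] by blast
      obtain q where q: "\<And>t. peval P (\<lambda>v. poly (C v) t) = poly q t"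
        using peval_polynomial_family[of P C] by blast
      have "poly q 0 \<noteq> 0"
        using nz C(2)[of 0] bm q[of 0] by (simp add: ideal_family_def)
      then have "q \<noteq> 0" by auto
      from eventually_poly_nonzero[OF this] C(1)
      show "eventually (\<lambda>t. ideal_family t \<in> s) cofinite"
        by eventually_elim (simp add: s hilb_chart_domain_iff[OF B] is_ideal_ideal_family C(2) q)
    qed
  qed simp
  with lim show ?thesis by blast
qed

text \<open>In this chart \<open>a\<close> cannot be 0, otherwise the basis element x^2 would lie in
  the ideal. So y^2 reduces to a multiple of x^2, without an xy term.\<close>

lemma curve_Y_coord:
  assumes I: "(I :: 'k::field poly poly set) \<in> curve_Y" and bm: "basis_mod I base_chart xy_monom"
  shows "hilb_coord base_chart I ((0,2),(1,1)) = 0"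
proof -
  obtain a c where ac: "(a, c) \<noteq> (0, 0)" and I_eq: "I = ideal_generated
      {var_y ^ 3, var_x * var_y ^ 2, var_x ^ 2 * var_y, var_x ^ 3,
       smult [:a:] (var_y ^ 2) + smult [:c:] (var_x ^ 2)}"
    using I unfolding curve_Y_def by blast
  have ideal: "is_ideal I" unfolding I_eq by (rule is_ideal_generated)
  have gen: "const a * var_y ^ 2 + const c * var_x ^ 2 \<in> I"
    unfolding I_eq smult_eq_const by (rule mem_ideal_generated) simp
  have "a \<noteq> 0"
  proof
    assume "a = 0"
    then have "lincomb base_chart xy_monom (\<lambda>b. if b = (2,0) then c else 0) \<in> I"
      using gen by (simp add: lincomb_base_chart)
    then have "\<forall>b\<in>base_chart. (if b = (2,0) then c else 0) = 0"
      using bm unfolding basis_mod_iff[OF ideal] by (elim conjE allE) (erule mp)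
    then have "c = 0" by (simp add: base_chart_def)
    with ac \<open>a = 0\<close> show False by simp
  qed
  have "const (1 / a) * (const a * var_y ^ 2 + const c * var_x ^ 2) \<in> I"
    by (rule ideal_mult[OF ideal gen])
  moreover have "const (1 / a) * const a = 1" "const (1 / a) * const c = const (c / a)"
    using \<open>a \<noteq> 0\<close> by (simp_all flip: const_simps(6))
  ultimately have "xy_monom (0,2) - lincomb base_chart xy_monom (\<lambda>b. if b = (2,0) then - (1 / a * c) else 0) \<in> I"
    by (simp add: lincomb_base_chart xy_monom_def distrib_left mult.assoc[symmetric])
  from hilb_coord_eqI[OF ideal bm this, of "(1,1)"] show ?thesis
    by (simp add: base_chart_def)
qed

text \<open>The image of the test function is regular at \<open>limit_ideal\<close>, so its value
  there is determined by the five-point ideals of the family. Compatibility would make it 0, but the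
  computation yields - 2.\<close>

theorem mainTheorem6:
  fixes p :: nat
    and \<phi> :: "('k::alg_closed_field poly poly set, 'k) sheaf_map"
  assumes "CHAR('k) = p" and "2 < p" and "p \<le> 23"
    and "induced_splitting 5 \<phi>"
  shows "\<not> compatibly_split (hilb 5) \<phi> curve_Y"
proof
  assume split: "compatibly_split (hilb 5) \<phi> curve_Y"
  let ?U = "hilb_chart_domain 5 base_chart :: 'k poly poly set set"
  have char: "CHAR('k) > 2" using assms by simp
  define g where "g = (\<lambda>I\<in>?U. peval (test_monom p) (hilb_coord base_chart I))"
  have openU: "openin (zariski (hilb 5)) ?U"
    by (rule openin_hilb_chart_domain[OF base_chart])
  have reg_g: "g \<in> regular (hilb 5) ?U"
    unfolding g_def by (rule regular_hilb_polynomial[OF base_chart openU order.refl])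
  have "g \<in> ideal_sheaf (hilb 5) curve_Y ?U"
    using reg_g curve_Y_coord assms(2)
    by (auto simp: ideal_sheaf_def g_def test_monom_def hilb_chart_domain_iff[OF base_chart(1,2)])
  then have "\<phi> ?U g \<in> ideal_sheaf (hilb 5) curve_Y ?U"
    using split openU unfolding compatibly_split_def by blast
  moreover have limU: "limit_ideal \<in> ?U"
    using is_ideal_limit_ideal limit_ideal_base_chart by (simp add: hilb_chart_domain_iff[OF base_chart(1,2)])
  ultimately have zero: "\<phi> ?U g limit_ideal = 0" and reg: "\<phi> ?U g \<in> regular (hilb 5) ?U"
    using limit_ideal_in_curve_Y by (auto simp: ideal_sheaf_def)
  obtain \<tau> \<sigma> where \<tau>: "standard_splitting vars5 \<tau>"
    and \<sigma>: "agrees_along (affine_space vars5) \<tau> (orbit 5) (symmetric_product 5) \<sigma>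
      (topspace (zariski (symmetric_product 5)))"
    and \<sigma>\<phi>: "agrees_along (symmetric_product 5) \<sigma> (\<lambda>s. vanishing_ideal (set_mset s)) (hilb 5) \<phi> (distinct_locus 5)"
    using assms(4) unfolding induced_splitting_def by blast
  obtain d where d: "\<And>t :: 'k. peval det_basis (curve_point t) = t ^ 8 * poly d t" "poly d 0 = 2 ^ 9"
    using det_basis_curve_point by blast
  obtain r where r: "\<And>t :: 'k. peval (standard_splitting_poly vars5 (test_poly p)) (curve_point t) = t ^ 16 * poly r t"
    "poly r 0 = - (2 ^ 19)"
    using test_poly_curve_point[OF \<tau> assms(1,2)] by blast
  \<comment> \<open>Regularity offers a quotient in the coordinates of an unspecified chart around
    the limit.\<close>
  have "\<exists>(D, c)\<in>{(hilb_chart_domain 5 B, hilb_coord B) | B. finite B \<and> card B = 5 \<and> order_ideal B}.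
      \<exists>W P Q. openin (zariski (hilb 5)) W \<and> limit_ideal \<in> W \<and> W \<subseteq> ?U \<inter> D \<and>
      (\<forall>y\<in>W. peval Q (c y) \<noteq> 0 \<and> \<phi> ?U g y = peval P (c y) / peval Q (c y))"
    using reg[unfolded regular_hilb charts_regular_def zariski_hilb[symmetric]] limU by simp
  then obtain B W P Q where B: "finite B" "card B = 5" and W: "openin (zariski (hilb 5)) W" "limit_ideal \<in> W"
      "W \<subseteq> ?U \<inter> hilb_chart_domain 5 B"
    and PQ: "\<forall>I\<in>W. peval Q (hilb_coord B I) \<noteq> 0 \<and> \<phi> ?U g I = peval P (hilb_coord B I) / peval Q (hilb_coord B I)"
    by auto
  have bm: "basis_mod (limit_ideal :: 'k poly poly set) B xy_monom"
    using W(2,3) by (auto simp: hilb_chart_domain_iff[OF B])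
  obtain C where C: "\<And>t :: 'k. basis_mod (ideal_family t) B xy_monom \<Longrightarrow> hilb_coord B (ideal_family t) = (\<lambda>v. poly (C v) t)"
    using ideal_family_coord_polynomial[OF char B bm] by blast
  obtain P' where P': "\<And>t. peval P (\<lambda>v. poly (C v) t) = poly P' t"
    using peval_polynomial_family[of P C] by blast
  obtain Q' where Q': "\<And>t. peval Q (\<lambda>v. poly (C v) t) = poly Q' t"
    using peval_polynomial_family[of Q C] by blast
  have on_W: "poly Q' t \<noteq> 0 \<and> \<phi> ?U g (ideal_family t) = poly P' t / poly Q' t" if "ideal_family t \<in> W" for t
  proof -
    have "basis_mod (ideal_family t) B xy_monom"
      using that W(3) by (auto simp: hilb_chart_domain_iff[OF B])
    then show ?thesis
      using bspec[OF PQ that] by (simp add: C P' Q')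
  qed
  have nonzero: "eventually (\<lambda>t :: 'k. t \<noteq> 0) cofinite"
    using eventually_poly_nonzero[of "[:0, 1:] :: 'k poly"] by simp
  \<comment> \<open>Where the points are distinct, the image is both P'/Q' and r/d^2, as t^16
    cancels. Cross-multiplied, this is an identity of polynomials at all but finitely many
    parameters, so it also holds at 0.\<close>
  have "eventually (\<lambda>t. poly (P' * d ^ 2) t = poly (r * Q') t) cofinite"
    using eventually_ideal_family_open[OF char W(1,2)] eventually_good_points[OF char] nonzero
  proof eventually_elim
    case (elim t)
    then have t: "t \<noteq> 0" by simp
    have "\<phi> ?U g (ideal_family t) = t ^ 16 * poly r t / (t ^ 8 * poly d t) ^ 2"
      using induced_splitting_value[OF assms(1) _ assms(4) \<tau> \<sigma> \<sigma>\<phi> elim(2)] assms(2) t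
      by (simp add: g_def[symmetric] ideal_family_def d(1) r(1))
    moreover have "poly d t \<noteq> 0"
      using elim(2) d(1)[of t] by (auto simp: good_points_def point_ideal_in_good_locus_iff)
    ultimately show ?case
      using on_W[OF elim(1)] t by (simp add: field_simps flip: power_mult)
  qed
  then have "P' * d ^ 2 = r * Q'" by (rule poly_eqI_eventually)
  then have "poly P' 0 * poly d 0 ^ 2 = poly r 0 * poly Q' 0"
    by (metis poly_mult poly_power)
  moreover have "poly Q' 0 \<noteq> 0" "poly P' 0 = 0"
    using on_W[of 0] W(2) zero by (auto simp: ideal_family_def)
  \<comment> \<open>The left side vanishes by compatibility while \<open>poly Q' 0\<close> is
    nonzero, so \<open>poly r 0\<close> would have to vanish.\<close>
  ultimately have "(2 :: 'k) ^ 19 = 0" unfolding r(2) by simp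
  then show False using power_not_zero[OF two_nonzero(1)[OF char]] by blast
qed

end
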